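(* Let $C_n$ denote the cycle on $n$ vertices with $n\geq 4$. Then $\operatorname{depth}\bigl(R/I(C_n)^{[2]}\bigr)= \left\lceil\frac{n}{3}\right\rceil+1$.
   Context: All graphs are finite and simple. Fix a field $\mathbb{K}$. For a graph $G$ with vertex set $V(G)$ (vertices are identified with indeterminates), $R=\mathbb{K}[x\mid x\in V(G)]$ and $I(G)=\langle xy\mid \{x,y\}\in E(G)\rangle\subseteq R$ is the edge ideal. The second square-free power $I(G)^{[2]}$ is the ideal of $R$ generated by the square-free monomials of $I(G)^2$; equivalently it is generated by the products $abcd$ over all pairs of disjoint edges $\{a,b\},\{c,d\}$ of $G$. The cycle $C_n$ has vertices $x_1,\dots,x_n$ and edges $\{x_i,x_{i+1}\}$ for $1\le i\le n-1$ and $\{x_1,x_n\}$; here $R=\mathbb{K}[x_1,\dots,x_n]$. *)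

theory Defs
  imports
    "HOL-Library.Poly_Mapping"
    "HOL-Library.Extended_Nat"
    "HOL-Algebra.Module"
    "HOL-Algebra.QuotRing"
    "HOL-Algebra.Ideal_Product"
begin

section \<open>Polynomial rings\<close>

text \<open>
  A monomial is an exponent vector \<open>'v \<Rightarrow>\<^sub>0 nat\<close> and a polynomial a finitely supported
  family of coefficients indexed by monomials. The type \<open>'v\<close> may have more elements than the
  set \<open>V\<close> of indeterminates; \<open>poly_ring V\<close> is the polynomial ring in the elements of \<open>V\<close> only.
\<close>

definition poly_ring :: "'v set \<Rightarrow> (('v \<Rightarrow>\<^sub>0 nat) \<Rightarrow>\<^sub>0 'k::field) ring" where
  "poly_ring V =
    \<lparr>carrier = {p. \<forall>m\<in>Poly_Mapping.keys p. Poly_Mapping.keys m \<subseteq> V},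
     mult = (*), one = 1, zero = 0, add = (+)\<rparr>"

definition monomial :: "('v \<Rightarrow>\<^sub>0 nat) \<Rightarrow> (('v \<Rightarrow>\<^sub>0 nat) \<Rightarrow>\<^sub>0 'k::field)" where
  "monomial m = Poly_Mapping.single m 1"

definition indet :: "'v \<Rightarrow> (('v \<Rightarrow>\<^sub>0 nat) \<Rightarrow>\<^sub>0 'k::field)" where
  "indet x = monomial (Poly_Mapping.single x 1)"

definition squarefree_exp :: "('v \<Rightarrow>\<^sub>0 nat) \<Rightarrow> bool" where
  "squarefree_exp m \<longleftrightarrow> (\<forall>x. Poly_Mapping.lookup m x \<le> 1)"

definition irrelevant_ideal :: "'v set \<Rightarrow> (('v \<Rightarrow>\<^sub>0 nat) \<Rightarrow>\<^sub>0 'k::field) set" where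
  "irrelevant_ideal V = Idl\<^bsub>poly_ring V\<^esub> (indet ` V)"

lemma cring_poly_ring: "cring (poly_ring V :: (('v \<Rightarrow>\<^sub>0 nat) \<Rightarrow>\<^sub>0 'k::field) ring)"
proof (rule cringI)
  let ?R = "poly_ring V :: (('v \<Rightarrow>\<^sub>0 nat) \<Rightarrow>\<^sub>0 'k) ring"
  have add: "p + q \<in> carrier ?R" if "p \<in> carrier ?R" "q \<in> carrier ?R" for p q
    using that keys_add[of p q] by (auto simp: poly_ring_def)
  have uminus: "- p \<in> carrier ?R" if "p \<in> carrier ?R" for p
    using that by (simp add: poly_ring_def)
  have mult: "p * q \<in> carrier ?R" if p: "p \<in> carrier ?R" and q: "q \<in> carrier ?R" for p q
  proof -
    have "Poly_Mapping.keys m \<subseteq> V" if "m \<in> Poly_Mapping.keys (p * q)" for m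
    proof -
      from that obtain a b where "m = a + b" "a \<in> Poly_Mapping.keys p" "b \<in> Poly_Mapping.keys q"
        using keys_mult[of p q] by auto
      then show ?thesis
        using p q keys_add[of a b] by (simp add: poly_ring_def) (meson Un_least order_trans)
    qed
    then show ?thesis by (simp add: poly_ring_def)
  qed
  have closed: "0 \<in> carrier ?R" "1 \<in> carrier ?R"
    by (simp_all add: poly_ring_def)
  have ops: "add ?R = (+)" "monoid.mult ?R = (*)" "zero ?R = 0" "one ?R = 1"
    by (simp_all add: poly_ring_def)
  show "abelian_group ?R"
  proof (rule abelian_groupI; unfold ops)
    fix p assume "p \<in> carrier ?R"
    then show "\<exists>q\<in>carrier ?R. q + p = 0"
      using uminus by (intro bexI[of _ "- p"]) simp_all
  qed (simp_all add: add closed ac_simps)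
  show "Group.comm_monoid ?R"
    by (rule comm_monoidI; unfold ops) (simp_all add: mult closed ac_simps)
  show "(p \<oplus>\<^bsub>?R\<^esub> q) \<otimes>\<^bsub>?R\<^esub> r = p \<otimes>\<^bsub>?R\<^esub> r \<oplus>\<^bsub>?R\<^esub> q \<otimes>\<^bsub>?R\<^esub> r" for p q r
    unfolding ops by (rule distrib_right)
qed


section \<open>Depth\<close>

text \<open>The ring \<open>R/I\<close> regarded as an \<open>R\<close>-module.\<close>

definition quotient_module :: "('a, 'c) ring_scheme \<Rightarrow> 'a set \<Rightarrow> ('a, 'a set) module" where
  "quotient_module R I =
    \<lparr>carrier = carrier (R Quot I), mult = mult (R Quot I), one = one (R Quot I),
     zero = zero (R Quot I), add = add (R Quot I),
     smult = (\<lambda>a X. (I +>\<^bsub>R\<^esub> a) \<otimes>\<^bsub>R Quot I\<^esub> X)\<rparr>"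

lemma module_quotient_module:
  assumes "cring R" "ideal I R"
  shows "module R (quotient_module R I)"
proof -
  interpret I: ideal I R by fact
  interpret Q: cring "R Quot I"
    using I.quotient_is_cring[OF \<open>cring R\<close>] .
  interpret h: ring_hom_ring R "R Quot I" "(+>\<^bsub>R\<^esub>) I"
    by (rule I.rcos_ring_hom_ring)
  have abelian: "abelian_group (quotient_module R I)"
  proof (rule abelian_groupI)
    fix X assume "X \<in> carrier (quotient_module R I)"
    then show "\<exists>Y\<in>carrier (quotient_module R I).
        Y \<oplus>\<^bsub>quotient_module R I\<^esub> X = \<zero>\<^bsub>quotient_module R I\<^esub>"
      unfolding quotient_module_def
      using Q.a_inv_closed[of X] Q.l_neg[of X] by auto
  qed (simp_all add: quotient_module_def Q.a_ac)
  have smult: "a \<odot>\<^bsub>quotient_module R I\<^esub> X = (I +>\<^bsub>R\<^esub> a) \<otimes>\<^bsub>R Quot I\<^esub> X" for a X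
    by (simp add: quotient_module_def)
  have carrier: "carrier (quotient_module R I) = carrier (R Quot I)"
    and add: "add (quotient_module R I) = add (R Quot I)"
    by (simp_all add: quotient_module_def)
  show ?thesis
    by (rule moduleI[OF \<open>cring R\<close> abelian]; unfold smult carrier add)
      (simp_all add: Q.l_distr Q.r_distr Q.m_assoc)
qed

text \<open>\<open>seq_submodule R M [f\<^sub>1, \<dots>, f\<^sub>r]\<close> is the submodule \<open>(f\<^sub>1, \<dots>, f\<^sub>r)M\<close>.\<close>

definition seq_submodule :: "('a, 'c) ring_scheme \<Rightarrow> ('a, 'b, 'd) module_scheme \<Rightarrow> 'a list \<Rightarrow> 'b set" where
  "seq_submodule R M fs =
    (\<lambda>N. submodule N R M) hull {f \<odot>\<^bsub>M\<^esub> x | f x. f \<in> set fs \<and> x \<in> carrier M}"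

text \<open>
  The first condition says that the element of index \<open>i\<close> is a nonzerodivisor on
  \<open>M/(f\<^sub>1, \<dots>, f\<^sub>i)M\<close> (the sequence \<open>fs\<close> is indexed from 0), stated on representatives.
\<close>

definition regular_sequence ::
  "('a, 'c) ring_scheme \<Rightarrow> ('a, 'b, 'd) module_scheme \<Rightarrow> 'a list \<Rightarrow> bool" where
  "regular_sequence R M fs \<longleftrightarrow>
     set fs \<subseteq> carrier R \<and>
     (\<forall>i<length fs. \<forall>x\<in>carrier M.
        (fs ! i) \<odot>\<^bsub>M\<^esub> x \<in> seq_submodule R M (take i fs) \<longrightarrow> x \<in> seq_submodule R M (take i fs)) \<and>
     seq_submodule R M fs \<noteq> carrier M"

text \<open>
  The depth of \<open>M\<close> with respect to an ideal \<open>J\<close>, for \<open>JM \<noteq> M\<close>; the convention that the depth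
  is infinite if \<open>JM = M\<close> is not built in.
\<close>

definition depth :: "('a, 'c) ring_scheme \<Rightarrow> 'a set \<Rightarrow> ('a, 'b, 'd) module_scheme \<Rightarrow> enat" where
  "depth R J M = (SUP fs \<in> {fs. set fs \<subseteq> J \<and> regular_sequence R M fs}. enat (length fs))"

text \<open>As usual for graded modules, depth over a polynomial ring refers to the irrelevant ideal.\<close>

definition depth_quotient :: "'v set \<Rightarrow> (('v \<Rightarrow>\<^sub>0 nat) \<Rightarrow>\<^sub>0 'k::field) set \<Rightarrow> enat" where
  "depth_quotient V I = depth (poly_ring V) (irrelevant_ideal V) (quotient_module (poly_ring V) I)"


section \<open>Edge ideals\<close>

text \<open>A simple graph is given by its vertex set \<open>V\<close> and its set \<open>E\<close> of two-element edges.\<close>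

definition edge_ideal :: "'v set \<Rightarrow> 'v set set \<Rightarrow> (('v \<Rightarrow>\<^sub>0 nat) \<Rightarrow>\<^sub>0 'k::field) set" where
  "edge_ideal V E = Idl\<^bsub>poly_ring V\<^esub> {indet x * indet y | x y. {x, y} \<in> E}"

definition squarefree_square ::
  "'v set \<Rightarrow> (('v \<Rightarrow>\<^sub>0 nat) \<Rightarrow>\<^sub>0 'k::field) set \<Rightarrow> (('v \<Rightarrow>\<^sub>0 nat) \<Rightarrow>\<^sub>0 'k) set" where
  "squarefree_square V I =
    Idl\<^bsub>poly_ring V\<^esub> {monomial m | m. squarefree_exp m \<and> monomial m \<in> I \<cdot>\<^bsub>poly_ring V\<^esub> I}"

definition cycle_vertices :: "nat \<Rightarrow> nat set" where
  "cycle_vertices n = {1..n}"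

definition cycle_edges :: "nat \<Rightarrow> nat set set" where
  "cycle_edges n = {{i, i + 1} | i. 1 \<le> i \<and> i \<le> n - 1} \<union> {{1, n}}"

end

theory Submission
  imports Defs
begin

text \<open>
  The second square-free power of \<open>I(C\<^sub>n)\<close> is the ideal of nonfaces of the complex \<open>\<Delta>\<close> of vertex sets that do not contain two disjoint
  edges.

  Lower bound. The complete homogeneous polynomials \<open>h\<^sub>1, \<dots>, h\<^sub>d\<close> in all the variables form a regular
  sequence on \<open>K[F]\<close> for every face \<open>F\<close> with at least \<open>d\<close> vertices, over any field, and by the exact
  sequence \<open>0 \<rightarrow> R/(J : u) \<rightarrow> R/J \<rightarrow> R/(J + uR) \<rightarrow> 0\<close> such a fixed sequence is regular on \<open>R/J\<close> if it is so on
  the two outer terms. It remains to split \<open>\<Delta>\<close> by monomials \<open>u\<close> into large simplices. Split off the edges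
  \<open>{1, 2}, \<dots>, {n - 3, n - 2}\<close> one after the other: the colon ideals are edge ideals of a cycle on \<open>n - 2\<close>
  vertices or of a path on \<open>n - 3\<close> vertices, with two more free variables. What is left is split by
  \<open>{1, n - 2}\<close> into a cycle on \<open>n - 2\<close> vertices and two paths on \<open>n - 6\<close> vertices.

  Upper bound. If \<open>J\<close> admits a regular sequence of length \<open>r\<close>, the Koszul cohomology of \<open>R/J\<close> with
  respect to the squares of the variables vanishes below degree \<open>r\<close>. The dominating set \<open>F\<close> of the
  vertices that are 1 modulo 3 has a disconnected link in \<open>\<Delta>\<close>, and this gives a nonzero class in
  degree \<open>card F + 1\<close>.
\<close>


section \<open>Regular sequences modulo ideals of a subring\<close>

text \<open>The lower bound rests on the fact that depth does not drop below the minimum over the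
  outer terms of a short exact sequence. One sequence that suits all simplices at once makes this
  elementary. Generic linear forms would serve over an infinite field, but may not exist over a
  finite one; complete homogeneous polynomials are monic in each variable over every field. Edges
  are split off because the depths of the edge ideals of a path, ceiling(m/3), and of a cycle,
  ceiling((m-1)/3), are reached by splitting at vertices. With two free variables, a path on n-3 and
  a cycle on n-2 vertices both give exactly ceiling(n/3)+1. The upper bound is Hochster's formula in
  multidegree -F, read off one Koszul complex instead of local cohomology. Squares are the smallest
  powers that show this degree: the monomial x_a^2 x_F has F in its support and so sees the link of
  F, but no x_u^2 with u in F divides it. With the variables themselves the representative would be
  x_a, which has lost F.\<close>

locale comm_subring =
  fixes A :: "'a::comm_ring_1 set"
  assumes zero_mem [simp, intro]: "0 \<in> A"
    and one_mem [simp, intro]: "1 \<in> A"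
    and add_mem [intro]: "a \<in> A \<Longrightarrow> b \<in> A \<Longrightarrow> a + b \<in> A"
    and mult_mem [intro]: "a \<in> A \<Longrightarrow> b \<in> A \<Longrightarrow> a * b \<in> A"
    and uminus_mem [intro]: "a \<in> A \<Longrightarrow> - a \<in> A"
begin

lemma diff_mem [intro]: "a \<in> A \<Longrightarrow> b \<in> A \<Longrightarrow> a - b \<in> A"
  using add_mem[of a "- b"] by auto

lemma sum_mem [intro]: "(\<And>i. i \<in> I \<Longrightarrow> g i \<in> A) \<Longrightarrow> sum g I \<in> A"
  by (induction I rule: infinite_finite_induct) auto

lemma power_mem [intro]: "a \<in> A \<Longrightarrow> a ^ k \<in> A"
  by (induction k) auto

definition ideal_in :: "'a set \<Rightarrow> bool" where
  "ideal_in N \<longleftrightarrow> N \<subseteq> A \<and> 0 \<in> N \<and> (\<forall>x\<in>N. \<forall>y\<in>N. x + y \<in> N) \<and> (\<forall>a\<in>A. \<forall>x\<in>N. a * x \<in> N)"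

lemma ideal_inD:
  assumes "ideal_in N"
  shows "N \<subseteq> A" "0 \<in> N" "x \<in> N \<Longrightarrow> y \<in> N \<Longrightarrow> x + y \<in> N"
    "a \<in> A \<Longrightarrow> x \<in> N \<Longrightarrow> a * x \<in> N" "x \<in> N \<Longrightarrow> x \<in> A"
    "x \<in> N \<Longrightarrow> - x \<in> N" "x \<in> N \<Longrightarrow> y \<in> N \<Longrightarrow> x - y \<in> N"
    "a \<in> A \<Longrightarrow> x \<in> N \<Longrightarrow> x * a \<in> N"
proof -
  show 1: "N \<subseteq> A" "0 \<in> N" "x \<in> N \<Longrightarrow> y \<in> N \<Longrightarrow> x + y \<in> N"
    "a \<in> A \<Longrightarrow> x \<in> N \<Longrightarrow> a * x \<in> N" "x \<in> N \<Longrightarrow> x \<in> A" for x y a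
    using assms by (auto simp: ideal_in_def)
  show 2: "x \<in> N \<Longrightarrow> - x \<in> N" for x
    using 1(4)[of "- 1" x] by auto
  show "x \<in> N \<Longrightarrow> y \<in> N \<Longrightarrow> x - y \<in> N"
    using 1(3)[of x "- y"] 2[of y] by auto
  show "a \<in> A \<Longrightarrow> x \<in> N \<Longrightarrow> x * a \<in> N"
    using 1(4)[of a x] by (simp add: mult.commute)
qed

lemma ideal_in_sum:
  assumes "ideal_in N" "\<And>i. i \<in> I \<Longrightarrow> g i \<in> N"
  shows "sum g I \<in> N"
  using assms(2) by (induction I rule: infinite_finite_induct) (auto simp: ideal_inD[OF assms(1)])

lemma ideal_in_cong:
  assumes "ideal_in N" "x - y \<in> N"
  shows "x \<in> N \<longleftrightarrow> y \<in> N"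
  using ideal_inD(3)[OF assms(1), of "x - y" y] ideal_inD(7)[OF assms(1), of x "x - y"] assms(2)
  by auto

definition adjoin :: "'a set \<Rightarrow> 'a \<Rightarrow> 'a set" where
  "adjoin N f = {x + f * a | x a. x \<in> N \<and> a \<in> A}"

lemma adjoinI: "x \<in> N \<Longrightarrow> a \<in> A \<Longrightarrow> x + f * a \<in> adjoin N f"
  by (auto simp: adjoin_def)

lemma adjoinE:
  assumes "p \<in> adjoin N f"
  obtains x a where "x \<in> N" "a \<in> A" "p = x + f * a"
  using assms by (auto simp: adjoin_def)

lemma ideal_in_adjoin:
  assumes N: "ideal_in N" and f: "f \<in> A"
  shows "ideal_in (adjoin N f)"
  unfolding ideal_in_def
proof (intro conjI ballI)
  note I = ideal_inD[OF N]
  show "adjoin N f \<subseteq> A" using f I(5) by (auto simp: adjoin_def)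
  show "0 \<in> adjoin N f" using adjoinI[of 0 N 0 f] I(2) by auto
  show "p + q \<in> adjoin N f" if p: "p \<in> adjoin N f" and q: "q \<in> adjoin N f" for p q
  proof -
    from p obtain x a where "x \<in> N" "a \<in> A" "p = x + f * a" by (rule adjoinE)
    moreover from q obtain y b where "y \<in> N" "b \<in> A" "q = y + f * b" by (rule adjoinE)
    ultimately show ?thesis
      using adjoinI[of "x + y" N "a + b" f] I(3)[of x y] by (auto simp: algebra_simps)
  qed
  show "c * p \<in> adjoin N f" if c: "c \<in> A" and p: "p \<in> adjoin N f" for c p
  proof -
    from p obtain x a where "x \<in> N" "a \<in> A" "p = x + f * a" by (rule adjoinE)
    then show ?thesis
      using adjoinI[of "c * x" N "c * a" f] I(4)[of c x] c by (auto simp: algebra_simps)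
  qed
qed

lemma adjoin_superset: "N \<subseteq> adjoin N f"
  using adjoinI[of _ N 0 f] by auto

lemma adjoin_self: "ideal_in N \<Longrightarrow> f \<in> adjoin N f"
  using adjoinI[of 0 N 1 f] by (auto simp: ideal_inD)

lemma adjoin_least:
  assumes "ideal_in P" "N \<subseteq> P" "f \<in> P"
  shows "adjoin N f \<subseteq> P"
  using assms(2,3) ideal_inD(3,8)[OF assms(1)] by (auto simp: adjoin_def)

lemma adjoin_commute:
  assumes N: "ideal_in N" and "f \<in> A" "g \<in> A"
  shows "adjoin (adjoin N f) g = adjoin (adjoin N g) f"
proof -
  have "adjoin (adjoin N f) g \<subseteq> adjoin (adjoin N g) f" if "f \<in> A" "g \<in> A" for f g
  proof (rule adjoin_least)
    show P: "ideal_in (adjoin (adjoin N g) f)" using N that by (intro ideal_in_adjoin)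
    show "g \<in> adjoin (adjoin N g) f"
      using adjoin_superset[of "adjoin N g" f] adjoin_self[OF N, of g] by auto
    show "adjoin N f \<subseteq> adjoin (adjoin N g) f"
      using adjoin_superset[of "adjoin N g" f] adjoin_superset[of N g] N that
      by (intro adjoin_least[OF P] adjoin_self ideal_in_adjoin) auto
  qed
  from this[of f g] this[of g f] assms(2,3) show ?thesis by auto
qed

lemma adjoin_cong:
  assumes N: "ideal_in N" and fg: "f - g \<in> N" and mem: "f \<in> A" "g \<in> A"
  shows "adjoin N f = adjoin N g"
proof -
  have "adjoin N f \<subseteq> adjoin N g" if fg: "f - g \<in> N" "g \<in> A" for f g
  proof (rule adjoin_least)
    show I: "ideal_in (adjoin N g)" using N that by (intro ideal_in_adjoin)
    show "N \<subseteq> adjoin N g" by (rule adjoin_superset)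
    show "f \<in> adjoin N g"
      using ideal_in_cong[OF I, of f g] adjoin_self[OF N, of g] adjoin_superset[of N g] fg by auto
  qed
  from this[of f g] this[of g f] fg mem ideal_inD(6)[OF N fg] show ?thesis by auto
qed

text \<open>Regularity without the properness condition \<open>(f\<^sub>1, \<dots>, f\<^sub>r)M \<noteq> M\<close>, for \<open>M = A/N\<close>.\<close>

primrec weakly_regular :: "'a list \<Rightarrow> 'a set \<Rightarrow> bool" where
  "weakly_regular [] N \<longleftrightarrow> True"
| "weakly_regular (f # fs) N \<longleftrightarrow>
     (\<forall>p\<in>A. f * p \<in> N \<longrightarrow> p \<in> N) \<and> weakly_regular fs (adjoin N f)"

lemma weakly_regular_carrier: "set fs \<subseteq> A \<Longrightarrow> weakly_regular fs A"
proof (induction fs)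
  case (Cons f fs)
  have "adjoin A f = A"
    using Cons.prems adjoin_superset[of A f] by (auto simp: adjoin_def)
  with Cons show ?case by auto
qed auto

lemma weakly_regular_cong_head:
  assumes N: "ideal_in N" and "f - g \<in> N" "f \<in> A" "g \<in> A"
  shows "weakly_regular (f # fs) N \<longleftrightarrow> weakly_regular (g # fs) N"
proof -
  have "f * p \<in> N \<longleftrightarrow> g * p \<in> N" if "p \<in> A" for p
    using ideal_in_cong[OF N, of "f * p" "g * p"] ideal_inD(8)[OF N that \<open>f - g \<in> N\<close>]
    by (simp add: algebra_simps)
  with adjoin_cong[OF assms] show ?thesis by auto
qed

text \<open>The sequence is regular on the outer terms of
  \<open>0 \<rightarrow> A/(N : u) \<rightarrow> A/N \<rightarrow> A/(N + uA) \<rightarrow> 0\<close>, hence on the middle one.\<close>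

lemma weakly_regular_split:
  assumes "ideal_in N" "u \<in> A" "set fs \<subseteq> A"
    and "weakly_regular fs {p \<in> A. u * p \<in> N}" "weakly_regular fs (adjoin N u)"
  shows "weakly_regular fs N"
  using assms
proof (induction fs arbitrary: N)
  case (Cons f fs)
  note I = ideal_inD[OF Cons.prems(1)]
  have f: "f \<in> A" and u: "u \<in> A" using Cons.prems by auto
  have colon: "\<And>p. p \<in> A \<Longrightarrow> u * (f * p) \<in> N \<Longrightarrow> u * p \<in> N"
    and plus: "\<And>p. p \<in> A \<Longrightarrow> f * p \<in> adjoin N u \<Longrightarrow> p \<in> adjoin N u"
    using Cons.prems f by auto
  have "p \<in> N" if p: "p \<in> A" "f * p \<in> N" for p
  proof -
    from plus[OF p(1)] p(2) adjoin_superset[of N u] have "p \<in> adjoin N u" by auto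
    then obtain n s where ns: "n \<in> N" "s \<in> A" "p = n + u * s" by (rule adjoinE)
    have "u * (f * s) = f * p - f * n" using ns by (simp add: algebra_simps)
    also have "\<dots> \<in> N" using p(2) I(7) I(4)[OF f ns(1)] by auto
    finally have "u * s \<in> N" using colon ns by auto
    with ns I(3) show ?thesis by auto
  qed
  moreover have "weakly_regular fs (adjoin N f)"
  proof (rule Cons.IH)
    show "ideal_in (adjoin N f)" "u \<in> A" "set fs \<subseteq> A"
      using Cons.prems f by (auto intro: ideal_in_adjoin)
    \<comment> \<open>The colon by \<open>u\<close> commutes with adding \<open>f\<close>, because
      \<open>f\<close> is a nonzerodivisor modulo \<open>N + uA\<close>. So the exact sequence stays
      exact modulo \<open>f\<close> and the induction can go on.\<close>
    have "{p \<in> A. u * p \<in> adjoin N f} = adjoin {p \<in> A. u * p \<in> N} f"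
    proof (intro equalityI subsetI)
      fix p assume "p \<in> {p \<in> A. u * p \<in> adjoin N f}"
      then have p: "p \<in> A" and "u * p \<in> adjoin N f" by auto
      from this(2) obtain n q where nq: "n \<in> N" "q \<in> A" "u * p = n + f * q" by (rule adjoinE)
      have "f * q = - n + u * p" using nq by (simp add: algebra_simps)
      then have "f * q \<in> adjoin N u" using adjoinI[of "- n" N p u] nq p I(6) by auto
      then have "q \<in> adjoin N u" using plus nq by auto
      then obtain n' s where ns: "n' \<in> N" "s \<in> A" "q = n' + u * s" by (rule adjoinE)
      have "u * (p - f * s) = n + f * n'" using nq ns by (simp add: algebra_simps)
      also have "\<dots> \<in> N" using nq ns I(3) I(4)[OF f] by auto
      finally have "p - f * s \<in> {p \<in> A. u * p \<in> N}" using p f ns by auto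
      from adjoinI[OF this ns(2), of f] show "p \<in> adjoin {p \<in> A. u * p \<in> N} f" by auto
    next
      fix p assume "p \<in> adjoin {p \<in> A. u * p \<in> N} f"
      then obtain n a where na: "n \<in> A" "u * n \<in> N" "a \<in> A" "p = n + f * a"
        by (auto elim: adjoinE)
      then have "u * p = u * n + f * (u * a)" by (simp add: algebra_simps)
      then show "p \<in> {p \<in> A. u * p \<in> adjoin N f}"
        using adjoinI[of "u * n" N "u * a" f] na f u by auto
    qed
    then show "weakly_regular fs {p \<in> A. u * p \<in> adjoin N f}" using Cons.prems by auto
    show "weakly_regular fs (adjoin (adjoin N f) u)"
      using Cons.prems adjoin_commute[of N f u] f u by auto
  qed
  ultimately show ?case by auto
qed auto

text \<open>Regular sequences cannot be permuted freely outside the local setting. Moving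
  \<open>f\<close> to the front works since \<open>f\<close> is a nonzerodivisor modulo every
  initial segment of \<open>gs\<close>: if \<open>g * p = n + f * q\<close>, then \<open>q\<close>
  lies in \<open>N + gA\<close>, and cancelling \<open>g\<close> puts \<open>p\<close> into
  \<open>N + fA\<close>.\<close>

lemma weakly_regular_Cons_swap:
  assumes "ideal_in N" "f \<in> A" "set gs \<subseteq> A" "weakly_regular gs N"
    and "\<And>i p. i \<le> length gs \<Longrightarrow> p \<in> A \<Longrightarrow> f * p \<in> foldl adjoin N (take i gs) \<Longrightarrow>
           p \<in> foldl adjoin N (take i gs)"
  shows "weakly_regular (f # gs) N"
  using assms
proof (induction gs arbitrary: N)
  case Nil
  then show ?case by simp
next
  case (Cons g gs)
  note I = ideal_inD[OF Cons.prems(1)]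
  have f: "f \<in> A" and g: "g \<in> A" using Cons.prems by auto
  have IH: "weakly_regular (f # gs) (adjoin N g)"
    using Cons.prems(3,4) Cons.prems(5)[of "Suc i" for i]
    by (intro Cons.IH ideal_in_adjoin Cons.prems) auto
  have reg_f: "p \<in> N" if "p \<in> A" "f * p \<in> N" for p using Cons.prems(5)[of 0 p] that by auto
  have reg_fg: "p \<in> adjoin N g" if "p \<in> A" "f * p \<in> adjoin N g" for p
    using Cons.prems(5)[of 1 p] that by auto
  have "p \<in> adjoin N f" if p: "p \<in> A" "g * p \<in> adjoin N f" for p
  proof -
    from p(2) obtain n q where nq: "n \<in> N" "q \<in> A" "g * p = n + f * q" by (rule adjoinE)
    have "f * q = - n + g * p" using nq by (simp add: algebra_simps)
    then have "f * q \<in> adjoin N g" using adjoinI[of "- n" N p g] nq p I(6) by auto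
    then have "q \<in> adjoin N g" using reg_fg nq by auto
    then obtain n' s where ns: "n' \<in> N" "s \<in> A" "q = n' + g * s" by (rule adjoinE)
    have "g * (p - f * s) = n + f * n'" using nq ns by (simp add: algebra_simps)
    also have "\<dots> \<in> N" using nq ns I(3) I(4)[OF f] by auto
    finally have "p - f * s \<in> N" using p f ns Cons.prems(4) by auto
    from adjoinI[OF this ns(2), of f] show ?thesis by auto
  qed
  with IH reg_f adjoin_commute[OF Cons.prems(1) f g] show ?case by auto
qed

lemma ideal_in_foldl_adjoin: "ideal_in N \<Longrightarrow> set fs \<subseteq> A \<Longrightarrow> ideal_in (foldl adjoin N fs)"
  by (induction fs arbitrary: N) (auto intro: ideal_in_adjoin)

lemma foldl_adjoin_least:
  assumes "ideal_in P" "N \<subseteq> P" "set fs \<subseteq> P"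
  shows "foldl adjoin N fs \<subseteq> P"
  using assms(2,3) by (induction fs arbitrary: N) (auto simp: adjoin_least[OF assms(1)])

lemma foldl_adjoin_superset: "N \<subseteq> foldl adjoin N fs"
proof (induction fs arbitrary: N)
  case (Cons f fs)
  then show ?case using adjoin_superset[of N f] by force
qed auto

lemma foldl_adjoin_contains:
  assumes "ideal_in N" "set fs \<subseteq> A"
  shows "set fs \<subseteq> foldl adjoin N fs"
  using assms
proof (induction fs arbitrary: N)
  case (Cons f fs)
  then show ?case
    using adjoin_self[of N f] foldl_adjoin_superset[of "adjoin N f" fs] ideal_in_adjoin[of N f] by force
qed auto

lemma weakly_regular_iff_nth:
  "weakly_regular fs N \<longleftrightarrow>
     (\<forall>i<length fs. \<forall>p\<in>A. fs ! i * p \<in> foldl adjoin N (take i fs) \<longrightarrow> p \<in> foldl adjoin N (take i fs))"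
proof (induction fs arbitrary: N)
  case (Cons f fs)
  show ?case unfolding weakly_regular.simps Cons.IH by (auto simp: All_less_Suc2)
qed auto

end


subsection \<open>Koszul cochains\<close>

definition alt_sign :: "'i::linorder \<Rightarrow> 'i set \<Rightarrow> 'a::comm_ring_1" where
  "alt_sign v S = (- 1) ^ card {u \<in> S. u < v}"

lemma alt_sign_square: "alt_sign v S * (alt_sign v S * x) = (x :: 'a::comm_ring_1)"
proof -
  have "alt_sign v S * alt_sign v S = (1 :: 'a)"
    unfolding alt_sign_def by (simp flip: power_mult_distrib)
  then show ?thesis by (simp flip: mult.assoc)
qed

lemma alt_sign_swap:
  fixes u v :: "'i::linorder"
  assumes "finite S" "u \<in> S" "v \<in> S" "u \<noteq> v"
  shows "alt_sign v S * alt_sign u (S - {v}) = - (alt_sign u S * alt_sign v (S - {u}) :: 'a::comm_ring_1)"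
proof -
  have "alt_sign v S * alt_sign u (S - {v}) = - (alt_sign u S * alt_sign v (S - {u}) :: 'a)"
    if "u \<in> S" "v \<in> S" "u < v" for u v
  proof -
    have "{w \<in> S - {v}. w < u} = {w \<in> S. w < u}" using that by auto
    moreover have "{w \<in> S. w < v} = insert u {w \<in> S - {u}. w < v}" using that by auto
    then have "card {w \<in> S. w < v} = Suc (card {w \<in> S - {u}. w < v})" using assms(1) by simp
    ultimately show ?thesis by (simp add: alt_sign_def)
  qed
  from this[of u v] this[of v u] assms show ?thesis by (cases "u < v") auto
qed

text \<open>The wedge product with the sum of all \<open>y v\<close> times \<open>e_v\<close>, in
  coordinates: \<open>c S\<close> is the coefficient of \<open>e_S\<close>, and
  \<open>alt_sign v S\<close> is the sign of \<open>e_v\<close> wedge \<open>e_(S - {v})\<close>. No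
  degree is fixed, so one formula covers the whole complex.\<close>

definition koszul :: "('i::linorder \<Rightarrow> 'a::comm_ring_1) \<Rightarrow> ('i set \<Rightarrow> 'a) \<Rightarrow> 'i set \<Rightarrow> 'a" where
  "koszul y c S = (\<Sum>v\<in>S. alt_sign v S * y v * c (S - {v}))"

lemma koszul_empty [simp]: "koszul y c {} = 0"
  by (simp add: koszul_def)

lemma koszul_diff: "koszul y (\<lambda>S. b S - c S) S = koszul y b S - koszul y c S"
  by (simp add: koszul_def algebra_simps sum_subtractf)

lemma koszul_add: "koszul y (\<lambda>S. b S + c S) S = koszul y b S + koszul y c S"
  by (simp add: koszul_def algebra_simps sum.distrib)

lemma koszul_mult: "koszul y (\<lambda>S. r * c S) S = r * koszul y c S"
  by (simp add: koszul_def sum_distrib_left mult_ac)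

text \<open>Removing \<open>v\<close> and then \<open>u\<close> cancels against removing
  \<open>u\<close> and then \<open>v\<close>. The double sum is cut into \<open>u < v\<close> and
  \<open>v < u\<close>, since antisymmetry alone would only show that twice the sum is zero.\<close>

lemma koszul_koszul:
  assumes "finite S"
  shows "koszul y (koszul y c) S = 0"
proof -
  define g where "g v u = alt_sign v S * alt_sign u (S - {v}) * (y v * y u * c (S - {v} - {u}))" for v u
  have anti: "g v u = - g u v" if "u \<in> S" "v \<in> S" "u \<noteq> v" for u v
  proof -
    have "S - {v} - {u} = S - {u} - {v}" by auto
    then show ?thesis
      using alt_sign_swap[OF assms that, where 'a='b] by (simp add: g_def mult_ac(2))
  qed
  have "koszul y (koszul y c) S = (\<Sum>v\<in>S. \<Sum>u\<in>S - {v}. g v u)"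
    by (simp add: koszul_def g_def sum_distrib_left mult_ac)
  also have "\<dots> = (\<Sum>v\<in>S. (\<Sum>u\<in>{u \<in> S. u < v}. g v u) + (\<Sum>u\<in>{u \<in> S. v < u}. g v u))"
  proof (rule sum.cong)
    fix v assume "v \<in> S"
    have eq: "S - {v} = {u \<in> S. u < v} \<union> {u \<in> S. v < u}" by auto
    show "(\<Sum>u\<in>S - {v}. g v u) = (\<Sum>u\<in>{u \<in> S. u < v}. g v u) + (\<Sum>u\<in>{u \<in> S. v < u}. g v u)"
      unfolding eq by (rule sum.union_disjoint) (use assms in auto)
  qed auto
  also have "\<dots> = (\<Sum>v\<in>S. \<Sum>u\<in>{u \<in> S. u < v}. g v u) + (\<Sum>v\<in>S. \<Sum>u\<in>{u \<in> S. v < u}. g v u)"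
    by (rule sum.distrib)
  also have "(\<Sum>v\<in>S. \<Sum>u\<in>{u \<in> S. v < u}. g v u) = (\<Sum>u\<in>S. \<Sum>v\<in>{v \<in> S. v < u}. g v u)"
    by (rule sum.swap_restrict) (use assms in auto)
  also have "\<dots> = (\<Sum>u\<in>S. \<Sum>v\<in>{v \<in> S. v < u}. - g u v)"
  proof (rule sum.cong[OF refl], rule sum.cong[OF refl])
    show "g v u = - g u v" if "u \<in> S" "v \<in> {v \<in> S. v < u}" for u v
      using that by (intro anti) auto
  qed
  also have "\<dots> = - (\<Sum>v\<in>S. \<Sum>u\<in>{u \<in> S. u < v}. g v u)"
    by (simp only: sum_negf)
  finally show ?thesis by simp
qed

text \<open>The contraction with the basis vector dual to \<open>e_j\<close>, with its usual
  sign.\<close>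

definition koszul_htpy :: "'i::linorder \<Rightarrow> ('i set \<Rightarrow> 'a::comm_ring_1) \<Rightarrow> 'i set \<Rightarrow> 'a" where
  "koszul_htpy j c S = (if j \<in> S then 0 else alt_sign j (insert j S) * c (insert j S))"

text \<open>This is why \<open>y j\<close> annihilates Koszul cohomology. For \<open>j\<close> in
  \<open>S\<close> only the term of the differential that removes \<open>j\<close> survives; for
  \<open>j\<close> outside \<open>S\<close> the terms other than that of \<open>j\<close> cancel in
  pairs.\<close>

lemma koszul_homotopy:
  assumes "finite S"
  shows "koszul y (koszul_htpy j c) S + koszul_htpy j (koszul y c) S = y j * c S"
proof (cases "j \<in> S")
  case True
  have "koszul y (koszul_htpy j c) S = (\<Sum>v\<in>S. if v = j then y j * c S else 0)"
    unfolding koszul_def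
  proof (intro sum.cong refl)
    fix v assume "v \<in> S"
    have "insert j (S - {j}) = S" using True by auto
    then show "alt_sign v S * y v * koszul_htpy j c (S - {v}) = (if v = j then y j * c S else 0)"
      using True by (auto simp: koszul_htpy_def mult.assoc mult.left_commute[of "y j"] alt_sign_square)
  qed
  then show ?thesis using True assms by (simp add: koszul_htpy_def)
next
  case False
  let ?T = "insert j S"
  define g where "g v = alt_sign j ?T * (alt_sign v ?T * (y v * c (?T - {v})))" for v
  have "koszul y (koszul_htpy j c) S = (\<Sum>v\<in>S. - g v)"
    unfolding koszul_def
  proof (intro sum.cong refl)
    fix v assume v: "v \<in> S"
    have eq: "insert j (S - {v}) = ?T - {v}" "?T - {j} = S" using v False by auto
    have "finite ?T" "j \<in> ?T" "v \<in> ?T" "j \<noteq> v" using assms v False by auto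
    from alt_sign_swap[OF this, where 'a='b]
    have swap: "alt_sign v ?T * alt_sign j (?T - {v}) = - (alt_sign j ?T * alt_sign v S :: 'b)"
      unfolding eq(2) .
    have "alt_sign v S * alt_sign j (?T - {v})
        = alt_sign v S * (alt_sign v ?T * (alt_sign v ?T * alt_sign j (?T - {v})) :: 'b)"
      by (simp only: alt_sign_square)
    also have "\<dots> = - (alt_sign v S * (alt_sign v S * (alt_sign j ?T * alt_sign v ?T)))"
      unfolding swap by (simp only: mult_ac mult_minus_right)
    finally have sgn: "alt_sign v S * alt_sign j (?T - {v}) = - (alt_sign j ?T * alt_sign v ?T :: 'b)"
      by (simp only: alt_sign_square)
    have "alt_sign v S * y v * koszul_htpy j c (S - {v})
       = (alt_sign v S * alt_sign j (?T - {v})) * (y v * c (?T - {v}))"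
      using v False by (simp only: koszul_htpy_def eq(1) Diff_iff if_False simp_thms mult_ac)
    then show "alt_sign v S * y v * koszul_htpy j c (S - {v}) = - g v"
      unfolding sgn by (simp only: g_def mult_ac mult_minus_left mult_minus_right)
  qed
  moreover have "koszul_htpy j (koszul y c) S = (\<Sum>v\<in>?T. g v)"
    using False by (simp add: koszul_htpy_def koszul_def g_def sum_distrib_left mult_ac)
  moreover have "?T - {j} = S" using False by auto
  then have "g j = y j * c S" by (simp add: g_def alt_sign_square)
  ultimately show ?thesis using False assms by (simp add: sum_negf)
qed

section \<open>Koszul cohomology with coefficients in A/N\<close>

context comm_subring
begin

lemma koszul_mem:
  assumes N: "ideal_in N" and "\<And>v. v \<in> S \<Longrightarrow> y v \<in> A" "\<And>v. v \<in> S \<Longrightarrow> c (S - {v}) \<in> N"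
  shows "koszul y c S \<in> N"
proof -
  have sgn: "alt_sign v S \<in> A" for v :: 'b and S by (auto simp: alt_sign_def)
  show ?thesis
    unfolding koszul_def using assms sgn by (intro ideal_in_sum[OF N] ideal_inD(4)[OF N]) auto
qed

text \<open>A cochain with values in \<open>A/N\<close> is represented by a lift to
  \<open>A\<close>. Only its values on the subsets of \<open>V\<close> with \<open>i\<close>
  elements count; elsewhere it is arbitrary.\<close>

definition cocycle :: "'i::linorder set \<Rightarrow> ('i \<Rightarrow> 'a) \<Rightarrow> 'a set \<Rightarrow> nat \<Rightarrow> ('i set \<Rightarrow> 'a) \<Rightarrow> bool" where
  "cocycle V y N i c \<longleftrightarrow>
     (\<forall>S. c S \<in> A) \<and> (\<forall>S\<subseteq>V. card S = Suc i \<longrightarrow> koszul y c S \<in> N)"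

definition coboundary :: "'i::linorder set \<Rightarrow> ('i \<Rightarrow> 'a) \<Rightarrow> 'a set \<Rightarrow> nat \<Rightarrow> ('i set \<Rightarrow> 'a) \<Rightarrow> bool" where
  "coboundary V y N i c \<longleftrightarrow>
     (\<exists>b. (\<forall>S. b S \<in> A) \<and> (\<forall>S\<subseteq>V. card S = i \<longrightarrow> c S - koszul y b S \<in> N))"

lemma cocycle_mult:
  assumes "ideal_in N" "cocycle V y N i c" "g \<in> A"
  shows "cocycle V y N i (\<lambda>S. g * c S)"
  using assms by (auto simp: cocycle_def koszul_mult ideal_inD)

text \<open>The annihilator of a class is an ideal, so it contains every element of the ideal
  generated by the \<open>x v\<close> as soon as it contains the \<open>x v\<close>
  themselves.\<close>

lemma ideal_in_coboundary:
  assumes N: "ideal_in N"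
  shows "ideal_in {g \<in> A. coboundary V y N i (\<lambda>S. g * c S)}"
  unfolding ideal_in_def
proof (intro conjI ballI)
  note I = ideal_inD[OF N]
  let ?P = "{g \<in> A. coboundary V y N i (\<lambda>S. g * c S)}"
  show "?P \<subseteq> A" by auto
  have "coboundary V y N i (\<lambda>S. 0 * c S)"
    unfolding coboundary_def by (intro exI[of _ "\<lambda>_. 0"]) (auto simp: koszul_def I)
  then show "0 \<in> ?P" by auto
  show "g + h \<in> ?P" if gh: "g \<in> ?P" "h \<in> ?P" for g h
  proof -
    from gh obtain b b' where b: "\<forall>S. b S \<in> A" "\<forall>S. b' S \<in> A"
      "\<forall>S\<subseteq>V. card S = i \<longrightarrow> g * c S - koszul y b S \<in> N"
      "\<forall>S\<subseteq>V. card S = i \<longrightarrow> h * c S - koszul y b' S \<in> N"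
      by (auto simp: coboundary_def)
    have "(g + h) * c S - koszul y (\<lambda>S. b S + b' S) S
        = (g * c S - koszul y b S) + (h * c S - koszul y b' S)" for S
      by (simp add: koszul_add algebra_simps)
    then have "coboundary V y N i (\<lambda>S. (g + h) * c S)"
      unfolding coboundary_def using b I(3) by (intro exI[of _ "\<lambda>S. b S + b' S"]) auto
    with gh show ?thesis by auto
  qed
  show "a * g \<in> ?P" if a: "a \<in> A" and g: "g \<in> ?P" for a g
  proof -
    from g obtain b where b: "\<forall>S. b S \<in> A"
      "\<forall>S\<subseteq>V. card S = i \<longrightarrow> g * c S - koszul y b S \<in> N"
      by (auto simp: coboundary_def)
    have "a * g * c S - koszul y (\<lambda>S. a * b S) S = a * (g * c S - koszul y b S)" for S
      by (simp add: koszul_mult algebra_simps)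
    then have "coboundary V y N i (\<lambda>S. a * g * c S)"
      unfolding coboundary_def using b I(4) a by (intro exI[of _ "\<lambda>S. a * b S"]) auto
    with a g show ?thesis by auto
  qed
qed

lemma coboundary_koszul_mult:
  assumes N: "ideal_in N" and V: "finite V" and c: "cocycle V y N i c" and j: "j \<in> V"
  shows "coboundary V y N i (\<lambda>S. y j * c S)"
  unfolding coboundary_def
proof (intro exI conjI allI impI)
  have sgn: "alt_sign v S \<in> A" for v :: 'b and S by (auto simp: alt_sign_def)
  show "koszul_htpy j c S \<in> A" for S
    using c sgn by (auto simp: koszul_htpy_def cocycle_def)
  fix S assume S: "S \<subseteq> V" "card S = i"
  then have fin: "finite S" using V finite_subset by auto
  have "koszul_htpy j (koszul y c) S \<in> N"
  proof (cases "j \<in> S")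
    case False
    then have "koszul y c (insert j S) \<in> N" using c S j fin by (auto simp: cocycle_def)
    with False show ?thesis using ideal_inD(4)[OF N] sgn by (auto simp: koszul_htpy_def)
  qed (auto simp: koszul_htpy_def ideal_inD[OF N])
  then show "y j * c S - koszul y (koszul_htpy j c) S \<in> N"
    using koszul_homotopy[OF fin, of y j c] by (simp flip: koszul_homotopy[OF fin, of y j c])
qed

text \<open>A nonzero class can be multiplied into a nonzero class killed by every \<open>x v\<close>, because
  \<open>(x v)\<^sup>2\<close> acts as zero on Koszul cohomology.\<close>

lemma exists_class_killed:
  assumes N: "ideal_in N" and V: "finite V" and x: "\<And>v. v \<in> V \<Longrightarrow> x v \<in> A"
    and c: "cocycle V (\<lambda>v. (x v)\<^sup>2) N i c" "\<not> coboundary V (\<lambda>v. (x v)\<^sup>2) N i c"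
  shows "\<exists>c'. cocycle V (\<lambda>v. (x v)\<^sup>2) N i c' \<and> \<not> coboundary V (\<lambda>v. (x v)\<^sup>2) N i c' \<and>
           (\<forall>v\<in>V. coboundary V (\<lambda>v. (x v)\<^sup>2) N i (\<lambda>S. x v * c' S))"
proof -
  let ?cyc = "cocycle V (\<lambda>v. (x v)\<^sup>2) N i" and ?cob = "coboundary V (\<lambda>v. (x v)\<^sup>2) N i"
  have "\<exists>c'. ?cyc c' \<and> \<not> ?cob c' \<and> (\<forall>v\<in>W. ?cob (\<lambda>S. x v * c' S))" if "finite W" "W \<subseteq> V" for W
    using that
  proof (induction W rule: finite_induct)
    case empty
    then show ?case using c by auto
  next
    case (insert w W)
    then obtain c' where c': "?cyc c'" "\<not> ?cob c'" "\<forall>v\<in>W. ?cob (\<lambda>S. x v * c' S)" by auto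
    show ?case
    proof (cases "?cob (\<lambda>S. x w * c' S)")
      case True
      with c' show ?thesis by auto
    next
      case False
      have w: "x w \<in> A" using insert x by auto
      have "?cob (\<lambda>S. x v * (x w * c' S))" if "v \<in> W" for v
      proof -
        have "x v \<in> {g \<in> A. ?cob (\<lambda>S. g * c' S)}" using c' that insert x by auto
        from ideal_inD(8)[OF ideal_in_coboundary[OF N] w this] show ?thesis
          by (simp add: mult.assoc)
      qed
      moreover have "?cob (\<lambda>S. x w * (x w * c' S))"
        using coboundary_koszul_mult[OF N V c'(1), of w] insert
        by (simp add: power2_eq_square mult.assoc)
      ultimately show ?thesis
        using False cocycle_mult[OF N c'(1) w] by (intro exI[of _ "\<lambda>S. x w * c' S"]) auto
    qed
  qed
  from this[of V] V show ?thesis by auto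
qed

text \<open>In the long exact sequence of multiplication by \<open>f\<close> on \<open>A/N\<close>,
  vanishing for \<open>A/(N + fA)\<close> in degree \<open>i - 1\<close> makes \<open>f\<close>
  injective in degree \<open>i\<close>. But a nonzero class could be chosen to be killed by all
  \<open>x v\<close>, hence by \<open>f\<close>. The hypothesis on \<open>fs\<close> expresses
  membership in the ideal generated by the \<open>x v\<close> without naming that ideal.\<close>

theorem koszul_vanishing:
  assumes V: "finite V" and x: "\<And>v. v \<in> V \<Longrightarrow> x v \<in> A"
    and fs: "\<And>f P. f \<in> set fs \<Longrightarrow> ideal_in P \<Longrightarrow> x ` V \<subseteq> P \<Longrightarrow> f \<in> P"
    and "ideal_in N" "weakly_regular fs N" "i < length fs"
    and "cocycle V (\<lambda>v. (x v)\<^sup>2) N i c"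
  shows "coboundary V (\<lambda>v. (x v)\<^sup>2) N i c"
  using assms(3-)
proof (induction fs arbitrary: N i c)
  case Nil
  then show ?case by simp
next
  case (Cons f fs)
  let ?y = "\<lambda>v. (x v)\<^sup>2"
  have N: "ideal_in N" by fact
  note I = ideal_inD[OF N]
  have ideal_A: "ideal_in A" by (auto simp: ideal_in_def)
  have y: "?y v \<in> A" if "v \<in> V" for v using x[OF that] by auto
  have f: "f \<in> A" using Cons.prems(1)[of f A] ideal_A x by auto
  have reg: "p \<in> N" if "p \<in> A" "f * p \<in> N" for p using Cons.prems that by auto
  have vanish: "coboundary V ?y (adjoin N f) i' b"
    if "i' < length fs" "cocycle V ?y (adjoin N f) i' b" for i' b
    using that Cons.prems by (intro Cons.IH ideal_in_adjoin[OF N f]) auto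
  have injective: "coboundary V ?y N i c"
    if c: "cocycle V ?y N i c" and fc: "coboundary V ?y N i (\<lambda>S. f * c S)" for c
  proof -
    from fc obtain b where b: "\<And>S. b S \<in> A"
      "\<And>S. S \<subseteq> V \<Longrightarrow> card S = i \<Longrightarrow> f * c S - koszul ?y b S \<in> N"
      by (auto simp: coboundary_def)
    have cA: "c S \<in> A" for S using c by (auto simp: cocycle_def)
    show ?thesis
    proof (cases i)
      \<comment> \<open>In degree 0 the differential into it is zero and only the empty set counts,
        so regularity of \<open>f\<close> is enough.\<close>
      case 0
      have "c {} \<in> N" using reg[OF cA, of "{}"] b(2)[of "{}"] 0 by simp
      then have "c S - koszul ?y (\<lambda>_. 0) S \<in> N" if "S \<subseteq> V" "card S = i" for S
      proof -
        have "S = {}" using that 0 V finite_subset by fastforce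
        with \<open>c {} \<in> N\<close> show ?thesis by simp
      qed
      then show ?thesis unfolding coboundary_def by (intro exI[of _ "\<lambda>_. 0"]) auto
    next
      case (Suc i')
      \<comment> \<open>If \<open>f * c\<close> is the coboundary of \<open>b\<close> modulo
        \<open>N\<close>, then \<open>b\<close> is a cocycle modulo \<open>N + fA\<close> one degree
        lower. There it is a coboundary up to some \<open>f * e\<close>, so \<open>f * c\<close>
        agrees modulo \<open>N\<close> with \<open>f\<close> times the coboundary of
        \<open>e\<close>, and \<open>f\<close> cancels.\<close>
      have "koszul ?y b S \<in> adjoin N f" if "S \<subseteq> V" "card S = Suc i'" for S
      proof -
        have "koszul ?y b S = - (f * c S - koszul ?y b S) + f * c S" by simp
        also have "\<dots> \<in> adjoin N f" using I(6)[OF b(2)[of S]] that Suc cA by (intro adjoinI) auto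
        finally show ?thesis .
      qed
      then have "cocycle V ?y (adjoin N f) i' b" using b by (auto simp: cocycle_def)
      then have "coboundary V ?y (adjoin N f) i' b" using vanish Cons.prems Suc by auto
      then obtain b' where b': "\<And>S. b' S \<in> A"
        "\<And>S. S \<subseteq> V \<Longrightarrow> card S = i' \<Longrightarrow> b S - koszul ?y b' S \<in> adjoin N f"
        by (auto simp: coboundary_def)
      have "\<exists>e\<in>A. S \<subseteq> V \<longrightarrow> card S = i' \<longrightarrow> b S - koszul ?y b' S - f * e \<in> N" for S
      proof (cases "S \<subseteq> V \<and> card S = i'")
        case True
        then obtain n a where "n \<in> N" "a \<in> A" "b S - koszul ?y b' S = n + f * a"
          using b'(2)[of S] by (auto elim: adjoinE)
        then show ?thesis by (intro bexI[of _ a]) auto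
      qed auto
      then obtain e where e: "\<And>S. e S \<in> A"
        "\<And>S. S \<subseteq> V \<Longrightarrow> card S = i' \<Longrightarrow> b S - koszul ?y b' S - f * e S \<in> N"
        by metis
      have "c S - koszul ?y e S \<in> N" if S: "S \<subseteq> V" "card S = i" for S
      proof -
        have fin: "finite S" using S V finite_subset by auto
        have "koszul ?y (\<lambda>T. b T - koszul ?y b' T - f * e T) S \<in> N"
          using y S fin Suc by (intro koszul_mem N e(2)) auto
        then have "koszul ?y b S - f * koszul ?y e S \<in> N"
          by (simp add: koszul_diff koszul_mult koszul_koszul[OF fin])
        from I(3)[OF b(2)[OF S] this] have "f * (c S - koszul ?y e S) \<in> N"
          by (simp add: algebra_simps)
        moreover have "koszul ?y e S \<in> A" using e(1) y S by (intro koszul_mem ideal_A) auto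
        ultimately show ?thesis using reg cA by auto
      qed
      with e(1) show ?thesis by (auto simp: coboundary_def)
    qed
  qed
  show ?case
  proof (rule ccontr)
    assume "\<not> coboundary V ?y N i c"
    from exists_class_killed[OF N V x Cons.prems(5) this]
    obtain c' where c': "cocycle V ?y N i c'" "\<not> coboundary V ?y N i c'"
      "\<forall>v\<in>V. coboundary V ?y N i (\<lambda>S. x v * c' S)" by auto
    have "f \<in> {g \<in> A. coboundary V ?y N i (\<lambda>S. g * c' S)}"
      using c'(3) x by (intro Cons.prems(1)[OF _ ideal_in_coboundary[OF N]]) auto
    with injective[OF c'(1)] c'(2) show False by auto
  qed
qed

end


section \<open>Polynomial rings\<close>

abbreviation Pol :: "'v set \<Rightarrow> (('v \<Rightarrow>\<^sub>0 nat) \<Rightarrow>\<^sub>0 'k::field) set" where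
  "Pol V \<equiv> carrier (poly_ring V)"

lemma Pol_iff: "p \<in> Pol V \<longleftrightarrow> (\<forall>m\<in>Poly_Mapping.keys p. Poly_Mapping.keys m \<subseteq> V)"
  by (simp add: poly_ring_def)

interpretation Pol: comm_subring "Pol V :: (('v \<Rightarrow>\<^sub>0 nat) \<Rightarrow>\<^sub>0 'k::field) set"
proof -
  interpret cring "poly_ring V :: (('v \<Rightarrow>\<^sub>0 nat) \<Rightarrow>\<^sub>0 'k) ring" by (rule cring_poly_ring)
  let ?R = "poly_ring V :: (('v \<Rightarrow>\<^sub>0 nat) \<Rightarrow>\<^sub>0 'k) ring"
  have ops: "add ?R = (+)" "monoid.mult ?R = (*)" "zero ?R = 0" "one ?R = 1"
    by (simp_all add: poly_ring_def)
  show "comm_subring (carrier ?R)"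
  proof (rule comm_subring.intro)
    show "- a \<in> carrier ?R" if "a \<in> carrier ?R" for a
      using that by (simp add: Pol_iff)
  qed (fact zero_closed[unfolded ops] one_closed[unfolded ops] add.m_closed[simplified, unfolded ops]
      m_closed[unfolded ops])+
qed

lemma single_in_Pol: "Poly_Mapping.keys m \<subseteq> V \<Longrightarrow> Poly_Mapping.single m c \<in> Pol V"
  by (simp add: Pol_iff)

lemma indet_in_Pol: "v \<in> V \<Longrightarrow> indet v \<in> Pol V"
  by (simp add: indet_def monomial_def single_in_Pol)

lemma sum_single_keys: "(\<Sum>m\<in>Poly_Mapping.keys p. Poly_Mapping.single m (Poly_Mapping.lookup p m)) = p"
  by (rule poly_mapping_eqI)
    (auto simp: lookup_sum lookup_single when_def in_keys_iff)

lemma lookup_single_mult: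
  fixes a k :: "'v \<Rightarrow>\<^sub>0 nat" and q :: "('v \<Rightarrow>\<^sub>0 nat) \<Rightarrow>\<^sub>0 'k::field"
  shows "Poly_Mapping.lookup (Poly_Mapping.single a c * q) k =
    (if \<forall>x. Poly_Mapping.lookup a x \<le> Poly_Mapping.lookup k x
     then c * Poly_Mapping.lookup q (k - a) else 0)"
proof -
  have eq: "k = a + m \<longleftrightarrow> (\<forall>x. Poly_Mapping.lookup a x \<le> Poly_Mapping.lookup k x) \<and> k - a = m" for m
  proof
    assume "k = a + m"
    then show "(\<forall>x. Poly_Mapping.lookup a x \<le> Poly_Mapping.lookup k x) \<and> k - a = m"
      by (simp add: lookup_add)
  next
    assume "(\<forall>x. Poly_Mapping.lookup a x \<le> Poly_Mapping.lookup k x) \<and> k - a = m"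
    then show "k = a + m"
      by (intro poly_mapping_eqI) (auto simp: lookup_add lookup_minus)
  qed
  have "Poly_Mapping.single a c * q =
      (\<Sum>m\<in>Poly_Mapping.keys q. Poly_Mapping.single (a + m) (c * Poly_Mapping.lookup q m))"
    by (subst (1) sum_single_keys[of q, symmetric]) (simp add: sum_distrib_left mult_single)
  then have "Poly_Mapping.lookup (Poly_Mapping.single a c * q) k =
      (\<Sum>m\<in>Poly_Mapping.keys q. if k = a + m then c * Poly_Mapping.lookup q m else 0)"
    by (simp add: lookup_sum lookup_single when_def eq_commute[of _ k])
  also have "\<dots> = (\<Sum>m\<in>Poly_Mapping.keys q. if k - a = m then
      (if \<forall>x. Poly_Mapping.lookup a x \<le> Poly_Mapping.lookup k x then c * Poly_Mapping.lookup q m else 0) else 0)"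
    unfolding eq by (intro sum.cong refl) auto
  also have "\<dots> = (if k - a \<in> Poly_Mapping.keys q then
      (if \<forall>x. Poly_Mapping.lookup a x \<le> Poly_Mapping.lookup k x then c * Poly_Mapping.lookup q (k - a) else 0) else 0)"
    by (rule sum.delta') simp
  finally show ?thesis by (simp add: in_keys_iff)
qed

lemma keys_add_exponent:
  fixes m :: "'v \<Rightarrow>\<^sub>0 nat"
  shows "Poly_Mapping.keys (a + m) = Poly_Mapping.keys a \<union> Poly_Mapping.keys m"
  by (auto simp: in_keys_iff lookup_add)


subsection \<open>Coefficients with respect to one variable\<close>

text \<open>The coefficient of a power of \<open>v\<close> stays in the same polynomial ring, so
  that membership in an ideal of \<open>K[V]\<close> can be asked of it directly.\<close>

lift_definition coeff_in :: "'v \<Rightarrow> nat \<Rightarrow> (('v \<Rightarrow>\<^sub>0 nat) \<Rightarrow>\<^sub>0 'k::field) \<Rightarrow> (('v \<Rightarrow>\<^sub>0 nat) \<Rightarrow>\<^sub>0 'k)"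
  is "\<lambda>v t p m. if Poly_Mapping.lookup m v = 0 then p (m + Poly_Mapping.single v t) else 0"
proof -
  fix v :: 'v and t :: nat and p :: "('v \<Rightarrow>\<^sub>0 nat) \<Rightarrow> 'k"
  assume fin: "finite {m. p m \<noteq> 0}"
  have inj: "inj (\<lambda>m. m + Poly_Mapping.single v t)"
  proof (rule injI)
    fix x y assume "x + Poly_Mapping.single v t = y + Poly_Mapping.single v t"
    then show "x = y" by (rule add_right_imp_eq)
  qed
  show "finite {m. (if Poly_Mapping.lookup m v = 0 then p (m + Poly_Mapping.single v t) else 0) \<noteq> 0}"
    by (rule finite_subset[OF _ finite_vimageI[OF fin inj]]) auto
qed

lemma coeff_in_add: "coeff_in v t (p + q) = coeff_in v t p + coeff_in v t q"
  by (rule poly_mapping_eqI) (simp add: coeff_in.rep_eq lookup_add)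

lemma coeff_in_zero: "coeff_in v t 0 = 0"
  by (rule poly_mapping_eqI) (simp add: coeff_in.rep_eq)

lemma coeff_in_sum: "coeff_in v t (sum f I) = (\<Sum>i\<in>I. coeff_in v t (f i))"
  by (induction I rule: infinite_finite_induct) (simp_all add: coeff_in_add coeff_in_zero)

lemma coeff_in_mult_free:
  assumes "\<And>m. m \<in> Poly_Mapping.keys g \<Longrightarrow> v \<notin> Poly_Mapping.keys m"
  shows "coeff_in v t (g * q) = g * coeff_in v t q"
proof -
  have single: "coeff_in v t (Poly_Mapping.single a c * q) = Poly_Mapping.single a c * coeff_in v t q"
    if "v \<notin> Poly_Mapping.keys a" for a c
  proof (rule poly_mapping_eqI)
    fix m
    have av: "Poly_Mapping.lookup a v = 0" using that by (simp add: in_keys_iff)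
    have "(\<forall>x. Poly_Mapping.lookup a x \<le> Poly_Mapping.lookup (m + Poly_Mapping.single v t) x)
        \<longleftrightarrow> (\<forall>x. Poly_Mapping.lookup a x \<le> Poly_Mapping.lookup m x)"
    proof (rule iff_allI)
      show "Poly_Mapping.lookup a x \<le> Poly_Mapping.lookup (m + Poly_Mapping.single v t) x
        \<longleftrightarrow> Poly_Mapping.lookup a x \<le> Poly_Mapping.lookup m x" for x
        using av by (cases "x = v") (simp_all add: lookup_add lookup_single when_def)
    qed
    moreover have "m + Poly_Mapping.single v t - a = m - a + Poly_Mapping.single v t"
      if "\<forall>x. Poly_Mapping.lookup a x \<le> Poly_Mapping.lookup m x"
      using that by (intro poly_mapping_eqI) (simp add: lookup_add lookup_minus)
    ultimately show "Poly_Mapping.lookup (coeff_in v t (Poly_Mapping.single a c * q)) m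
        = Poly_Mapping.lookup (Poly_Mapping.single a c * coeff_in v t q) m"
      using av by (simp add: coeff_in.rep_eq lookup_single_mult lookup_minus)
  qed
  have "coeff_in v t (g * q) = coeff_in v t
      (\<Sum>m\<in>Poly_Mapping.keys g. Poly_Mapping.single m (Poly_Mapping.lookup g m) * q)"
    by (simp add: sum_single_keys flip: sum_distrib_right)
  also have "\<dots> = (\<Sum>m\<in>Poly_Mapping.keys g. Poly_Mapping.single m (Poly_Mapping.lookup g m) * coeff_in v t q)"
    unfolding coeff_in_sum using assms by (intro sum.cong refl single) auto
  also have "\<dots> = g * coeff_in v t q"
    by (simp add: sum_single_keys flip: sum_distrib_right)
  finally show ?thesis .
qed

lemma coeff_in_indet_mult: "coeff_in v (Suc t) (indet v * q) = coeff_in v t q"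
proof (rule poly_mapping_eqI)
  fix m
  have "m + Poly_Mapping.single v (Suc t) - Poly_Mapping.single v 1 = m + Poly_Mapping.single v t"
    by (intro poly_mapping_eqI) (simp add: lookup_add lookup_minus lookup_single when_def)
  then show "Poly_Mapping.lookup (coeff_in v (Suc t) (indet v * q)) m = Poly_Mapping.lookup (coeff_in v t q) m"
    by (simp add: coeff_in.rep_eq indet_def monomial_def lookup_single_mult lookup_add lookup_single when_def)
qed

lemma coeff_in_eq_0:
  assumes "\<And>m. m \<in> Poly_Mapping.keys p \<Longrightarrow> Poly_Mapping.lookup m v < t"
  shows "coeff_in v t p = 0"
proof (rule poly_mapping_eqI)
  fix m
  have "m + Poly_Mapping.single v t \<notin> Poly_Mapping.keys p"
    using assms[of "m + Poly_Mapping.single v t"] by (auto simp: lookup_add)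
  then show "Poly_Mapping.lookup (coeff_in v t p) m = Poly_Mapping.lookup 0 m"
    by (simp add: coeff_in.rep_eq in_keys_iff)
qed

lemma sum_coeff_in:
  assumes "\<And>m. m \<in> Poly_Mapping.keys p \<Longrightarrow> Poly_Mapping.lookup m v \<le> B"
  shows "(\<Sum>t\<le>B. Poly_Mapping.single (Poly_Mapping.single v t) 1 * coeff_in v t p) = p"
proof (rule poly_mapping_eqI)
  fix k
  have "Poly_Mapping.lookup (Poly_Mapping.single (Poly_Mapping.single v t) 1 * coeff_in v t p) k
      = (if t = Poly_Mapping.lookup k v then Poly_Mapping.lookup p k else 0)" for t
  proof (cases "t \<le> Poly_Mapping.lookup k v")
    case True
    then have "k - Poly_Mapping.single v t + Poly_Mapping.single v t = k"
      by (intro poly_mapping_eqI) (auto simp: lookup_add lookup_minus lookup_single when_def)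
    with True show ?thesis
      by (auto simp: lookup_single_mult coeff_in.rep_eq lookup_single lookup_minus when_def)
  next
    case False
    then show ?thesis
      by (auto simp: lookup_single_mult lookup_single when_def)
  qed
  then have "Poly_Mapping.lookup (\<Sum>t\<le>B. Poly_Mapping.single (Poly_Mapping.single v t) 1 * coeff_in v t p) k
      = (if Poly_Mapping.lookup k v \<le> B then Poly_Mapping.lookup p k else 0)"
    by (simp add: lookup_sum)
  also have "\<dots> = Poly_Mapping.lookup p k"
    using assms[of k] by (auto simp: in_keys_iff)
  finally show "Poly_Mapping.lookup (\<Sum>t\<le>B. Poly_Mapping.single (Poly_Mapping.single v t) 1 * coeff_in v t p) k
      = Poly_Mapping.lookup p k" .
qed

lemma degree_in_bounded:
  fixes p :: "('v \<Rightarrow>\<^sub>0 nat) \<Rightarrow>\<^sub>0 'k::zero"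
  shows "\<exists>B. \<forall>m\<in>Poly_Mapping.keys p. Poly_Mapping.lookup m v \<le> B"
  by (intro exI[of _ "Max ((\<lambda>m. Poly_Mapping.lookup m v) ` Poly_Mapping.keys p)"] ballI Max_ge) auto

text \<open>An ideal of \<open>K[V]\<close> extended from \<open>K[V - {v}]\<close>.\<close>

definition extended_in :: "'v \<Rightarrow> (('v \<Rightarrow>\<^sub>0 nat) \<Rightarrow>\<^sub>0 'k::field) set \<Rightarrow> bool" where
  "extended_in v N \<longleftrightarrow> (\<forall>p\<in>N. \<forall>t. coeff_in v t p \<in> N)"

lemma coeff_in_Pol: "p \<in> Pol V \<Longrightarrow> coeff_in v t p \<in> Pol V"
  unfolding Pol_iff
proof (intro ballI)
  fix m assume p: "\<forall>m\<in>Poly_Mapping.keys p. Poly_Mapping.keys m \<subseteq> V"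
    and "m \<in> Poly_Mapping.keys (coeff_in v t p)"
  then have "m + Poly_Mapping.single v t \<in> Poly_Mapping.keys p"
    by (auto simp: in_keys_iff coeff_in.rep_eq split: if_splits)
  with p have "Poly_Mapping.keys (m + Poly_Mapping.single v t) \<subseteq> V" by blast
  then show "Poly_Mapping.keys m \<subseteq> V" by (simp add: keys_add_exponent)
qed

lemma in_ideal_if_coeffs:
  assumes N: "Pol.ideal_in V N" and v: "v \<in> V" and "\<And>t. coeff_in v t p \<in> N"
  shows "p \<in> N"
proof -
  obtain B where B: "\<forall>m\<in>Poly_Mapping.keys p. Poly_Mapping.lookup m v \<le> B"
    using degree_in_bounded[of p v] by (rule exE)
  have "p = (\<Sum>t\<le>B. Poly_Mapping.single (Poly_Mapping.single v t) 1 * coeff_in v t p)"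
    by (rule sum_coeff_in[symmetric]) (rule bspec[OF B])
  also have "\<dots> \<in> N"
    by (rule Pol.ideal_in_sum[OF N], rule Pol.ideal_inD(4)[OF N _ assms(3)], rule single_in_Pol)
      (simp add: v)
  finally show ?thesis .
qed

lemma extended_in_adjoin:
  assumes "extended_in v N" "\<And>m. m \<in> Poly_Mapping.keys g \<Longrightarrow> v \<notin> Poly_Mapping.keys m"
  shows "extended_in v (Pol.adjoin V N g)"
  unfolding extended_in_def
proof (intro ballI allI)
  fix p t assume "p \<in> Pol.adjoin V N g"
  then obtain x a where xa: "x \<in> N" "a \<in> Pol V" "p = x + g * a" by (rule Pol.adjoinE)
  have "coeff_in v t p = coeff_in v t x + g * coeff_in v t a"
    using assms(2) by (simp add: xa(3) coeff_in_add coeff_in_mult_free)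
  moreover have "coeff_in v t x \<in> N" using assms(1) xa(1) by (simp add: extended_in_def)
  ultimately show "coeff_in v t p \<in> Pol.adjoin V N g"
    using Pol.adjoinI[OF _ coeff_in_Pol[OF xa(2)], of "coeff_in v t x" N g v t] by simp
qed


section \<open>Complete homogeneous polynomials\<close>

fun complete_sym :: "nat \<Rightarrow> 'v list \<Rightarrow> (('v \<Rightarrow>\<^sub>0 nat) \<Rightarrow>\<^sub>0 'k::field)" where
  "complete_sym 0 vs = 1"
| "complete_sym (Suc j) [] = 0"
| "complete_sym (Suc j) (v # vs) = complete_sym (Suc j) vs + indet v * complete_sym j (v # vs)"

lemma complete_sym_in_Pol: "set vs \<subseteq> V \<Longrightarrow> complete_sym j vs \<in> Pol V"
proof (induction j vs rule: complete_sym.induct)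
  case (3 j v vs)
  then show ?case by (simp add: Pol.add_mem Pol.mult_mem indet_in_Pol)
qed auto

lemma keys_complete_sym:
  "m \<in> Poly_Mapping.keys (complete_sym j vs :: ('v \<Rightarrow>\<^sub>0 nat) \<Rightarrow>\<^sub>0 'k::field) \<Longrightarrow>
     Poly_Mapping.keys m \<subseteq> set vs"
  using complete_sym_in_Pol[OF order_refl, of j vs] by (auto simp: Pol_iff)

text \<open>As a polynomial in \<open>v\<close>, \<open>complete_sym j (v # ws)\<close> is monic of degree \<open>j\<close>, so modulo \<open>N\<close> it
  moves the leading \<open>v\<close>-coefficient of \<open>p\<close> up by \<open>j\<close>.\<close>

lemma leading_coeff_complete_sym_mult:
  assumes N: "Pol.ideal_in V N" and V: "set (v # ws) \<subseteq> V" and v: "v \<notin> set ws"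
    and top: "\<And>b. b > t \<Longrightarrow> coeff_in v b p \<in> N"
  shows "(\<forall>s>t + j. coeff_in v s (complete_sym j (v # ws) * p) \<in> N) \<and>
         coeff_in v (t + j) (complete_sym j (v # ws) * p) - coeff_in v t p \<in> N"
proof (induction j)
  case 0
  show ?case using top Pol.ideal_inD(2)[OF N] by simp
next
  case (Suc j)
  let ?h = "\<lambda>j. complete_sym j (v # ws)"
  have free: "v \<notin> Poly_Mapping.keys m" if "m \<in> Poly_Mapping.keys (complete_sym (Suc j) ws :: ('a \<Rightarrow>\<^sub>0 nat) \<Rightarrow>\<^sub>0 'b)" for m
    using keys_complete_sym[OF that] v by auto
  have coeff: "coeff_in v (Suc s) (?h (Suc j) * p)
      = complete_sym (Suc j) ws * coeff_in v (Suc s) p + coeff_in v s (?h j * p)" for s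
    using coeff_in_indet_mult[of v s "?h j * p"]
    by (simp only: complete_sym.simps distrib_right coeff_in_add mult.assoc
        coeff_in_mult_free[of "complete_sym (Suc j) ws" v, OF free])
  have low: "complete_sym (Suc j) ws * coeff_in v (Suc s) p \<in> N" if "s \<ge> t" for s
    using Pol.ideal_inD(4)[OF N complete_sym_in_Pol top] V that by simp
  have "coeff_in v s (?h (Suc j) * p) \<in> N" if s: "s > t + Suc j" for s
  proof -
    obtain s' where s': "s = Suc s'" using s by (cases s) auto
    show ?thesis
      unfolding s' coeff using s s' Suc.IH by (intro Pol.ideal_inD(3)[OF N] low) auto
  qed
  moreover have "coeff_in v (t + Suc j) (?h (Suc j) * p) - coeff_in v t p \<in> N"
    unfolding add_Suc_right coeff add_diff_eq[symmetric]
    by (rule Pol.ideal_inD(3)[OF N low conjunct2[OF Suc.IH]]) simp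
  ultimately show ?case by blast
qed

text \<open>If some coefficient of \<open>p\<close> lies outside \<open>N\<close>, the highest such
  one reappears modulo \<open>N\<close> as a coefficient of the product; but an extended ideal
  contains all coefficients of its members.\<close>

lemma complete_sym_nonzerodivisor:
  assumes N: "Pol.ideal_in V N" and ext: "extended_in v N" and V: "set (v # ws) \<subseteq> V"
    and v: "v \<notin> set ws" and hp: "complete_sym j (v # ws) * p \<in> N"
  shows "p \<in> N"
proof (rule in_ideal_if_coeffs[OF N])
  show "v \<in> V" using V by simp
  let ?T = "{t. coeff_in v t p \<notin> N}"
  obtain B where B: "\<forall>m\<in>Poly_Mapping.keys p. Poly_Mapping.lookup m v \<le> B"
    using degree_in_bounded[of p v] by (rule exE)
  have "coeff_in v t p \<in> N" if "t > B" for t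
  proof -
    have "coeff_in v t p = 0" using B that by (intro coeff_in_eq_0) (auto dest!: bspec)
    then show ?thesis using Pol.ideal_inD(2)[OF N] by simp
  qed
  then have "?T \<subseteq> {..B}" by (auto simp: not_less[symmetric])
  then have fin: "finite ?T" using finite_subset by blast
  show "coeff_in v t p \<in> N" for t
  proof (rule ccontr)
    assume "coeff_in v t p \<notin> N"
    then have max: "Max ?T \<in> ?T" using fin by (intro Max_in) auto
    have "coeff_in v b p \<in> N" if "b > Max ?T" for b
      using Max_ge[OF fin, of b] that by force
    from leading_coeff_complete_sym_mult[OF N V v this, where j = j]
    have "coeff_in v (Max ?T + j) (complete_sym j (v # ws) * p) - coeff_in v (Max ?T) p \<in> N"
      by blast
    moreover have "coeff_in v (Max ?T + j) (complete_sym j (v # ws) * p) \<in> N"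
      using ext hp by (simp add: extended_in_def)
    ultimately have "coeff_in v (Max ?T) p \<in> N" using Pol.ideal_in_cong[OF N] by blast
    with max show False by simp
  qed
qed

definition complete_sym_seq :: "'v list \<Rightarrow> nat \<Rightarrow> nat \<Rightarrow> (('v \<Rightarrow>\<^sub>0 nat) \<Rightarrow>\<^sub>0 'k::field) list" where
  "complete_sym_seq vs a d = map (\<lambda>i. complete_sym i vs) [a..<a + d]"

lemma complete_sym_seq_simps [simp]:
  "complete_sym_seq vs a 0 = []"
  "complete_sym_seq vs a (Suc d) = complete_sym a vs # complete_sym_seq vs (Suc a) d"
  by (simp_all add: complete_sym_seq_def upt_conv_Cons del: upt_Suc)

lemma length_complete_sym_seq: "length (complete_sym_seq vs a d) = d"
  by (simp add: complete_sym_seq_def del: upt_Suc)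

lemma set_complete_sym_seq: "set (complete_sym_seq vs a d) = (\<lambda>i. complete_sym i vs) ` {a..<a + d}"
  by (simp add: complete_sym_seq_def)

lemma complete_sym_seq_subset_Pol: "set vs \<subseteq> V \<Longrightarrow> set (complete_sym_seq vs a d) \<subseteq> Pol V"
  by (auto simp: set_complete_sym_seq complete_sym_in_Pol)

lemma weakly_regular_complete_sym_cong:
  assumes "Pol.ideal_in V N" "set vs \<subseteq> V" "set ws \<subseteq> V"
    and "\<And>i. complete_sym i vs - complete_sym i ws \<in> N"
  shows "Pol.weakly_regular V (complete_sym_seq vs a d) N \<longleftrightarrow>
         Pol.weakly_regular V (complete_sym_seq ws a d) N"
  using assms
proof (induction d arbitrary: a N)
  case (Suc d)
  have mem: "complete_sym a vs \<in> Pol V" "complete_sym a ws \<in> Pol V"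
    using Suc.prems by (simp_all add: complete_sym_in_Pol)
  have "Pol.weakly_regular V (complete_sym a vs # complete_sym_seq vs (Suc a) d) N \<longleftrightarrow>
      Pol.weakly_regular V (complete_sym a ws # complete_sym_seq vs (Suc a) d) N"
    by (rule Pol.weakly_regular_cong_head[OF Suc.prems(1,4) mem])
  moreover have "Pol.weakly_regular V (complete_sym_seq vs (Suc a) d) (Pol.adjoin V N (complete_sym a ws)) \<longleftrightarrow>
      Pol.weakly_regular V (complete_sym_seq ws (Suc a) d) (Pol.adjoin V N (complete_sym a ws))"
    by (intro Suc.IH Pol.ideal_in_adjoin Suc.prems mem subsetD[OF Pol.adjoin_superset Suc.prems(4)])
  ultimately show ?case by simp
qed simp

text \<open>By the recursion, the polynomials of degree \<open>a + 1\<close> in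
  \<open>v # ws\<close> and in \<open>ws\<close> differ by \<open>indet v\<close> times the one of
  degree \<open>a\<close> in \<open>v # ws\<close>. Once the latter is in the ideal,
  \<open>v\<close> can be restored in degree \<open>a + 1\<close>, and then in each following
  degree.\<close>

lemma weakly_regular_complete_sym_Cons:
  assumes "Pol.ideal_in V N" "set (v # ws) \<subseteq> V" "complete_sym a (v # ws) \<in> N"
    and "Pol.weakly_regular V (complete_sym_seq ws (Suc a) d) N"
  shows "Pol.weakly_regular V (complete_sym_seq (v # ws) (Suc a) d) N"
  using assms
proof (induction d arbitrary: a N)
  case (Suc d)
  let ?h = "complete_sym (Suc a) (v # ws)" and ?g = "complete_sym (Suc a) ws"
  have V: "v \<in> V" "set ws \<subseteq> V" using Suc.prems by auto
  have mem: "?h \<in> Pol V" "?g \<in> Pol V" 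
    by (rule complete_sym_in_Pol[OF Suc.prems(2)], rule complete_sym_in_Pol[OF V(2)])
  have diff: "?h - ?g \<in> N"
    using Pol.ideal_inD(4)[OF Suc.prems(1) indet_in_Pol[OF V(1)] Suc.prems(3)] by simp
  have ideal: "Pol.ideal_in V (Pol.adjoin V N ?g)"
    by (rule Pol.ideal_in_adjoin[OF Suc.prems(1) mem(2)])
  have "?h \<in> Pol.adjoin V N ?g"
    using Pol.ideal_in_cong[OF ideal, of ?h ?g] Pol.adjoin_self[OF Suc.prems(1), of ?g]
      subsetD[OF Pol.adjoin_superset diff] by blast
  then have "Pol.weakly_regular V (complete_sym_seq (v # ws) (Suc (Suc a)) d) (Pol.adjoin V N ?g)"
    using Suc.prems by (intro Suc.IH ideal) simp_all
  then have "Pol.weakly_regular V (?g # complete_sym_seq (v # ws) (Suc (Suc a)) d) N"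
    using Suc.prems(4) by simp
  then show ?case
    using Pol.weakly_regular_cong_head[OF Suc.prems(1) diff mem]
    by (simp only: complete_sym_seq_simps)
qed simp

lemma extended_in_foldl_adjoin:
  assumes "extended_in v N" "\<And>g m. g \<in> set gs \<Longrightarrow> m \<in> Poly_Mapping.keys g \<Longrightarrow> v \<notin> Poly_Mapping.keys m"
  shows "extended_in v (foldl (Pol.adjoin V) N gs)"
  using assms
proof (induction gs arbitrary: N)
  case (Cons g gs)
  have "extended_in v (Pol.adjoin V N g)"
    using Cons.prems(1) by (rule extended_in_adjoin) (rule Cons.prems(2)[of g], simp_all)
  then have "extended_in v (foldl (Pol.adjoin V) (Pol.adjoin V N g) gs)"
    by (rule Cons.IH) (metis Cons.prems(2) list.set_intros(2))
  then show ?case by simp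
qed simp

theorem weakly_regular_complete_sym:
  assumes N: "Pol.ideal_in V N" and "set vs \<subseteq> V" "distinct vs"
    and ext: "\<And>v. v \<in> set vs \<Longrightarrow> indet v \<notin> N \<Longrightarrow> extended_in v N"
    and "d \<le> length (filter (\<lambda>v. indet v \<notin> N) vs)"
  shows "Pol.weakly_regular V (complete_sym_seq vs a d) N"
  using assms(2-)
proof (induction vs arbitrary: a d)
  case Nil
  then show ?case by simp
next
  case (Cons v ws)
  have V: "v \<in> V" "set ws \<subseteq> V" and v: "v \<notin> set ws" using Cons.prems by auto
  show ?case
  proof (cases "indet v \<in> N")
    case True
    have "complete_sym i (v # ws) - complete_sym i ws \<in> N" for i
      using Pol.ideal_inD(2)[OF N] Pol.ideal_inD(8)[OF N complete_sym_in_Pol True, of "v # ws"] Cons.prems(1)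
      by (cases i) simp_all
    then show ?thesis
      using weakly_regular_complete_sym_cong[OF N, of "v # ws" ws a d] Cons True by simp
  next
    case False
    show ?thesis
    proof (cases d)
      case (Suc d')
      let ?f = "complete_sym a (v # ws)" and ?gs = "complete_sym_seq ws (Suc a) d'"
      have f: "?f \<in> Pol V" using complete_sym_in_Pol[OF Cons.prems(1)] .
      have gs: "set ?gs \<subseteq> Pol V" by (rule complete_sym_seq_subset_Pol[OF V(2)])
      have "Pol.weakly_regular V (?f # ?gs) N"
      proof (rule Pol.weakly_regular_Cons_swap[OF N f gs])
        show "Pol.weakly_regular V ?gs N" using Cons False Suc by simp
        fix i p
        assume fp: "?f * p \<in> foldl (Pol.adjoin V) N (take i ?gs)"
        have sub: "set (take i ?gs) \<subseteq> set ?gs" by (rule set_take_subset)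
        have "Pol.ideal_in V (foldl (Pol.adjoin V) N (take i ?gs))"
          using sub gs by (intro Pol.ideal_in_foldl_adjoin N) (rule order_trans)
        moreover have "extended_in v (foldl (Pol.adjoin V) N (take i ?gs))"
        proof (rule extended_in_foldl_adjoin)
          show "extended_in v N" using Cons.prems(3) False by simp
          fix g m assume "g \<in> set (take i ?gs)" and m: "m \<in> Poly_Mapping.keys g"
          then obtain i where "g = complete_sym i ws" using sub by (auto simp: set_complete_sym_seq)
          with m v keys_complete_sym[of m i ws] show "v \<notin> Poly_Mapping.keys m" by auto
        qed
        ultimately show "p \<in> foldl (Pol.adjoin V) N (take i ?gs)"
          using Cons.prems(1) v fp by (rule complete_sym_nonzerodivisor)
      qed
      then show ?thesis
        using weakly_regular_complete_sym_Cons[OF Pol.ideal_in_adjoin[OF N f] Cons.prems(1)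
            Pol.adjoin_self[OF N]] Suc by simp
    qed simp
  qed
qed


section \<open>Ideals and quotients of \<open>K[V]\<close>\<close>

lemma poly_ring_ops:
  "add (poly_ring V) = (+)" "monoid.mult (poly_ring V) = (*)"
  "zero (poly_ring V) = 0" "one (poly_ring V) = 1"
  by (simp_all add: poly_ring_def)

lemma ideal_iff_ideal_in: "ideal J (poly_ring V) \<longleftrightarrow> Pol.ideal_in V J"
proof
  assume "ideal J (poly_ring V)"
  then interpret ideal J "poly_ring V" .
  show "Pol.ideal_in V J"
    unfolding Pol.ideal_in_def
  proof (intro conjI ballI)
    show "J \<subseteq> Pol V" by (rule a_subset)
    show "0 \<in> J"
      using additive_subgroup.zero_closed[OF is_additive_subgroup] by (simp only: poly_ring_ops)
    show "p + q \<in> J" if "p \<in> J" "q \<in> J" for p q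
      using additive_subgroup.a_closed[OF is_additive_subgroup that] by (simp only: poly_ring_ops)
    show "a * p \<in> J" if "a \<in> Pol V" "p \<in> J" for a p
      using I_l_closed[OF that(2,1)] by (simp only: poly_ring_ops)
  qed
next
  assume J: "Pol.ideal_in V J"
  interpret cring "poly_ring V" by (rule cring_poly_ring)
  have minus: "\<ominus>\<^bsub>poly_ring V\<^esub> p = - p" if "p \<in> Pol V" for p
    using that by (intro minus_equality) (auto simp: poly_ring_ops)
  show "ideal J (poly_ring V)"
  proof (rule idealI[OF ring_axioms])
    show "subgroup J (add_monoid (poly_ring V))"
    proof (rule add.subgroupI)
      show "J \<subseteq> Pol V" "J \<noteq> {}" using Pol.ideal_inD(1,2)[OF J] by auto
      show "\<ominus>\<^bsub>poly_ring V\<^esub> p \<in> J" if "p \<in> J" for p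
        using minus[OF Pol.ideal_inD(5)[OF J that]] Pol.ideal_inD(6)[OF J that] by simp
      show "p \<oplus>\<^bsub>poly_ring V\<^esub> q \<in> J" if "p \<in> J" "q \<in> J" for p q
        using Pol.ideal_inD(3)[OF J that] by (simp add: poly_ring_ops)
    qed
    show "q \<otimes>\<^bsub>poly_ring V\<^esub> p \<in> J" "p \<otimes>\<^bsub>poly_ring V\<^esub> q \<in> J" if "p \<in> J" "q \<in> Pol V" for p q
      using Pol.ideal_inD(4,8)[OF J that(2,1)] by (simp_all add: poly_ring_ops)
  qed
qed

lemma ideal_in_genideal: "S \<subseteq> Pol V \<Longrightarrow> Pol.ideal_in V (Idl\<^bsub>poly_ring V\<^esub> S)"
  using ring.genideal_ideal[OF cring.axioms(1)[OF cring_poly_ring]] by (simp flip: ideal_iff_ideal_in)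

lemma genideal_subset_iff:
  assumes "Pol.ideal_in V P" "S \<subseteq> Pol V"
  shows "Idl\<^bsub>poly_ring V\<^esub> S \<subseteq> P \<longleftrightarrow> S \<subseteq> P"
  using ring.genideal_minimal[OF cring.axioms(1)[OF cring_poly_ring], of P V S]
    ring.genideal_self[OF cring.axioms(1)[OF cring_poly_ring] assms(2)] assms(1)
  unfolding ideal_iff_ideal_in by blast

lemma generator_in_genideal: "S \<subseteq> Pol V \<Longrightarrow> s \<in> S \<Longrightarrow> s \<in> Idl\<^bsub>poly_ring V\<^esub> S"
  using genideal_subset_iff[OF ideal_in_genideal, of S V S] by auto


subsection \<open>Regular sequences on \<open>K[V]/J\<close>\<close>

context
  fixes V :: "'v set" and J :: "(('v \<Rightarrow>\<^sub>0 nat) \<Rightarrow>\<^sub>0 'k::field) set"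
  assumes J: "Pol.ideal_in V J"
begin

private abbreviation (input) "R \<equiv> poly_ring V :: (('v \<Rightarrow>\<^sub>0 nat) \<Rightarrow>\<^sub>0 'k) ring"
private abbreviation (input) "M \<equiv> quotient_module R J"
private abbreviation (input) "cls p \<equiv> J +>\<^bsub>R\<^esub> p"

lemma coset_eq_iff:
  assumes "p \<in> Pol V" "q \<in> Pol V"
  shows "cls p = cls q \<longleftrightarrow> p - q \<in> J"
proof
  have coset: "cls p = (\<lambda>j. j + p) ` J" for p
    by (auto simp: a_r_coset_def' poly_ring_ops)
  show "p - q \<in> J" if "cls p = cls q"
  proof -
    have "p \<in> cls p" unfolding coset using Pol.ideal_inD(2)[OF J] by force
    then have "p \<in> cls q" using that by simp
    then obtain j where "j \<in> J" "p = j + q" unfolding coset by auto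
    then show ?thesis by simp
  qed
  show "cls p = cls q" if pq: "p - q \<in> J"
  proof -
    have "cls p \<subseteq> cls q" if "p - q \<in> J" for p q
    proof
      fix r assume "r \<in> cls p"
      then obtain j where "j \<in> J" "r = j + p" unfolding coset by auto
      then have "r = (j + (p - q)) + q" "j + (p - q) \<in> J"
        using Pol.ideal_inD(3)[OF J _ that] by auto
      then show "r \<in> cls q" unfolding coset by blast
    qed
    from this[OF pq] this[of q p] Pol.ideal_inD(6)[OF J pq] show ?thesis by simp
  qed
qed

lemma quotient_module_ops:
  shows "carrier M = cls ` Pol V"
    and "p \<in> Pol V \<Longrightarrow> q \<in> Pol V \<Longrightarrow> cls p \<oplus>\<^bsub>M\<^esub> cls q = cls (p + q)"
    and "p \<in> Pol V \<Longrightarrow> q \<in> Pol V \<Longrightarrow> p \<odot>\<^bsub>M\<^esub> cls q = cls (p * q)"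
    and "\<zero>\<^bsub>M\<^esub> = cls 0"
proof -
  have ideal: "ideal J R" using J by (simp only: ideal_iff_ideal_in)
  note hom = ideal.rcos_ring_hom[OF ideal]
  have ops: "carrier M = carrier (R Quot J)" "add M = add (R Quot J)"
    "p \<odot>\<^bsub>M\<^esub> X = cls p \<otimes>\<^bsub>R Quot J\<^esub> X" "\<zero>\<^bsub>M\<^esub> = J" for p X
    by (simp_all add: quotient_module_def FactRing_def)
  have "carrier (R Quot J) = (\<Union>p\<in>Pol V. {cls p})"
    by (simp add: FactRing_def A_RCOSETS_def')
  then show "carrier M = cls ` Pol V" unfolding ops by blast
  show "cls p \<oplus>\<^bsub>M\<^esub> cls q = cls (p + q)" if "p \<in> Pol V" "q \<in> Pol V"
    using ring_hom_add[OF hom that] unfolding ops poly_ring_ops by (rule sym)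
  show "p \<odot>\<^bsub>M\<^esub> cls q = cls (p * q)" if "p \<in> Pol V" "q \<in> Pol V"
    using ring_hom_mult[OF hom that] unfolding ops poly_ring_ops by (rule sym)
  show "\<zero>\<^bsub>M\<^esub> = cls 0"
    unfolding ops by (auto simp: a_r_coset_def' poly_ring_ops)
qed

lemma submodule_cosets:
  assumes G: "Pol.ideal_in V G"
  shows "submodule (cls ` G) R M"
proof -
  note I = Pol.ideal_inD[OF G]
  interpret M: module R M
    using module_quotient_module[OF cring_poly_ring] J by (simp add: ideal_iff_ideal_in)
  have smult: "a \<odot>\<^bsub>M\<^esub> X \<in> cls ` G" if a: "a \<in> Pol V" and X: "X \<in> cls ` G" for a X
  proof -
    from X obtain p where p: "p \<in> G" "X = cls p" by auto
    then show ?thesis using quotient_module_ops(3)[OF a I(5)] I(4)[OF a] by auto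
  qed
  show ?thesis
  proof (rule M.submoduleI)
    show sub: "cls ` G \<subseteq> carrier M" using I(1) by (auto simp: quotient_module_ops(1))
    show "\<zero>\<^bsub>M\<^esub> \<in> cls ` G" using I(2) by (auto simp: quotient_module_ops(4))
    show "X \<oplus>\<^bsub>M\<^esub> Y \<in> cls ` G" if "X \<in> cls ` G" "Y \<in> cls ` G" for X Y
    proof -
      from that obtain p q where "p \<in> G" "X = cls p" "q \<in> G" "Y = cls q" by auto
      then show ?thesis using quotient_module_ops(2)[OF I(5) I(5)] I(3) by auto
    qed
    show "\<ominus>\<^bsub>M\<^esub> X \<in> cls ` G" if X: "X \<in> cls ` G" for X
    proof -
      from X obtain p where p: "p \<in> G" "X = cls p" by auto
      have mem: "p \<in> Pol V" "- p \<in> Pol V" using I(5,6) p(1) by simp_all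
      have "cls (- p) \<oplus>\<^bsub>M\<^esub> cls p = \<zero>\<^bsub>M\<^esub>"
        by (simp add: quotient_module_ops(2)[OF mem(2,1)] quotient_module_ops(4))
      then have "\<ominus>\<^bsub>M\<^esub> cls p = cls (- p)"
        using mem by (intro M.M.minus_equality) (auto simp: quotient_module_ops(1))
      then show ?thesis using p I(6) by simp
    qed
  qed (fact smult)
qed

text \<open>For minimality, the preimage in \<open>K[V]\<close> of a competing submodule is an ideal
  that contains \<open>J\<close> and, by acting on the class of 1, all of \<open>fs\<close>.\<close>

lemma seq_submodule_quotient:
  assumes fs: "set fs \<subseteq> Pol V"
  shows "seq_submodule R M fs = cls ` foldl (Pol.adjoin V) J fs"
proof -
  let ?G = "foldl (Pol.adjoin V) J fs"
  interpret M: module R M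
    using module_quotient_module[OF cring_poly_ring] J by (simp add: ideal_iff_ideal_in)
  have G: "Pol.ideal_in V ?G" by (rule Pol.ideal_in_foldl_adjoin[OF J fs])
  show ?thesis
    unfolding seq_submodule_def
  proof (rule hull_unique)
    show "{f \<odot>\<^bsub>M\<^esub> x |f x. f \<in> set fs \<and> x \<in> carrier M} \<subseteq> cls ` ?G"
    proof
      fix X assume "X \<in> {f \<odot>\<^bsub>M\<^esub> x |f x. f \<in> set fs \<and> x \<in> carrier M}"
      then obtain f p where fp: "f \<in> set fs" "p \<in> Pol V" "X = f \<odot>\<^bsub>M\<^esub> cls p"
        by (auto simp: quotient_module_ops(1))
      have "f \<in> ?G" using Pol.foldl_adjoin_contains[OF J fs] fp(1) by blast
      then show "X \<in> cls ` ?G"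
        using quotient_module_ops(3)[OF _ fp(2), of f] Pol.ideal_inD(8)[OF G fp(2)] fp fs by blast
    qed
    show "submodule (cls ` ?G) R M" by (rule submodule_cosets[OF G])
    fix T assume gen: "{f \<odot>\<^bsub>M\<^esub> x |f x. f \<in> set fs \<and> x \<in> carrier M} \<subseteq> T" and T: "submodule T R M"
    note T' = M.submoduleE[OF T]
    have zero: "\<zero>\<^bsub>M\<^esub> \<in> T"
    proof -
      obtain X where X: "X \<in> T" using T'(2) by auto
      then have "\<zero>\<^bsub>R\<^esub> \<odot>\<^bsub>M\<^esub> X \<in> T" by (intro T'(4)) auto
      then show ?thesis using M.smult_l_null X T'(1) by auto
    qed
    let ?P = "{p \<in> Pol V. cls p \<in> T}"
    have "Pol.ideal_in V ?P"
      unfolding Pol.ideal_in_def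
    proof (intro conjI ballI)
      show "0 \<in> ?P" using zero by (simp add: quotient_module_ops(4))
      show "p + q \<in> ?P" if "p \<in> ?P" "q \<in> ?P" for p q
        using that T'(5)[of "cls p" "cls q"] quotient_module_ops(2)[of p q] Pol.add_mem[of p V q] by simp
      show "a * p \<in> ?P" if "a \<in> Pol V" "p \<in> ?P" for a p
        using that T'(4)[of a "cls p"] quotient_module_ops(3)[of a p] Pol.mult_mem[of a V p] by simp
    qed auto
    moreover have "J \<subseteq> ?P"
    proof
      fix j assume j: "j \<in> J"
      then have "cls j = cls 0" using coset_eq_iff[OF Pol.ideal_inD(5)[OF J j] Pol.zero_mem] by simp
      then show "j \<in> ?P" using zero Pol.ideal_inD(5)[OF J j] by (simp add: quotient_module_ops(4))
    qed
    moreover have "set fs \<subseteq> ?P"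
    proof
      fix f assume f: "f \<in> set fs"
      then have "f \<odot>\<^bsub>M\<^esub> cls 1 \<in> T" using gen quotient_module_ops(1) Pol.one_mem by blast
      then show "f \<in> ?P" using quotient_module_ops(3)[of f 1] f fs Pol.one_mem[of V] by (simp add: subset_iff)
    qed
    ultimately have "?G \<subseteq> ?P" by (rule Pol.foldl_adjoin_least)
    then show "cls ` ?G \<subseteq> T" by auto
  qed
qed

lemma coset_in_image_iff:
  assumes G: "Pol.ideal_in V G" "J \<subseteq> G" and p: "p \<in> Pol V"
  shows "cls p \<in> cls ` G \<longleftrightarrow> p \<in> G"
proof
  assume "cls p \<in> cls ` G"
  then obtain q where q: "q \<in> G" "cls p = cls q" by auto
  then have "p - q \<in> G" using coset_eq_iff[OF p Pol.ideal_inD(5)[OF G(1) q(1)]] G(2) by blast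
  then show "p \<in> G" using Pol.ideal_in_cong[OF G(1)] q(1) by blast
qed auto

text \<open>From here on cosets and hulls are gone. Properness becomes a separate conjunct, because
  the splitting argument passes through quotients that may be zero.\<close>

lemma regular_sequence_quotient_iff:
  "regular_sequence R M fs \<longleftrightarrow>
     set fs \<subseteq> Pol V \<and> Pol.weakly_regular V fs J \<and> foldl (Pol.adjoin V) J fs \<noteq> Pol V"
proof (cases "set fs \<subseteq> Pol V")
  case fs: True
  have ideal: "Pol.ideal_in V (foldl (Pol.adjoin V) J (take i fs))" for i
    using order_trans[OF set_take_subset fs] by (intro Pol.ideal_in_foldl_adjoin J)
  have mem: "cls p \<in> seq_submodule R M (take i fs) \<longleftrightarrow> p \<in> foldl (Pol.adjoin V) J (take i fs)"
    if "p \<in> Pol V" for p i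
    using coset_in_image_iff[OF ideal Pol.foldl_adjoin_superset that]
      seq_submodule_quotient[OF order_trans[OF set_take_subset fs]] by simp
  have "(\<forall>x\<in>carrier M. fs ! i \<odot>\<^bsub>M\<^esub> x \<in> seq_submodule R M (take i fs) \<longrightarrow> x \<in> seq_submodule R M (take i fs))
      \<longleftrightarrow> (\<forall>p\<in>Pol V. fs ! i * p \<in> foldl (Pol.adjoin V) J (take i fs) \<longrightarrow> p \<in> foldl (Pol.adjoin V) J (take i fs))"
    if "i < length fs" for i
  proof -
    have f: "fs ! i \<in> Pol V" using that fs by auto
    show ?thesis
      unfolding quotient_module_ops(1) ball_simps
      by (intro ball_cong refl) (simp add: mem quotient_module_ops(3)[OF f] Pol.mult_mem[OF f])
  qed
  moreover have "seq_submodule R M fs = carrier M \<longleftrightarrow> foldl (Pol.adjoin V) J fs = Pol V"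
  proof
    assume eq: "seq_submodule R M fs = carrier M"
    have "p \<in> foldl (Pol.adjoin V) J fs" if "p \<in> Pol V" for p
      using mem[OF that, of "length fs"] eq that by (simp add: quotient_module_ops(1))
    then show "foldl (Pol.adjoin V) J fs = Pol V"
      using Pol.ideal_inD(1)[OF ideal[of "length fs"]] by auto
  qed (simp add: seq_submodule_quotient[OF fs] quotient_module_ops(1))
  ultimately show ?thesis
    using fs by (simp add: regular_sequence_def Pol.weakly_regular_iff_nth)
qed (simp add: regular_sequence_def)

end


section \<open>Ideals of nonfaces\<close>

definition down_closed :: "'v set set \<Rightarrow> bool" where
  "down_closed \<Delta> \<longleftrightarrow> (\<forall>F\<in>\<Delta>. \<forall>G\<subseteq>F. G \<in> \<Delta>)"

text \<open>The Stanley-Reisner ideal of \<open>\<Delta>\<close>, given by supports of monomials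
  instead of generators, so that colons and sums can be computed on the complex. The void complex
  gives all of \<open>K[V]\<close>, whereas \<open>{{}}\<close> gives the polynomials without
  constant term.\<close>

definition nonface_ideal :: "'v set \<Rightarrow> 'v set set \<Rightarrow> (('v \<Rightarrow>\<^sub>0 nat) \<Rightarrow>\<^sub>0 'k::field) set" where
  "nonface_ideal V \<Delta> = {p \<in> Pol V. \<forall>m\<in>Poly_Mapping.keys p. Poly_Mapping.keys m \<notin> \<Delta>}"

definition squarefree_of :: "'v set \<Rightarrow> 'v \<Rightarrow>\<^sub>0 nat" where
  "squarefree_of U = (\<Sum>u\<in>U. Poly_Mapping.single u 1)"

lemma lookup_squarefree_of:
  "finite U \<Longrightarrow> Poly_Mapping.lookup (squarefree_of U) v = (if v \<in> U then 1 else 0)"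
  by (simp add: squarefree_of_def lookup_sum lookup_single when_def)

lemma keys_squarefree_of: "finite U \<Longrightarrow> Poly_Mapping.keys (squarefree_of U) = U"
  by (auto simp: in_keys_iff lookup_squarefree_of split: if_splits)

lemma squarefree_of_le:
  assumes "finite U" "U \<subseteq> Poly_Mapping.keys k"
  shows "Poly_Mapping.lookup (squarefree_of U) x \<le> Poly_Mapping.lookup k x"
proof (cases "x \<in> U")
  case True
  then have "Poly_Mapping.lookup k x \<noteq> 0" using assms(2) in_keys_iff[of x k] by blast
  with True assms(1) show ?thesis by (simp add: lookup_squarefree_of)
qed (simp add: lookup_squarefree_of assms(1))

lemma add_diff_poly_mapping:
  fixes a k :: "'v \<Rightarrow>\<^sub>0 nat"
  assumes "\<And>x. Poly_Mapping.lookup a x \<le> Poly_Mapping.lookup k x"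
  shows "a + (k - a) = k"
  by (rule poly_mapping_eqI) (simp add: lookup_add lookup_minus assms)

lemma ideal_in_monomial_support:
  assumes "\<And>a m. Q m \<Longrightarrow> Q (a + m)"
  shows "Pol.ideal_in V {p :: (('v \<Rightarrow>\<^sub>0 nat) \<Rightarrow>\<^sub>0 'k::field). p \<in> Pol V \<and> (\<forall>m\<in>Poly_Mapping.keys p. Q m)}"
  unfolding Pol.ideal_in_def
proof (intro conjI ballI)
  let ?N = "{p :: (('v \<Rightarrow>\<^sub>0 nat) \<Rightarrow>\<^sub>0 'k). p \<in> Pol V \<and> (\<forall>m\<in>Poly_Mapping.keys p. Q m)}"
  show "?N \<subseteq> Pol V" "0 \<in> ?N" by auto
  show "p + q \<in> ?N" if "p \<in> ?N" "q \<in> ?N" for p q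
    using that keys_add[of p q] Pol.add_mem[of p V q] by blast
  show "p * q \<in> ?N" if p: "p \<in> Pol V" and q: "q \<in> ?N" for p q
  proof -
    have "Q m" if m: "m \<in> Poly_Mapping.keys (p * q)" for m
    proof -
      obtain a b where "m = a + b" "b \<in> Poly_Mapping.keys q" using keys_mult[of p q] m by blast
      then show ?thesis using q assms by simp
    qed
    then show ?thesis using p q Pol.mult_mem[of p V q] by simp
  qed
qed

lemma ideal_in_nonface_ideal:
  assumes "down_closed \<Delta>"
  shows "Pol.ideal_in V (nonface_ideal V \<Delta>)"
  unfolding nonface_ideal_def
proof (rule ideal_in_monomial_support)
  fix a m :: "'a \<Rightarrow>\<^sub>0 nat"
  have "Poly_Mapping.keys m \<subseteq> Poly_Mapping.keys (a + m)" by (simp add: keys_add_exponent)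
  then show "Poly_Mapping.keys (a + m) \<notin> \<Delta>" if "Poly_Mapping.keys m \<notin> \<Delta>"
    using assms that unfolding down_closed_def by blast
qed

lemma single_in_nonface_ideal:
  "Poly_Mapping.keys m \<subseteq> V \<Longrightarrow> Poly_Mapping.keys m \<notin> \<Delta> \<Longrightarrow> Poly_Mapping.single m c \<in> nonface_ideal V \<Delta>"
  by (simp add: nonface_ideal_def single_in_Pol)

lemma nonface_ideal_subset:
  fixes N :: "(('v \<Rightarrow>\<^sub>0 nat) \<Rightarrow>\<^sub>0 'k::field) set"
  assumes "Pol.ideal_in V N"
    and "\<And>m c. Poly_Mapping.keys m \<subseteq> V \<Longrightarrow> Poly_Mapping.keys m \<notin> \<Delta> \<Longrightarrow> Poly_Mapping.single m c \<in> N"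
  shows "nonface_ideal V \<Delta> \<subseteq> N"
proof
  fix p :: "('v \<Rightarrow>\<^sub>0 nat) \<Rightarrow>\<^sub>0 'k" assume p: "p \<in> nonface_ideal V \<Delta>"
  have "(\<Sum>m\<in>Poly_Mapping.keys p. Poly_Mapping.single m (Poly_Mapping.lookup p m)) \<in> N"
    using p by (intro Pol.ideal_in_sum[OF assms(1)] assms(2)) (auto simp: nonface_ideal_def Pol_iff)
  then show "p \<in> N" by (simp add: sum_single_keys)
qed

lemma indet_in_nonface_ideal_iff: "indet v \<in> nonface_ideal V \<Delta> \<longleftrightarrow> v \<in> V \<and> {v} \<notin> \<Delta>"
  by (auto simp: nonface_ideal_def indet_def monomial_def Pol_iff)

text \<open>The colon corresponds to the star of \<open>U\<close> rather than its link: the vertices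
  of \<open>U\<close> remain as cone points, so the polynomial ring does not change. The star is
  void if \<open>U\<close> is not a face of a down-closed \<open>\<Delta>\<close>.\<close>

lemma colon_nonface_ideal:
  assumes U: "finite U" "U \<subseteq> V"
  shows "{p \<in> Pol V. monomial (squarefree_of U) * p \<in> nonface_ideal V \<Delta>} = nonface_ideal V {S. S \<union> U \<in> \<Delta>}"
proof -
  let ?x = "monomial (squarefree_of U)"
  have x: "?x \<in> Pol V" using U by (simp add: monomial_def single_in_Pol keys_squarefree_of)
  have keys: "k \<in> Poly_Mapping.keys (?x * p) \<longleftrightarrow>
      (\<forall>y. Poly_Mapping.lookup (squarefree_of U) y \<le> Poly_Mapping.lookup k y) \<and> k - squarefree_of U \<in> Poly_Mapping.keys p"
    for k and p :: "('a \<Rightarrow>\<^sub>0 nat) \<Rightarrow>\<^sub>0 'b"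
    by (simp add: in_keys_iff[of k] in_keys_iff[of "k - squarefree_of U"] monomial_def lookup_single_mult)
  have union: "Poly_Mapping.keys (squarefree_of U + m) = Poly_Mapping.keys m \<union> U" for m
    by (auto simp: keys_add_exponent keys_squarefree_of U)
  have "(\<forall>k\<in>Poly_Mapping.keys (?x * p). Poly_Mapping.keys k \<notin> \<Delta>) \<longleftrightarrow>
      (\<forall>m\<in>Poly_Mapping.keys p. Poly_Mapping.keys m \<union> U \<notin> \<Delta>)" for p :: "('a \<Rightarrow>\<^sub>0 nat) \<Rightarrow>\<^sub>0 'b"
  proof (intro iffI ballI)
    fix m assume *: "\<forall>k\<in>Poly_Mapping.keys (?x * p). Poly_Mapping.keys k \<notin> \<Delta>" and m: "m \<in> Poly_Mapping.keys p"
    have "squarefree_of U + m \<in> Poly_Mapping.keys (?x * p)"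
      unfolding keys using m by (simp add: lookup_add)
    with * show "Poly_Mapping.keys m \<union> U \<notin> \<Delta>" by (simp flip: union)
  next
    fix k assume *: "\<forall>m\<in>Poly_Mapping.keys p. Poly_Mapping.keys m \<union> U \<notin> \<Delta>" and k: "k \<in> Poly_Mapping.keys (?x * p)"
    then have "Poly_Mapping.keys (k - squarefree_of U) \<union> U \<notin> \<Delta>" unfolding keys by blast
    moreover have "squarefree_of U + (k - squarefree_of U) = k"
      using k unfolding keys by (intro add_diff_poly_mapping) blast
    ultimately show "Poly_Mapping.keys k \<notin> \<Delta>" using union[of "k - squarefree_of U"] by simp
  qed
  then show ?thesis
    using Pol.mult_mem[OF x] by (auto simp: nonface_ideal_def)
qed

lemma adjoin_nonface_ideal:
  assumes \<Delta>: "down_closed \<Delta>" and U: "finite U" "U \<subseteq> V"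
  shows "Pol.adjoin V (nonface_ideal V \<Delta>) (monomial (squarefree_of U)) = nonface_ideal V {S \<in> \<Delta>. \<not> U \<subseteq> S}"
proof
  let ?N = "nonface_ideal V \<Delta> :: (('a \<Rightarrow>\<^sub>0 nat) \<Rightarrow>\<^sub>0 'b) set" and ?x = "monomial (squarefree_of U) :: ('a \<Rightarrow>\<^sub>0 nat) \<Rightarrow>\<^sub>0 'b"
  note N = ideal_in_nonface_ideal[OF \<Delta>, of V]
  have "down_closed {S \<in> \<Delta>. \<not> U \<subseteq> S}" using \<Delta> unfolding down_closed_def by blast
  note N' = ideal_in_nonface_ideal[OF this, of V]
  have x: "?x \<in> Pol V" using U by (simp add: monomial_def single_in_Pol keys_squarefree_of)
  show "Pol.adjoin V ?N ?x \<subseteq> nonface_ideal V {S \<in> \<Delta>. \<not> U \<subseteq> S}"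
  proof (rule Pol.adjoin_least[OF N'])
    show "?N \<subseteq> nonface_ideal V {S \<in> \<Delta>. \<not> U \<subseteq> S}" by (auto simp: nonface_ideal_def)
    show "?x \<in> nonface_ideal V {S \<in> \<Delta>. \<not> U \<subseteq> S}"
      unfolding monomial_def by (rule single_in_nonface_ideal) (use U in \<open>auto simp: keys_squarefree_of\<close>)
  qed
  show "nonface_ideal V {S \<in> \<Delta>. \<not> U \<subseteq> S} \<subseteq> Pol.adjoin V ?N ?x"
  proof (rule nonface_ideal_subset[OF Pol.ideal_in_adjoin[OF N x]])
    fix m :: "'a \<Rightarrow>\<^sub>0 nat" and c :: 'b
    assume m: "Poly_Mapping.keys m \<subseteq> V" "Poly_Mapping.keys m \<notin> {S \<in> \<Delta>. \<not> U \<subseteq> S}"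
    show "Poly_Mapping.single m c \<in> Pol.adjoin V ?N ?x"
    proof (cases "Poly_Mapping.keys m \<in> \<Delta>")
      case False
      then show ?thesis
        using single_in_nonface_ideal[OF m(1)] subsetD[OF Pol.adjoin_superset] by blast
    next
      case True
      then have Um: "U \<subseteq> Poly_Mapping.keys m" using m(2) by blast
      let ?r = "m - squarefree_of U"
      have eq: "squarefree_of U + ?r = m"
        by (rule add_diff_poly_mapping) (rule squarefree_of_le[OF U(1) Um])
      then have "Poly_Mapping.keys ?r \<subseteq> Poly_Mapping.keys m"
        by (metis keys_add_exponent sup_ge2)
      then have "Poly_Mapping.single ?r c \<in> Pol V" using m(1) by (intro single_in_Pol) blast
      from Pol.adjoinI[OF Pol.ideal_inD(2)[OF N] this, of ?x] eq show ?thesis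
        by (simp add: monomial_def mult_single)
    qed
  qed
qed

text \<open>The complexes that \<open>I \<mapsto> (I : x\<^sub>U), I + (x\<^sub>U)\<close> splits into simplices of at least \<open>d\<close> vertices;
  \<open>I\<close> is the ideal of nonfaces.\<close>

inductive splits :: "'v set \<Rightarrow> nat \<Rightarrow> 'v set set \<Rightarrow> bool" for V d where
  splits_void: "splits V d {}"
| splits_simplex: "F \<subseteq> V \<Longrightarrow> d \<le> card F \<Longrightarrow> splits V d (Pow F)"
| splits_step: "U \<subseteq> V \<Longrightarrow> splits V d {S. S \<union> U \<in> \<Delta>} \<Longrightarrow> splits V d {S \<in> \<Delta>. \<not> U \<subseteq> S} \<Longrightarrow> splits V d \<Delta>"

text \<open>On a simplex the variables outside \<open>F\<close> lie in the ideal, and the ideal is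
  extended in those of \<open>F\<close>; on the zero module, from the void complex, every sequence
  is weakly regular. The degrees start at 1 to keep the sequence in the irrelevant ideal.\<close>

theorem weakly_regular_splits:
  assumes "splits V d \<Delta>" and "down_closed \<Delta>" and V: "distinct vs" "set vs = V"
  shows "Pol.weakly_regular V (complete_sym_seq vs 1 d :: (('v \<Rightarrow>\<^sub>0 nat) \<Rightarrow>\<^sub>0 'k::field) list)
           (nonface_ideal V \<Delta>)"
  using assms(1,2)
proof (induction rule: splits.induct)
  case splits_void
  have "nonface_ideal V {} = (Pol V :: (('v \<Rightarrow>\<^sub>0 nat) \<Rightarrow>\<^sub>0 'k) set)"
    by (auto simp: nonface_ideal_def)
  then show ?case
    using Pol.weakly_regular_carrier[OF complete_sym_seq_subset_Pol[of vs V]] V by simp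
next
  case (splits_simplex F)
  let ?N = "nonface_ideal V (Pow F) :: (('v \<Rightarrow>\<^sub>0 nat) \<Rightarrow>\<^sub>0 'k) set"
  show ?case
  proof (rule weakly_regular_complete_sym)
    show "Pol.ideal_in V ?N" by (rule ideal_in_nonface_ideal[OF splits_simplex.prems])
    show "set vs \<subseteq> V" "distinct vs" using V by auto
    show "extended_in v ?N" if "v \<in> set vs" "indet v \<notin> ?N" for v
      unfolding extended_in_def
    proof (intro ballI allI)
      have v: "v \<in> F" using that V by (simp add: indet_in_nonface_ideal_iff)
      fix p t assume p: "p \<in> ?N"
      have "\<not> Poly_Mapping.keys m \<subseteq> F" if "m \<in> Poly_Mapping.keys (coeff_in v t p)" for m
      proof -
        have "m + Poly_Mapping.single v t \<in> Poly_Mapping.keys p"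
          using that by (auto simp: in_keys_iff coeff_in.rep_eq split: if_splits)
        then have "\<not> Poly_Mapping.keys (m + Poly_Mapping.single v t) \<subseteq> F"
          using p by (simp add: nonface_ideal_def)
        with v show ?thesis by (auto simp: keys_add_exponent split: if_splits)
      qed
      moreover have "coeff_in v t p \<in> Pol V"
        using p by (intro coeff_in_Pol) (simp add: nonface_ideal_def)
      ultimately show "coeff_in v t p \<in> ?N" by (simp add: nonface_ideal_def)
    qed
    have "filter (\<lambda>v. indet v \<notin> ?N) vs = filter (\<lambda>v. v \<in> F) vs"
      using V by (intro filter_cong refl) (simp add: indet_in_nonface_ideal_iff)
    moreover have "length (filter (\<lambda>v. v \<in> F) vs) = card F"
      using V splits_simplex.hyps distinct_length_filter[of vs "\<lambda>v. v \<in> F"]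
      by (simp add: Int_absorb2 Collect_mem_eq)
    ultimately show "d \<le> length (filter (\<lambda>v. indet v \<notin> ?N) vs)"
      using splits_simplex.hyps by simp
  qed
next
  case (splits_step U \<Delta>)
  let ?N = "nonface_ideal V \<Delta> :: (('v \<Rightarrow>\<^sub>0 nat) \<Rightarrow>\<^sub>0 'k) set"
  have U: "finite U" "U \<subseteq> V" using splits_step.hyps V by (auto intro: finite_subset)
  have closed: "down_closed {S. S \<union> U \<in> \<Delta>}" "down_closed {S \<in> \<Delta>. \<not> U \<subseteq> S}"
    using splits_step.prems unfolding down_closed_def by (blast intro: Un_mono)+
  show ?case
  proof (rule Pol.weakly_regular_split)
    show "Pol.ideal_in V ?N" by (rule ideal_in_nonface_ideal[OF splits_step.prems])
    show "monomial (squarefree_of U) \<in> Pol V"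
      using U by (simp add: monomial_def single_in_Pol keys_squarefree_of)
    show "set (complete_sym_seq vs 1 d) \<subseteq> Pol V" using V by (intro complete_sym_seq_subset_Pol) simp
    show "Pol.weakly_regular V (complete_sym_seq vs 1 d) {p \<in> Pol V. monomial (squarefree_of U) * p \<in> ?N}"
      unfolding colon_nonface_ideal[OF U] by (rule splits_step.IH(1)[OF closed(1)])
    show "Pol.weakly_regular V (complete_sym_seq vs 1 d) (Pol.adjoin V ?N (monomial (squarefree_of U)))"
      unfolding adjoin_nonface_ideal[OF splits_step.prems U] by (rule splits_step.IH(2)[OF closed(2)])
  qed
qed

section \<open>Lower bound on the depth from a splitting\<close>

lemma down_closed_empty_face: "down_closed {{}}"
  by (simp add: down_closed_def)

lemma irrelevant_ideal_subset: "irrelevant_ideal V \<subseteq> nonface_ideal V {{}}"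
  unfolding irrelevant_ideal_def
  by (subst genideal_subset_iff[OF ideal_in_nonface_ideal[OF down_closed_empty_face]])
    (auto simp: indet_in_Pol indet_in_nonface_ideal_iff)

lemma ideal_in_irrelevant: "Pol.ideal_in V (irrelevant_ideal V)"
  unfolding irrelevant_ideal_def by (rule ideal_in_genideal) (auto simp: indet_in_Pol)

lemma indet_in_irrelevant: "v \<in> V \<Longrightarrow> indet v \<in> irrelevant_ideal V"
  unfolding irrelevant_ideal_def by (rule generator_in_genideal) (auto simp: indet_in_Pol)

lemma irrelevant_ideal_least: "Pol.ideal_in V P \<Longrightarrow> indet ` V \<subseteq> P \<Longrightarrow> irrelevant_ideal V \<subseteq> P"
  unfolding irrelevant_ideal_def by (subst genideal_subset_iff) (auto simp: indet_in_Pol)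

lemma complete_sym_in_irrelevant: "set vs \<subseteq> V \<Longrightarrow> complete_sym (Suc j) vs \<in> irrelevant_ideal V"
proof (induction vs arbitrary: j)
  case Nil
  then show ?case using Pol.ideal_inD(2)[OF ideal_in_irrelevant] by simp
next
  case (Cons v vs)
  then have "v \<in> V" "set vs \<subseteq> V" by auto
  then show ?case
    unfolding complete_sym.simps
    by (intro Pol.ideal_inD(3,8)[OF ideal_in_irrelevant] Cons.IH indet_in_irrelevant
        complete_sym_in_Pol Cons.prems)
qed

lemma foldl_adjoin_irrelevant_neq_Pol:
  assumes "{} \<in> \<Delta>" "set fs \<subseteq> irrelevant_ideal V"
  shows "foldl (Pol.adjoin V) (nonface_ideal V \<Delta>) fs \<noteq> (Pol V :: (('v \<Rightarrow>\<^sub>0 nat) \<Rightarrow>\<^sub>0 'k::field) set)"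
proof -
  let ?N0 = "nonface_ideal V {{}} :: (('v \<Rightarrow>\<^sub>0 nat) \<Rightarrow>\<^sub>0 'k) set"
  have "foldl (Pol.adjoin V) (nonface_ideal V \<Delta>) fs \<subseteq> ?N0"
  proof (rule Pol.foldl_adjoin_least)
    show "Pol.ideal_in V ?N0" by (rule ideal_in_nonface_ideal[OF down_closed_empty_face])
    show "nonface_ideal V \<Delta> \<subseteq> ?N0" using assms(1) by (auto simp: nonface_ideal_def)
    show "set fs \<subseteq> ?N0" using assms(2) irrelevant_ideal_subset by (rule order_trans)
  qed
  moreover have "1 \<notin> ?N0" by (simp add: nonface_ideal_def)
  ultimately show ?thesis using Pol.one_mem by blast
qed

theorem depth_ge_if_splits:
  assumes "finite V" and \<Delta>: "down_closed \<Delta>" "{} \<in> \<Delta>" and "splits V d \<Delta>"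
  shows "enat d \<le> depth_quotient V (nonface_ideal V \<Delta> :: (('v \<Rightarrow>\<^sub>0 nat) \<Rightarrow>\<^sub>0 'k::field) set)"
proof -
  let ?N = "nonface_ideal V \<Delta> :: (('v \<Rightarrow>\<^sub>0 nat) \<Rightarrow>\<^sub>0 'k) set"
  obtain vs where vs: "set vs = V" "distinct vs" using finite_distinct_list[OF \<open>finite V\<close>] by blast
  let ?fs = "complete_sym_seq vs 1 d :: (('v \<Rightarrow>\<^sub>0 nat) \<Rightarrow>\<^sub>0 'k) list"
  have irr: "set ?fs \<subseteq> irrelevant_ideal V"
  proof
    fix f assume "f \<in> set ?fs"
    then obtain i where i: "i \<ge> 1" "f = complete_sym i vs" by (auto simp: set_complete_sym_seq)
    then show "f \<in> irrelevant_ideal V"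
      using complete_sym_in_irrelevant[of vs V "i - 1"] vs by simp
  qed
  have "regular_sequence (poly_ring V) (quotient_module (poly_ring V) ?N) ?fs"
    unfolding regular_sequence_quotient_iff[OF ideal_in_nonface_ideal[OF \<Delta>(1)]]
    using complete_sym_seq_subset_Pol[OF equalityD1[OF vs(1)]]
      weakly_regular_splits[OF assms(4) \<Delta>(1) vs(2,1)] foldl_adjoin_irrelevant_neq_Pol[OF \<Delta>(2) irr]
    by blast
  with irr have "?fs \<in> {fs. set fs \<subseteq> irrelevant_ideal V \<and>
      regular_sequence (poly_ring V) (quotient_module (poly_ring V) ?N) fs}" by simp
  from SUP_upper[OF this, of "\<lambda>fs. enat (length fs)"] show ?thesis
    unfolding depth_quotient_def depth_def length_complete_sym_seq .
qed

section \<open>Upper bound on the depth from a disconnected link\<close>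

lemma alt_sign_cases: "alt_sign v S = (1 :: 'a::comm_ring_1) \<or> alt_sign v S = (- 1 :: 'a)"
  unfolding alt_sign_def using neg_one_even_power neg_one_odd_power by blast

text \<open>A disconnected link of \<open>F\<close> (the parts \<open>P\<close> and \<open>V - F - P\<close>) gives a nonzero Koszul cohomology
  class in degree \<open>card F + 1\<close>, represented by \<open>F \<union> {a} \<mapsto> \<plusminus> x\<^sub>a\<^sup>2 x\<^sub>F\<close> for \<open>a \<in> P\<close>.\<close>

theorem length_weakly_regular_le:
  fixes fs :: "(('v::linorder \<Rightarrow>\<^sub>0 nat) \<Rightarrow>\<^sub>0 'k::field) list"
  assumes V: "finite V" and \<Delta>: "down_closed \<Delta>" and FP: "F \<subseteq> V" "P \<subseteq> V - F"
    and a0: "a0 \<in> P" "insert a0 F \<in> \<Delta>" and b0: "b0 \<in> V - F - P" "insert b0 F \<in> \<Delta>"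
    and disc: "\<And>a b. a \<in> P \<Longrightarrow> b \<in> V - F - P \<Longrightarrow> insert a (insert b F) \<notin> \<Delta>"
    and fs: "set fs \<subseteq> irrelevant_ideal V" "Pol.weakly_regular V fs (nonface_ideal V \<Delta>)"
  shows "length fs \<le> Suc (card F)"
proof (rule ccontr)
  assume "\<not> length fs \<le> Suc (card F)"
  then have len: "Suc (card F) < length fs" by simp
  let ?N = "nonface_ideal V \<Delta> :: (('v \<Rightarrow>\<^sub>0 nat) \<Rightarrow>\<^sub>0 'k) set"
  have N: "Pol.ideal_in V ?N" by (rule ideal_in_nonface_ideal[OF \<Delta>])
  note I = Pol.ideal_inD[OF N]
  have fin: "finite F" "finite P" using FP V by (auto intro: finite_subset)
  define y where "y v = (indet v :: ('v \<Rightarrow>\<^sub>0 nat) \<Rightarrow>\<^sub>0 'k)\<^sup>2" for v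
  \<comment> \<open>For \<open>v\<close> outside \<open>F\<close>, the monomial with this exponent
    has multidegree \<open>-F\<close> after division by the product of the \<open>y u\<close> over
    \<open>u\<close> in \<open>insert v F\<close>.\<close>
  define e where "e v = Poly_Mapping.single v 2 + squarefree_of F" for v
  define z where "z v = (Poly_Mapping.single (e v) 1 :: ('v \<Rightarrow>\<^sub>0 nat) \<Rightarrow>\<^sub>0 'k)" for v
  define c where "c S = (\<Sum>a\<in>P. if S = insert a F then alt_sign a S * z a else 0)" for S
  have y_single: "y v = Poly_Mapping.single (Poly_Mapping.single v 2) 1" for v
    by (simp add: y_def indet_def monomial_def power2_eq_square mult_single numeral_2_eq_2 flip: single_add)
  have keys_e: "Poly_Mapping.keys (e v) = insert v F" for v
    by (auto simp: e_def keys_add_exponent keys_squarefree_of fin)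
  have z_Pol: "z v \<in> Pol V" if "v \<in> V" for v
    unfolding z_def by (rule single_in_Pol) (use that FP keys_e in auto)
  have sgn: "alt_sign v S \<in> Pol V" for v :: 'v and S unfolding alt_sign_def by (intro Pol.power_mem Pol.uminus_mem Pol.one_mem)
  have c_Pol: "c S \<in> Pol V" for S
    unfolding c_def
  proof (rule Pol.sum_mem)
    show "(if S = insert a F then alt_sign a S * z a else 0) \<in> Pol V" if "a \<in> P" for a
      using Pol.mult_mem[OF sgn z_Pol, of a a S] that FP by auto
  qed
  have c_insert: "c (insert a F) = alt_sign a (insert a F) * z a" if "a \<in> P" for a
  proof -
    have "insert a F = insert a' F \<longleftrightarrow> a = a'" if "a' \<in> P" for a' using that \<open>a \<in> P\<close> FP by auto
    then have "c (insert a F) = (\<Sum>a'\<in>P. if a = a' then alt_sign a' (insert a F) * z a' else 0)"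
      unfolding c_def by (intro sum.cong) auto
    also have "\<dots> = alt_sign a (insert a F) * z a" using that fin by simp
    finally show ?thesis .
  qed
  have c_0: "c S = 0" if "\<And>a. a \<in> P \<Longrightarrow> S \<noteq> insert a F" for S
    unfolding c_def using that by (intro sum.neutral) auto
  have cocycle: "Pol.cocycle V V y ?N (Suc (card F)) c"
    unfolding Pol.cocycle_def
  proof (intro conjI allI impI c_Pol)
    fix S assume S: "S \<subseteq> V" "card S = Suc (Suc (card F))"
    have finS: "finite S" using S V by (auto intro: finite_subset)
    show "koszul y c S \<in> ?N"
    \<comment> \<open>If \<open>S\<close> adds two vertices of \<open>P\<close> to \<open>F\<close>,
      the two remaining terms cancel. Otherwise each term by itself is zero or has a support that
      joins \<open>P\<close> to the other part, which is a nonface.\<close>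
    proof (cases "\<exists>v w. v \<in> P \<and> w \<in> P \<and> v \<noteq> w \<and> S = insert v (insert w F)")
      case True
      then obtain v w where vw: "v \<in> P" "w \<in> P" "v \<noteq> w" and S': "S = insert v (insert w F)" by auto
      have nF: "v \<notin> F" "w \<notin> F" using vw FP by auto
      have Sv: "S - {v} = insert w F" and Sw: "S - {w} = insert v F" using S' nF vw by auto
      have rest: "alt_sign u S * y u * c (S - {u}) = 0" if "u \<in> S - {v, w}" for u
      proof -
        have "u \<in> F" using that S' by auto
        then have "c (S - {u}) = 0" by (intro c_0) blast
        then show ?thesis by simp
      qed
      have "koszul y c S = (\<Sum>u\<in>{v, w}. alt_sign u S * y u * c (S - {u}))"
        unfolding koszul_def using finS S' rest by (intro sum.mono_neutral_right) auto
      also have "\<dots> = alt_sign v S * y v * (alt_sign w (insert w F) * z w)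
          + alt_sign w S * y w * (alt_sign v (insert v F) * z v)"
        using vw by (simp add: Sv Sw c_insert)
      also have "y w * z v = y v * z w"
        by (simp add: y_single z_def e_def mult_single ac_simps)
      then have "alt_sign v S * y v * (alt_sign w (insert w F) * z w)
          + alt_sign w S * y w * (alt_sign v (insert v F) * z v)
        = (alt_sign v S * alt_sign w (S - {v}) + alt_sign w S * alt_sign v (S - {w})) * (y v * z w)"
        unfolding Sv Sw by (simp add: algebra_simps)
      also have "\<dots> = 0"
        using alt_sign_swap[OF finS, of w v, where 'a = "('v \<Rightarrow>\<^sub>0 nat) \<Rightarrow>\<^sub>0 'k"] S' vw by simp
      finally show ?thesis using I(2) by simp
    next
      case False
      show ?thesis
        unfolding koszul_def
      proof (rule Pol.ideal_in_sum[OF N])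
        fix v assume v: "v \<in> S"
        show "alt_sign v S * y v * c (S - {v}) \<in> ?N"
        proof (cases "\<exists>a\<in>P. S - {v} = insert a F")
          case True
          then obtain a where a: "a \<in> P" "S - {v} = insert a F" by auto
          then have S': "S = insert v (insert a F)" and vn: "v \<noteq> a" "v \<notin> F" using v by auto
          then have "v \<in> V - F - P" using False a(1) v S by blast
          from disc[OF a(1) this] have nf: "insert v (insert a F) \<notin> \<Delta>" by (simp add: insert_commute)
          have "y v * z a = Poly_Mapping.single (Poly_Mapping.single v 2 + e a) 1"
            by (simp add: y_single z_def mult_single)
          also have "\<dots> \<in> ?N"
            by (rule single_in_nonface_ideal) (use nf S S' in \<open>simp_all add: keys_add_exponent keys_e insert_commute\<close>)
          finally have "(alt_sign v S * alt_sign a (S - {v})) * (y v * z a) \<in> ?N"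
            by (rule I(4)[OF Pol.mult_mem[OF sgn sgn]])
          then show ?thesis using c_insert[OF a(1)] a(2) by (simp add: ac_simps)
        next
          case False
          then have "c (S - {v}) = 0" by (intro c_0) blast
          then show ?thesis using I(2) by simp
        qed
      qed
    qed
  qed
  have "f \<in> Q" if "f \<in> set fs" "Pol.ideal_in V Q" "indet ` V \<subseteq> Q" for f Q
    using irrelevant_ideal_least[OF that(2,3)] fs(1) that(1) by blast
  from Pol.koszul_vanishing[where x = indet, OF V indet_in_Pol this N fs(2) len]
  have "Pol.coboundary V V y ?N (Suc (card F)) c" using cocycle unfolding y_def by simp
  then obtain b where b: "\<And>S. S \<subseteq> V \<Longrightarrow> card S = Suc (card F) \<Longrightarrow> c S - koszul y b S \<in> ?N"
    unfolding Pol.coboundary_def by blast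
  \<comment> \<open>Since \<open>insert v F\<close> is a face, members of the ideal have no monomial
    \<open>e v\<close>. In the coboundary of \<open>b\<close> the terms with \<open>u\<close> in
    \<open>F\<close> do not reach it either, as \<open>y u\<close> does not divide it. What remains
    is a coefficient of \<open>b F\<close> that does not depend on \<open>v\<close>.\<close>
  have coefficient: "Poly_Mapping.lookup g (e v) = Poly_Mapping.lookup (b F) (squarefree_of F)"
    if v: "v \<in> V - F" "insert v F \<in> \<Delta>" and cv: "c (insert v F) = alt_sign v (insert v F) * g" for v g
  proof -
    let ?S = "insert v F"
    let ?L = "\<lambda>p. Poly_Mapping.lookup p (e v)"
    have sgn_mult: "alt_sign u T * p = p \<or> alt_sign u T * p = - p" for u :: 'v and T and p :: "('v \<Rightarrow>\<^sub>0 nat) \<Rightarrow>\<^sub>0 'k"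
      using alt_sign_cases[of u T, where 'a = "('v \<Rightarrow>\<^sub>0 nat) \<Rightarrow>\<^sub>0 'k"] by auto
    have "?L (alt_sign u ?S * y u * b (?S - {u})) = 0" if u: "u \<in> F" for u
    proof -
      have "Poly_Mapping.lookup (e v) u = 1"
        using u v fin by (auto simp: e_def lookup_add lookup_single when_def lookup_squarefree_of)
      then have "\<not> (\<forall>x. Poly_Mapping.lookup (Poly_Mapping.single u 2) x \<le> Poly_Mapping.lookup (e v) x)"
        by (auto simp: not_le intro!: exI[of _ u])
      then have "?L (y u * b (?S - {u})) = 0" unfolding y_single lookup_single_mult by (rule if_not_P)
      then show ?thesis using sgn_mult[of u ?S "y u * b (?S - {u})"] by (auto simp: mult.assoc)
    qed
    then have "?L (\<Sum>u\<in>F. alt_sign u ?S * y u * b (?S - {u})) = 0"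
      by (simp add: lookup_sum)
    moreover have "?S - {v} = F" using v by auto
    then have "c ?S - koszul y b ?S
        = alt_sign v ?S * (g - y v * b F) - (\<Sum>u\<in>F. alt_sign u ?S * y u * b (?S - {u}))"
      using v fin by (simp add: cv koszul_def algebra_simps)
    moreover have "?L (c ?S - koszul y b ?S) = 0"
    proof -
      have "c ?S - koszul y b ?S \<in> ?N" using v FP fin by (intro b) auto
      then have "e v \<notin> Poly_Mapping.keys (c ?S - koszul y b ?S)"
        using v(2) keys_e[of v] by (auto simp: nonface_ideal_def)
      then show ?thesis by (simp add: in_keys_iff)
    qed
    ultimately have "?L (alt_sign v ?S * (g - y v * b F)) = 0" by (simp add: lookup_minus)
    then have "?L (g - y v * b F) = 0" using sgn_mult[of v ?S "g - y v * b F"] by (auto simp: lookup_minus)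
    moreover have "?L (y v * b F) = Poly_Mapping.lookup (b F) (squarefree_of F)"
    proof -
      have "\<forall>x. Poly_Mapping.lookup (Poly_Mapping.single v 2) x \<le> Poly_Mapping.lookup (e v) x"
        by (simp add: e_def lookup_add)
      moreover have "e v - Poly_Mapping.single v 2 = squarefree_of F" by (simp add: e_def)
      ultimately show ?thesis unfolding y_single lookup_single_mult by simp
    qed
    ultimately show ?thesis by (simp add: lookup_minus)
  qed
  \<comment> \<open>The vertex \<open>a0\<close> forces the value 1 and \<open>b0\<close> the value
    0: the indicator function of \<open>P\<close> is not constant on the vertices of the
    link.\<close>
  have "Poly_Mapping.lookup (b F) (squarefree_of F) = 1"
    using coefficient[OF _ a0(2) c_insert[OF a0(1)]] a0(1) FP by (auto simp: z_def)
  moreover have "c (insert b0 F) = alt_sign b0 (insert b0 F) * 0"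
    unfolding mult_zero_right using b0 FP by (intro c_0) auto
  from coefficient[OF _ b0(2) this] have "Poly_Mapping.lookup (b F) (squarefree_of F) = 0"
    using b0(1) by auto
  ultimately show False by simp
qed

corollary depth_le_if_link_disconnected:
  fixes V :: "'v::linorder set"
  assumes "finite V" and \<Delta>: "down_closed \<Delta>" and "F \<subseteq> V" "P \<subseteq> V - F"
    and "a0 \<in> P" "insert a0 F \<in> \<Delta>" "b0 \<in> V - F - P" "insert b0 F \<in> \<Delta>"
    and "\<And>a b. a \<in> P \<Longrightarrow> b \<in> V - F - P \<Longrightarrow> insert a (insert b F) \<notin> \<Delta>"
  shows "depth_quotient V (nonface_ideal V \<Delta> :: (('v \<Rightarrow>\<^sub>0 nat) \<Rightarrow>\<^sub>0 'k::field) set) \<le> enat (Suc (card F))"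
  unfolding depth_quotient_def depth_def
proof (rule SUP_least)
  fix fs :: "(('v \<Rightarrow>\<^sub>0 nat) \<Rightarrow>\<^sub>0 'k) list"
  assume "fs \<in> {fs. set fs \<subseteq> irrelevant_ideal V \<and>
    regular_sequence (poly_ring V) (quotient_module (poly_ring V) (nonface_ideal V \<Delta>)) fs}"
  then have "set fs \<subseteq> irrelevant_ideal V" "Pol.weakly_regular V fs (nonface_ideal V \<Delta>)"
    unfolding regular_sequence_quotient_iff[OF ideal_in_nonface_ideal[OF \<Delta>]] by auto
  from length_weakly_regular_le[OF assms this] show "enat (length fs) \<le> enat (Suc (card F))" by simp
qed


section \<open>Second square-free powers of edge ideals\<close>

definition matching_complex :: "'v set \<Rightarrow> 'v set set \<Rightarrow> 'v set set" where
  "matching_complex V E = {S. S \<subseteq> V \<and> (\<forall>e\<in>E. \<forall>e'\<in>E. e \<union> e' \<subseteq> S \<longrightarrow> e \<inter> e' \<noteq> {})}"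

lemma down_closed_matching_complex: "down_closed (matching_complex V E)"
  unfolding down_closed_def matching_complex_def by (auto 0 3 dest: order_trans)

context
  fixes V :: "'v set" and E :: "'v set set"
  assumes E: "\<And>e. e \<in> E \<Longrightarrow> e \<subseteq> V" "\<And>e. e \<in> E \<Longrightarrow> card e = 2"
begin

lemma finite_edge: "e \<in> E \<Longrightarrow> finite e"
  by (rule card_ge_0_finite) (simp add: E(2))

lemma indet_mult_indet: "x \<noteq> y \<Longrightarrow> indet x * indet y = monomial (squarefree_of {x, y})"
  by (simp add: indet_def monomial_def mult_single squarefree_of_def)

lemma edge_generators_in_Pol: "{indet x * indet y |x y. {x, y} \<in> E} \<subseteq> Pol V"
proof
  fix p assume "p \<in> {indet x * indet y |x y. {x, y} \<in> E}"
  then obtain x y where xy: "p = indet x * indet y" "{x, y} \<in> E" by blast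
  then have "x \<in> V" "y \<in> V" using E(1)[of "{x, y}"] by simp_all
  then show "p \<in> Pol V" unfolding xy(1) by (intro Pol.mult_mem indet_in_Pol)
qed

lemma edge_monomial_in_edge_ideal:
  assumes "e \<in> E"
  shows "monomial (squarefree_of e) \<in> edge_ideal V E"
proof -
  obtain x y where xy: "e = {x, y}" "x \<noteq> y" using E(2)[OF assms] by (auto simp: card_2_iff)
  have "indet x * indet y \<in> edge_ideal V E"
    unfolding edge_ideal_def
  proof (rule generator_in_genideal[OF edge_generators_in_Pol])
    show "indet x * indet y \<in> {indet x * indet y |x y. {x, y} \<in> E}" using assms xy by blast
  qed
  then show ?thesis by (simp add: xy indet_mult_indet)
qed

lemma edge_ideal_supports:
  assumes "p \<in> edge_ideal V E"
  shows "p \<in> Pol V \<and> (\<forall>m\<in>Poly_Mapping.keys p. \<exists>e\<in>E. \<forall>x. Poly_Mapping.lookup (squarefree_of e) x \<le> Poly_Mapping.lookup m x)"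
proof -
  let ?Q = "\<lambda>m. \<exists>e\<in>E. \<forall>x. Poly_Mapping.lookup (squarefree_of e) x \<le> Poly_Mapping.lookup m x"
  have "edge_ideal V E \<subseteq> {p \<in> Pol V. \<forall>m\<in>Poly_Mapping.keys p. ?Q m}"
    unfolding edge_ideal_def
  proof (subst genideal_subset_iff[OF _ edge_generators_in_Pol])
    show "Pol.ideal_in V {p \<in> Pol V. \<forall>m\<in>Poly_Mapping.keys p. ?Q m}"
    proof (rule ideal_in_monomial_support)
      fix a m assume "?Q m"
      then show "?Q (a + m)" unfolding lookup_add by (meson trans_le_add2)
    qed
    show "{indet x * indet y |x y. {x, y} \<in> E} \<subseteq> {p \<in> Pol V. \<forall>m\<in>Poly_Mapping.keys p. ?Q m}"
    proof
      fix p assume p: "p \<in> {indet x * indet y |x y. {x, y} \<in> E}"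
      then obtain x y where xy: "p = indet x * indet y" "{x, y} \<in> E" by blast
      then have "x \<noteq> y" using E(2)[of "{x, y}"] by auto
      then have "p = monomial (squarefree_of {x, y})" using xy indet_mult_indet by simp
      then have "\<forall>m\<in>Poly_Mapping.keys p. ?Q m" using xy(2) by (auto simp: monomial_def)
      with p edge_generators_in_Pol show "p \<in> {p \<in> Pol V. \<forall>m\<in>Poly_Mapping.keys p. ?Q m}" by blast
    qed
  qed
  with assms show ?thesis by blast
qed

text \<open>Exponents are added instead of uniting supports: a vertex common to both edges then has
  exponent at least 2, which a square-free monomial excludes.\<close>

lemma edge_ideal_square_supports:
  assumes "p \<in> edge_ideal V E \<cdot>\<^bsub>poly_ring V\<^esub> edge_ideal V E"
  shows "p \<in> Pol V \<and> (\<forall>m\<in>Poly_Mapping.keys p. \<exists>e\<in>E. \<exists>e'\<in>E. \<forall>x.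
    Poly_Mapping.lookup (squarefree_of e) x + Poly_Mapping.lookup (squarefree_of e') x \<le> Poly_Mapping.lookup m x)"
  using assms
proof (induction rule: ideal_prod.induct)
  case (prod p q)
  note p = edge_ideal_supports[OF prod(1)] and q = edge_ideal_supports[OF prod(2)]
  have "\<exists>e\<in>E. \<exists>e'\<in>E. \<forall>x.
    Poly_Mapping.lookup (squarefree_of e) x + Poly_Mapping.lookup (squarefree_of e') x \<le> Poly_Mapping.lookup m x"
    if m: "m \<in> Poly_Mapping.keys (p * q)" for m
  proof -
    obtain a b where ab: "m = a + b" "a \<in> Poly_Mapping.keys p" "b \<in> Poly_Mapping.keys q"
      using keys_mult[of p q] m by blast
    obtain e e' where "e \<in> E" "\<forall>x. Poly_Mapping.lookup (squarefree_of e) x \<le> Poly_Mapping.lookup a x"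
      "e' \<in> E" "\<forall>x. Poly_Mapping.lookup (squarefree_of e') x \<le> Poly_Mapping.lookup b x"
      using p q ab(2,3) by blast
    then show ?thesis by (intro bexI[of _ e] bexI[of _ e']) (auto simp: ab(1) lookup_add intro: add_mono)
  qed
  then show ?case using p q Pol.mult_mem[of p V q] by (simp add: poly_ring_ops)
next
  case (sum p q)
  then show ?case using keys_add[of p q] Pol.add_mem[of p V q] unfolding poly_ring_ops by blast
qed

theorem squarefree_square_edge_ideal:
  "squarefree_square V (edge_ideal V E :: (('v \<Rightarrow>\<^sub>0 nat) \<Rightarrow>\<^sub>0 'k::field) set) = nonface_ideal V (matching_complex V E)"
proof
  let ?I = "edge_ideal V E :: (('v \<Rightarrow>\<^sub>0 nat) \<Rightarrow>\<^sub>0 'k) set"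
  let ?gen = "{monomial m |m. squarefree_exp m \<and> monomial m \<in> ?I \<cdot>\<^bsub>poly_ring V\<^esub> ?I}
    :: (('v \<Rightarrow>\<^sub>0 nat) \<Rightarrow>\<^sub>0 'k) set"
  note N = ideal_in_nonface_ideal[OF down_closed_matching_complex, of V V E]
  have gen_Pol: "?gen \<subseteq> Pol V" using edge_ideal_square_supports by blast
  show "squarefree_square V ?I \<subseteq> nonface_ideal V (matching_complex V E)"
    unfolding squarefree_square_def
  proof (subst genideal_subset_iff[OF N gen_Pol], rule subsetI)
    fix p assume "p \<in> ?gen"
    then obtain m where m: "p = monomial m" "squarefree_exp m" "monomial m \<in> ?I \<cdot>\<^bsub>poly_ring V\<^esub> ?I" by blast
    note supports = edge_ideal_square_supports[OF m(3)]
    have keys_p: "Poly_Mapping.keys (monomial m :: ('v \<Rightarrow>\<^sub>0 nat) \<Rightarrow>\<^sub>0 'k) = {m}" by (simp add: monomial_def)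
    obtain e e' where e: "e \<in> E" "e' \<in> E"
      "\<And>x. Poly_Mapping.lookup (squarefree_of e) x + Poly_Mapping.lookup (squarefree_of e') x \<le> Poly_Mapping.lookup m x"
      using conjunct2[OF supports] unfolding keys_p by blast
    note le = e(3)[unfolded lookup_squarefree_of[OF finite_edge[OF e(1)]] lookup_squarefree_of[OF finite_edge[OF e(2)]]]
    have "e \<inter> e' = {}"
    proof (rule ccontr)
      assume "e \<inter> e' \<noteq> {}"
      then obtain x where "x \<in> e" "x \<in> e'" by blast
      then have "2 \<le> Poly_Mapping.lookup m x" using le[of x] by simp
      moreover have "Poly_Mapping.lookup m x \<le> 1" using m(2) by (simp add: squarefree_exp_def)
      ultimately show False by simp
    qed
    moreover have "e \<union> e' \<subseteq> Poly_Mapping.keys m"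
    proof
      fix x assume "x \<in> e \<union> e'"
      then have "1 \<le> Poly_Mapping.lookup m x" using le[of x] by (auto split: if_splits)
      then show "x \<in> Poly_Mapping.keys m" by (simp add: in_keys_iff)
    qed
    ultimately have "Poly_Mapping.keys m \<notin> matching_complex V E"
      using e(1,2) unfolding matching_complex_def by blast
    then show "p \<in> nonface_ideal V (matching_complex V E)"
      using conjunct1[OF supports] by (simp add: m(1) nonface_ideal_def keys_p)
  qed
  show "nonface_ideal V (matching_complex V E) \<subseteq> squarefree_square V ?I"
  proof (rule nonface_ideal_subset)
    show sq: "Pol.ideal_in V (squarefree_square V ?I)"
      unfolding squarefree_square_def by (rule ideal_in_genideal[OF gen_Pol])
    fix m :: "'v \<Rightarrow>\<^sub>0 nat" and c :: 'k
    assume m: "Poly_Mapping.keys m \<subseteq> V" "Poly_Mapping.keys m \<notin> matching_complex V E"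
    then obtain e e' where e: "e \<in> E" "e' \<in> E" "e \<inter> e' = {}" "e \<union> e' \<subseteq> Poly_Mapping.keys m"
      unfolding matching_complex_def by blast
    note fin = finite_edge[OF e(1)] finite_edge[OF e(2)]
    let ?u = "squarefree_of (e \<union> e')"
    have u: "?u = squarefree_of e + squarefree_of e'"
      unfolding squarefree_of_def by (rule sum.union_disjoint[OF fin e(3)])
    have "monomial ?u = (monomial (squarefree_of e) * monomial (squarefree_of e') :: ('v \<Rightarrow>\<^sub>0 nat) \<Rightarrow>\<^sub>0 'k)"
      by (simp add: monomial_def u mult_single)
    also have "\<dots> \<in> ?I \<cdot>\<^bsub>poly_ring V\<^esub> ?I"
      using ideal_prod.prod[where R = "poly_ring V", OF edge_monomial_in_edge_ideal[OF e(1)] edge_monomial_in_edge_ideal[OF e(2)]]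
      by (simp add: poly_ring_ops)
    finally have "monomial ?u \<in> ?gen"
      using fin by (auto simp: squarefree_exp_def lookup_squarefree_of)
    then have "monomial ?u \<in> squarefree_square V ?I"
      unfolding squarefree_square_def by (rule generator_in_genideal[OF gen_Pol])
    moreover have "?u + (m - ?u) = m"
      using fin e(4) by (intro add_diff_poly_mapping squarefree_of_le) auto
    then have "Poly_Mapping.single m c = Poly_Mapping.single (m - ?u) c * monomial ?u"
      by (simp add: monomial_def mult_single add.commute)
    moreover have "Poly_Mapping.keys (m - ?u) \<subseteq> V"
      using m(1) by (auto simp: in_keys_iff lookup_minus)
    then have "Poly_Mapping.single (m - ?u) c \<in> Pol V" by (rule single_in_Pol)
    ultimately show "Poly_Mapping.single m c \<in> squarefree_square V ?I"
      using Pol.ideal_inD(4)[OF sq] by simp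
  qed
qed

end


section \<open>Path and cycle complexes\<close>

definition independent_along :: "'v list \<Rightarrow> 'v set \<Rightarrow> bool" where
  "independent_along vs S \<longleftrightarrow> successively (\<lambda>x y. \<not> (x \<in> S \<and> y \<in> S)) vs"

text \<open>Vertices of \<open>W\<close> are cone points.\<close>

definition path_complex :: "'v set \<Rightarrow> 'v list \<Rightarrow> 'v set set" where
  "path_complex W vs = {S. S \<subseteq> W \<union> set vs \<and> independent_along vs S}"

text \<open>For a list of two vertices the closing edge is the edge of the path itself; this
  degenerate cycle occurs for \<open>n = 4\<close>.\<close>

definition cycle_complex :: "'v set \<Rightarrow> 'v list \<Rightarrow> 'v set set" where
  "cycle_complex W vs = {S \<in> path_complex W vs. \<not> (hd vs \<in> S \<and> last vs \<in> S)}"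

lemma independent_along_simps [simp]:
  "independent_along [] S"
  "independent_along [a] S"
  "independent_along (a # b # vs) S \<longleftrightarrow> \<not> (a \<in> S \<and> b \<in> S) \<and> independent_along (b # vs) S"
  by (simp_all add: independent_along_def)

lemma independent_along_append:
  "independent_along (vs @ ws) S \<longleftrightarrow> independent_along vs S \<and> independent_along ws S \<and>
     (vs = [] \<or> ws = [] \<or> \<not> (last vs \<in> S \<and> hd ws \<in> S))"
  by (auto simp: independent_along_def successively_append_iff)

lemma independent_along_Cons_notin:
  "a \<notin> S \<Longrightarrow> independent_along (a # vs) S \<longleftrightarrow> independent_along vs S"
  by (cases vs) simp_all

lemma independent_along_cong:
  "S \<inter> set vs = T \<inter> set vs \<Longrightarrow> independent_along vs S \<longleftrightarrow> independent_along vs T"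
proof (induction vs rule: induct_list012)
  case (3 a b vs)
  then have "a \<in> S \<longleftrightarrow> a \<in> T" "b \<in> S \<longleftrightarrow> b \<in> T" "S \<inter> set (b # vs) = T \<inter> set (b # vs)"
    by (auto simp: set_eq_iff)
  with 3 show ?case by simp
qed simp_all

lemma independent_along_insert: "v \<notin> set vs \<Longrightarrow> independent_along vs (insert v S) \<longleftrightarrow> independent_along vs S"
  by (rule independent_along_cong) auto

lemma independent_along_upt:
  "independent_along [a..<b] S \<longleftrightarrow> (\<forall>i. a \<le> i \<and> Suc i < b \<longrightarrow> \<not> (i \<in> S \<and> Suc i \<in> S))"
proof -
  have "independent_along [a..<b] S \<longleftrightarrow> (\<forall>i. Suc i < b - a \<longrightarrow> \<not> (a + i \<in> S \<and> Suc (a + i) \<in> S))"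
    by (auto simp: independent_along_def successively_conv_nth)
  also have "\<dots> \<longleftrightarrow> (\<forall>i. a \<le> i \<and> Suc i < b \<longrightarrow> \<not> (i \<in> S \<and> Suc i \<in> S))"
  proof (intro iffI allI impI)
    fix i assume *: "\<forall>i. Suc i < b - a \<longrightarrow> \<not> (a + i \<in> S \<and> Suc (a + i) \<in> S)" and i: "a \<le> i \<and> Suc i < b"
    then have "Suc (i - a) < b - a" by linarith
    with * have "\<not> (a + (i - a) \<in> S \<and> Suc (a + (i - a)) \<in> S)" by blast
    with i show "\<not> (i \<in> S \<and> Suc i \<in> S)" by simp
  qed auto
  finally show ?thesis .
qed

text \<open>The split is at the second vertex \<open>b\<close>. Its star has \<open>b\<close> free
  and a path shorter by three, which meets the bound exactly; deleting \<open>b\<close> leaves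
  \<open>a\<close> free and a path shorter by two. Splitting at \<open>a\<close> would lose one when
  the length is 1 modulo 3, since deleting \<open>a\<close> frees no vertex.\<close>

lemma splits_path_complex:
  assumes "finite W" "distinct vs" "W \<inter> set vs = {}" "W \<union> set vs \<subseteq> V"
    and "d \<le> card W + (length vs + 2) div 3"
  shows "splits V d (path_complex W vs)"
  using assms
proof (induction "length vs" arbitrary: W vs rule: less_induct)
  case less
  consider "vs = []" | a where "vs = [a]" | a b r where "vs = a # b # r"
    by (metis list.exhaust)
  then show ?case
  proof cases
    case 1
    then have "path_complex W vs = Pow W" by (auto simp: path_complex_def)
    then show ?thesis using less.prems 1 by (auto intro: splits_simplex)
  next
    case 2
    then have "path_complex W vs = Pow (insert a W)" by (auto simp: path_complex_def)
    then show ?thesis using less.prems 2 by (auto intro!: splits_simplex)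
  next
    case 3
    have b: "b \<notin> W" "b \<notin> set r" "a \<notin> W" "a \<noteq> b" "a \<notin> set r" using less.prems 3 by auto
    \<comment> \<open>Both neighbours of \<open>b\<close> leave. As \<open>tl [] = []\<close>, this
      also covers the case that \<open>b\<close> is the last vertex.\<close>
    have "{S. S \<union> {b} \<in> path_complex W vs} = path_complex (insert b W) (tl r)"
    proof (cases r)
      case Nil
      then show ?thesis using b by (auto simp: path_complex_def 3)
    next
      case (Cons c r')
      then have c: "c \<noteq> b" "b \<notin> set r'" "c \<notin> W" "c \<notin> set r'" "a \<notin> set r'"
        using b less.prems 3 by auto
      have "S \<union> {b} \<in> path_complex W vs \<longleftrightarrow> S \<in> path_complex (insert b W) r'" for S
      proof -
        have "S \<union> {b} \<in> path_complex W vs \<longleftrightarrow>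
            S \<subseteq> insert b (W \<union> {a, c} \<union> set r') \<and> a \<notin> S \<and> c \<notin> S \<and> independent_along (c # r') (insert b S)"
          using b c by (auto simp: path_complex_def 3 Cons)
        also have "\<dots> \<longleftrightarrow> S \<subseteq> insert b W \<union> set r' \<and> independent_along r' (insert b S)"
          using b c independent_along_Cons_notin[of c "insert b S" r'] by auto
        finally show ?thesis
          using c by (simp add: path_complex_def independent_along_insert)
      qed
      then show ?thesis by (auto simp: Cons)
    qed
    moreover have "splits V d (path_complex (insert b W) (tl r))"
    proof (rule less.hyps)
      show "length (tl r) < length vs" "distinct (tl r)" using less.prems(2) by (auto simp: 3 distinct_tl)
      show "finite (insert b W)" using less.prems by simp
      show "insert b W \<inter> set (tl r) = {}" "insert b W \<union> set (tl r) \<subseteq> V"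
        using less.prems b list.set_sel(2)[of r] by (cases r; auto simp: 3)+
      show "d \<le> card (insert b W) + (length (tl r) + 2) div 3"
        using less.prems(1,5) b by (simp add: 3)
    qed
    moreover have "{S \<in> path_complex W vs. \<not> {b} \<subseteq> S} = path_complex (insert a W) r"
    proof (rule Set.set_eqI)
      show "S \<in> {S \<in> path_complex W vs. \<not> {b} \<subseteq> S} \<longleftrightarrow> S \<in> path_complex (insert a W) r" for S
        using b by (cases "b \<in> S") (auto simp: path_complex_def 3 independent_along_Cons_notin)
    qed
    moreover have "splits V d (path_complex (insert a W) r)"
      using less.prems b by (intro less.hyps) (auto simp: 3)
    ultimately show ?thesis
      using less.prems(4) by - (rule splits_step[of "{b}"], simp_all add: 3)
  qed
qed

text \<open>One vertex \<open>a\<close> opens the cycle. Deleting it leaves a path with one vertex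
  fewer, which gives exactly the bound; its star has \<open>a\<close> free and loses both
  neighbours.\<close>

lemma splits_cycle_complex:
  assumes "finite W" "distinct vs" "W \<inter> set vs = {}" "W \<union> set vs \<subseteq> V" "length vs \<ge> 2"
    and "d \<le> card W + (length vs + 1) div 3"
  shows "splits V d (cycle_complex W vs)"
proof -
  obtain a r where vs: "vs = a # r" using assms(5) by (cases vs) auto
  have r: "r \<noteq> []" using assms(5) by (auto simp: vs)
  have a: "a \<notin> W" "a \<notin> set r" using assms vs by auto
  have "S \<union> {a} \<in> cycle_complex W vs \<longleftrightarrow> S \<in> path_complex (insert a W) (butlast (tl r))" for S
  proof (cases "tl r = []")
    case True
    then obtain c where "r = [c]" using r by (cases r) auto
    then show ?thesis using a assms by (auto simp: cycle_complex_def path_complex_def vs)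
  next
    case False
    then obtain c m e where r: "r = c # m @ [e]" by (cases r; cases "tl r" rule: rev_cases) auto
    have d: "c \<noteq> a" "e \<noteq> a" "a \<notin> set m" "c \<noteq> e" "c \<notin> set m" "e \<notin> set m" "c \<notin> W" "e \<notin> W"
      using assms by (auto simp: vs r)
    have "S \<union> {a} \<in> cycle_complex W vs \<longleftrightarrow> S \<subseteq> insert a (W \<union> {c, e} \<union> set m) \<and> c \<notin> S \<and> e \<notin> S \<and>
        independent_along (c # m @ [e]) (insert a S)"
      using d by (auto simp: cycle_complex_def path_complex_def vs r)
    also have "\<dots> \<longleftrightarrow> S \<subseteq> insert a W \<union> set m \<and> independent_along m (insert a S)"
      using d independent_along_Cons_notin[of c "insert a S" "m @ [e]"] by (auto simp: independent_along_append)
    finally show ?thesis using d by (simp add: path_complex_def r independent_along_insert)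
  qed
  then have "{S. S \<union> {a} \<in> cycle_complex W vs} = path_complex (insert a W) (butlast (tl r))" by auto
  moreover have "splits V d (path_complex (insert a W) (butlast (tl r)))"
  proof (rule splits_path_complex)
    have sub: "set (butlast (tl r)) \<subseteq> set r" by (cases r) (auto dest: in_set_butlastD)
    show "insert a W \<inter> set (butlast (tl r)) = {}" "insert a W \<union> set (butlast (tl r)) \<subseteq> V"
      using assms sub a by (auto simp: vs)
    show "distinct (butlast (tl r))" using assms(2) by (simp add: vs distinct_tl distinct_butlast)
    show "d \<le> card (insert a W) + (length (butlast (tl r)) + 2) div 3"
      using assms(1,5,6) a by (simp add: vs)
  qed (use assms in simp)
  moreover have "{S \<in> cycle_complex W vs. \<not> {a} \<subseteq> S} = path_complex W r"
  proof (rule Set.set_eqI)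
    show "S \<in> {S \<in> cycle_complex W vs. \<not> {a} \<subseteq> S} \<longleftrightarrow> S \<in> path_complex W r" for S
      using a by (cases "a \<in> S") (auto simp: cycle_complex_def path_complex_def vs independent_along_Cons_notin)
  qed
  moreover have "splits V d (path_complex W r)"
    using assms by (intro splits_path_complex) (auto simp: vs)
  ultimately show ?thesis
    using assms(4) by - (rule splits_step[of "{a}"], simp_all add: vs)
qed


section \<open>The matching complex of a cycle\<close>

definition cycle_edge :: "nat \<Rightarrow> nat \<Rightarrow> nat set" where
  "cycle_edge n i = {i, if i = n then 1 else Suc i}"

abbreviation cycle_matching_complex :: "nat \<Rightarrow> nat set set" where
  "cycle_matching_complex n \<equiv> matching_complex (cycle_vertices n) (cycle_edges n)"

lemma cycle_edges_eq: "n \<ge> 1 \<Longrightarrow> cycle_edges n = cycle_edge n ` {1..n}"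
  unfolding cycle_edges_def cycle_edge_def
proof (intro equalityI subsetI)
  fix e assume n: "n \<ge> 1" and "e \<in> {{i, i + 1} |i. 1 \<le> i \<and> i \<le> n - 1} \<union> {{1, n}}"
  then consider i where "1 \<le> i" "i < n" "e = {i, Suc i}" | "e = {1, n}" by fastforce
  then show "e \<in> (\<lambda>i. {i, if i = n then 1 else Suc i}) ` {1..n}"
  proof cases
    case 1
    then show ?thesis by (intro image_eqI[of _ _ i]) auto
  next
    case 2
    then show ?thesis using n by (intro image_eqI[of _ _ n]) auto
  qed
next
  fix e assume "e \<in> (\<lambda>i. {i, if i = n then 1 else Suc i}) ` {1..n}"
  then obtain i where i: "1 \<le> i" "i \<le> n" "e = {i, if i = n then 1 else Suc i}" by auto
  show "e \<in> {{i, i + 1} |i. 1 \<le> i \<and> i \<le> n - 1} \<union> {{1, n}}"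
  proof (cases "i = n")
    case False
    with i have "e = {i, i + 1}" "1 \<le> i" "i \<le> n - 1" by auto
    then show ?thesis by blast
  qed (use i in auto)
qed

lemma cycle_edges_wf:
  assumes "n \<ge> 2" "e \<in> cycle_edges n"
  shows "e \<subseteq> cycle_vertices n" "card e = 2"
  using assms by (auto simp: cycle_edges_def cycle_vertices_def)

lemma mem_cycle_matching_complex:
  assumes "n \<ge> 1"
  shows "S \<in> cycle_matching_complex n \<longleftrightarrow> S \<subseteq> {1..n} \<and>
    (\<forall>i\<in>{1..n}. \<forall>k\<in>{1..n}. cycle_edge n i \<subseteq> S \<longrightarrow> cycle_edge n k \<subseteq> S \<longrightarrow> cycle_edge n i \<inter> cycle_edge n k \<noteq> {})"
  using assms by (auto simp: matching_complex_def cycle_edges_eq cycle_vertices_def)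

text \<open>Pairwise meeting edges of a cycle on at least four vertices have a common vertex, so
  there this criterion loses nothing. If \<open>S\<close> contains no edge, any \<open>x\<close>
  will do.\<close>

lemma cycle_matching_complexI:
  assumes "S \<subseteq> {1..n}" "\<And>i. i \<in> {1..n} \<Longrightarrow> cycle_edge n i \<subseteq> S \<Longrightarrow> x \<in> cycle_edge n i"
  shows "S \<in> cycle_matching_complex n"
proof (cases "n \<ge> 1")
  case True
  show ?thesis unfolding mem_cycle_matching_complex[OF True] using assms by blast
next
  case False
  then show ?thesis using assms
    by (auto simp: matching_complex_def cycle_edges_def cycle_vertices_def)
qed

lemma cycle_matching_complexD:
  assumes "S \<in> cycle_matching_complex n" "i \<in> {1..n}" "k \<in> {1..n}" "cycle_edge n i \<subseteq> S" "cycle_edge n k \<subseteq> S"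
  shows "cycle_edge n i \<inter> cycle_edge n k \<noteq> {}"
  using assms mem_cycle_matching_complex[of n S] by auto


subsection \<open>The lower bound\<close>

definition cut_complex :: "nat \<Rightarrow> nat \<Rightarrow> nat set set" where
  "cut_complex n j = {S \<in> cycle_matching_complex n. \<forall>i\<in>{1..j}. \<not> {i, Suc i} \<subseteq> S}"

text \<open>All edges of such a face must meet \<open>{j + 1, j + 2}\<close>. The edge
  \<open>{j, j + 1}\<close> is already cut, so \<open>j\<close> is out, while
  \<open>{j + 2, j + 3}\<close> is allowed. The edges among the other \<open>n - 3\<close> vertices
  are forbidden; they form the path from \<open>j + 3\<close> through \<open>n\<close> and 1 to
  \<open>j - 1\<close>, which ends at \<open>n\<close> if \<open>j = 1\<close>.\<close>

lemma link_cut_complex: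
  assumes j: "1 \<le> j" "j + 4 \<le> n"
  shows "{S. S \<union> {Suc j, Suc (Suc j)} \<in> cut_complex n j} =
    path_complex {Suc j, Suc (Suc j)} ([j + 3..<Suc n] @ [1..<j])"
proof (rule Set.set_eqI, unfold mem_Collect_eq)
  fix S
  let ?U = "{Suc j, Suc (Suc j)}" and ?vs = "[j + 3..<Suc n] @ [1..<j]"
  let ?T = "S \<union> ?U"
  have eU: "cycle_edge n (Suc j) = ?U" using j by (simp add: cycle_edge_def)
  have indep: "independent_along ?vs S \<longleftrightarrow> (\<forall>i. j + 3 \<le> i \<and> i < n \<longrightarrow> \<not> (i \<in> S \<and> Suc i \<in> S)) \<and>
      (\<forall>i. 1 \<le> i \<and> Suc i < j \<longrightarrow> \<not> (i \<in> S \<and> Suc i \<in> S)) \<and> (j = 1 \<or> \<not> (n \<in> S \<and> 1 \<in> S))"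
  proof -
    have "[j + 3..<Suc n] \<noteq> []" "last [j + 3..<Suc n] = n" using j by auto
    moreover have "[1..<j] \<noteq> [] \<longrightarrow> hd [1..<j] = 1" "[1..<j] = [] \<longleftrightarrow> j = 1" using j by auto
    ultimately show ?thesis
      unfolding independent_along_append independent_along_upt by auto
  qed
  have path: "S \<in> path_complex ?U ?vs \<longleftrightarrow> S \<subseteq> {1..n} - {j} \<and> independent_along ?vs S"
    using j by (auto simp: path_complex_def subset_iff)
  show "?T \<in> cut_complex n j \<longleftrightarrow> S \<in> path_complex ?U ?vs"
  proof
    assume T: "?T \<in> cut_complex n j"
    then have T2: "?T \<in> cycle_matching_complex n" and cut: "\<forall>i\<in>{1..j}. \<not> {i, Suc i} \<subseteq> ?T"
      by (simp_all add: cut_complex_def)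
    have "S \<subseteq> {1..n}" using T2 mem_cycle_matching_complex[of n ?T] j by auto
    moreover have "j \<notin> S" using cut j by (auto dest: bspec[of _ _ j])
    moreover have meets: "cycle_edge n i \<inter> ?U \<noteq> {}" if "i \<in> {1..n}" "cycle_edge n i \<subseteq> S" for i
      using cycle_matching_complexD[OF T2 that(1), of "Suc j"] that(2) j unfolding eU by auto
    have "\<not> (i \<in> S \<and> Suc i \<in> S)" if "1 \<le> i" "i < n" "i > Suc (Suc j) \<or> Suc i < j" for i
      using meets[of i] that by (auto simp: cycle_edge_def)
    moreover have "\<not> (n \<in> S \<and> 1 \<in> S)"
      using meets[of n] j by (auto simp: cycle_edge_def)
    ultimately show "S \<in> path_complex ?U ?vs" using j unfolding path indep by auto
  next
    assume "S \<in> path_complex ?U ?vs"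
    then have S: "S \<subseteq> {1..n} - {j}"
      and 1: "\<And>i. j + 3 \<le> i \<Longrightarrow> i < n \<Longrightarrow> \<not> (i \<in> S \<and> Suc i \<in> S)"
      and 2: "\<And>i. 1 \<le> i \<Longrightarrow> Suc i < j \<Longrightarrow> \<not> (i \<in> S \<and> Suc i \<in> S)"
      and 3: "j = 1 \<or> \<not> (n \<in> S \<and> 1 \<in> S)"
      unfolding path indep by auto
    have edge: "i = Suc j \<or> i = Suc (Suc j)" if i: "i \<in> {1..n}" "cycle_edge n i \<subseteq> ?T" for i
    proof (rule ccontr)
      assume neq: "\<not> (i = Suc j \<or> i = Suc (Suc j))"
      have mem: "i \<in> ?T" "(if i = n then 1 else Suc i) \<in> ?T" using i(2) by (auto simp: cycle_edge_def)
      consider "i = j" | "Suc i = j" | "Suc i < j" | "j + 3 \<le> i" "i < n" | "i = n" using neq i(1) by force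
      then show False
      proof cases
        case 5
        then show ?thesis using mem 3 S j by auto
      qed (use mem neq S 1[of i] 2[of i] i j in auto)
    qed
    have "?T \<in> cycle_matching_complex n"
    proof (rule cycle_matching_complexI[where x = "Suc (Suc j)"])
      show "?T \<subseteq> {1..n}" using S j by auto
      show "Suc (Suc j) \<in> cycle_edge n i" if "i \<in> {1..n}" "cycle_edge n i \<subseteq> ?T" for i
        using edge[OF that] j by (auto simp: cycle_edge_def)
    qed
    moreover have "\<not> {i, Suc i} \<subseteq> ?T" if "i \<in> {1..j}" for i
    proof
      assume "{i, Suc i} \<subseteq> ?T"
      moreover have "cycle_edge n i = {i, Suc i}" using that j by (simp add: cycle_edge_def)
      ultimately show False using edge[of i] that j by auto
    qed
    ultimately show "?T \<in> cut_complex n j" by (simp add: cut_complex_def)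
  qed
qed

text \<open>With nothing cut, both \<open>{2, 3}\<close> and \<open>{n, 1}\<close> meet
  \<open>{1, 2}\<close>, but they are disjoint. So 3 and \<open>n\<close> exclude each other, which
  closes the path from 3 to \<open>n\<close> into a cycle.\<close>

lemma link_cut_complex_0:
  assumes n: "4 \<le> n"
  shows "{S. S \<union> {1, 2} \<in> cut_complex n 0} = cycle_complex {1, 2} [3..<Suc n]"
proof (rule Set.set_eqI, unfold mem_Collect_eq)
  fix S :: "nat set"
  let ?T = "S \<union> {1, 2}"
  have e: "cycle_edge n 1 = {1, 2}" "cycle_edge n 2 = {2, 3}" "cycle_edge n n = {n, 1}"
    using n by (auto simp: cycle_edge_def)
  have "hd [3..<Suc n] = 3" "last [3..<Suc n] = n" using n by auto
  then have cyc: "S \<in> cycle_complex {1, 2} [3..<Suc n] \<longleftrightarrow> S \<subseteq> {1..n} \<and>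
      (\<forall>i. 3 \<le> i \<and> i < n \<longrightarrow> \<not> (i \<in> S \<and> Suc i \<in> S)) \<and> \<not> (3 \<in> S \<and> n \<in> S)"
    unfolding cycle_complex_def path_complex_def mem_Collect_eq independent_along_upt
    using n by (auto simp: subset_iff)
  show "?T \<in> cut_complex n 0 \<longleftrightarrow> S \<in> cycle_complex {1, 2} [3..<Suc n]"
  proof
    assume "?T \<in> cut_complex n 0"
    then have T2: "?T \<in> cycle_matching_complex n" by (simp add: cut_complex_def)
    have "S \<subseteq> {1..n}" using T2 mem_cycle_matching_complex[of n ?T] n by auto
    moreover have "\<not> (i \<in> S \<and> Suc i \<in> S)" if "3 \<le> i" "i < n" for i
      using cycle_matching_complexD[OF T2, of i 1] that n unfolding e by (auto simp: cycle_edge_def)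
    moreover have "\<not> (3 \<in> S \<and> n \<in> S)"
      using cycle_matching_complexD[OF T2, of 2 n] n unfolding e by auto
    ultimately show "S \<in> cycle_complex {1, 2} [3..<Suc n]" unfolding cyc by blast
  next
    assume "S \<in> cycle_complex {1, 2} [3..<Suc n]"
    then have S: "S \<subseteq> {1..n}" and 1: "\<And>i. 3 \<le> i \<Longrightarrow> i < n \<Longrightarrow> \<not> (i \<in> S \<and> Suc i \<in> S)"
      and 2: "\<not> (3 \<in> S \<and> n \<in> S)"
      unfolding cyc by auto
    have edge: "i = 1 \<or> i = 2 \<or> i = n" if i: "i \<in> {1..n}" "cycle_edge n i \<subseteq> ?T" for i
      using 1[of i] i by (cases "3 \<le> i \<and> i < n") (auto simp: cycle_edge_def)
    have T: "?T \<subseteq> {1..n}" using S n by auto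
    have "?T \<in> cycle_matching_complex n"
    \<comment> \<open>If 3 is present, \<open>n\<close> is not, and all edges inside share the
      vertex 2; otherwise they share 1.\<close>
    proof (cases "3 \<in> S")
      case True
      with 2 n have "\<not> cycle_edge n n \<subseteq> ?T" by (auto simp: e)
      with edge have cases: "i = 1 \<or> i = 2" if "i \<in> {1..n}" "cycle_edge n i \<subseteq> ?T" for i using that by blast
      have "2 \<in> cycle_edge n i" if "i \<in> {1..n}" "cycle_edge n i \<subseteq> ?T" for i
        using cases[OF that] by (elim disjE) (simp_all only: e insert_iff simp_thms)
      with T show ?thesis by (rule cycle_matching_complexI)
    next
      case False
      with n have "\<not> cycle_edge n 2 \<subseteq> ?T" by (auto simp: e)
      with edge have cases: "i = 1 \<or> i = n" if "i \<in> {1..n}" "cycle_edge n i \<subseteq> ?T" for i using that by blast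
      have "1 \<in> cycle_edge n i" if "i \<in> {1..n}" "cycle_edge n i \<subseteq> ?T" for i
        using cases[OF that] by (elim disjE) (simp_all only: e insert_iff simp_thms)
      with T show ?thesis by (rule cycle_matching_complexI)
    qed
    then show "?T \<in> cut_complex n 0" by (simp add: cut_complex_def)
  qed
qed

lemma delete_cut_complex:
  "{S \<in> cut_complex n j. \<not> {Suc j, Suc (Suc j)} \<subseteq> S} = cut_complex n (Suc j)"
  by (auto simp: cut_complex_def atLeastAtMostSuc_conv)

text \<open>Only the edges \<open>{n - 2, n - 1}\<close>, \<open>{n - 1, n}\<close> and
  \<open>{n, 1}\<close> are still possible, and the first and last are the only disjoint pair among
  them.\<close>

lemma mem_last_cut_complex:
  assumes n: "4 \<le> n"
  shows "S \<in> cut_complex n (n - 3) \<longleftrightarrow> S \<subseteq> {1..n} \<and>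
    (\<forall>i. 1 \<le> i \<and> i \<le> n - 3 \<longrightarrow> \<not> (i \<in> S \<and> Suc i \<in> S)) \<and> \<not> {1, n - 2, n - 1, n} \<subseteq> S"
proof
  have e: "cycle_edge n (n - 2) = {n - 2, n - 1}" "cycle_edge n (n - 1) = {n - 1, n}" "cycle_edge n n = {n, 1}"
    using n by (auto simp: cycle_edge_def)
  show "S \<subseteq> {1..n} \<and> (\<forall>i. 1 \<le> i \<and> i \<le> n - 3 \<longrightarrow> \<not> (i \<in> S \<and> Suc i \<in> S)) \<and> \<not> {1, n - 2, n - 1, n} \<subseteq> S"
    if "S \<in> cut_complex n (n - 3)"
  proof -
    have S: "S \<in> cycle_matching_complex n" using that by (simp add: cut_complex_def)
    have "\<not> {1, n - 2, n - 1, n} \<subseteq> S"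
    proof
      assume "{1, n - 2, n - 1, n} \<subseteq> S"
      moreover have "n - 2 \<in> {1..n}" "n \<in> {1..n}" using n by auto
      ultimately have "cycle_edge n (n - 2) \<inter> cycle_edge n n \<noteq> {}"
        by (intro cycle_matching_complexD[OF S]) (auto simp: e)
      then show False using n by (auto simp: e)
    qed
    moreover have "S \<subseteq> {1..n}" using S mem_cycle_matching_complex[of n S] n by auto
    ultimately show ?thesis using that by (auto simp: cut_complex_def)
  qed
  assume "S \<subseteq> {1..n} \<and> (\<forall>i. 1 \<le> i \<and> i \<le> n - 3 \<longrightarrow> \<not> (i \<in> S \<and> Suc i \<in> S)) \<and> \<not> {1, n - 2, n - 1, n} \<subseteq> S"
  then have S: "S \<subseteq> {1..n}" and cut: "\<And>i. 1 \<le> i \<Longrightarrow> i \<le> n - 3 \<Longrightarrow> \<not> (i \<in> S \<and> Suc i \<in> S)"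
    and last: "\<not> {1, n - 2, n - 1, n} \<subseteq> S" by auto
  have edge: "i = n - 2 \<or> i = n - 1 \<or> i = n" if i: "i \<in> {1..n}" "cycle_edge n i \<subseteq> S" for i
    using cut[of i] i by (cases "i \<le> n - 3") (auto simp: cycle_edge_def split: if_splits)
  have "S \<in> cycle_matching_complex n"
  proof (cases "cycle_edge n n \<subseteq> S")
    case True
    with last have "\<not> cycle_edge n (n - 2) \<subseteq> S" unfolding e by blast
    with edge have cases: "i = n - 1 \<or> i = n" if "i \<in> {1..n}" "cycle_edge n i \<subseteq> S" for i using that by blast
    have "n \<in> cycle_edge n i" if "i \<in> {1..n}" "cycle_edge n i \<subseteq> S" for i
      using cases[OF that] by (elim disjE) (simp_all only: e insert_iff simp_thms)
    with S show ?thesis by (rule cycle_matching_complexI)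
  next
    case False
    with edge have cases: "i = n - 2 \<or> i = n - 1" if "i \<in> {1..n}" "cycle_edge n i \<subseteq> S" for i using that by blast
    have "n - 1 \<in> cycle_edge n i" if "i \<in> {1..n}" "cycle_edge n i \<subseteq> S" for i
      using cases[OF that] by (elim disjE) (simp_all only: e insert_iff simp_thms)
    with S show ?thesis by (rule cycle_matching_complexI)
  qed
  with cut show "S \<in> cut_complex n (n - 3)" by (simp add: cut_complex_def)
qed

text \<open>In faces without both 1 and \<open>n - 2\<close> the four-vertex condition is automatic;
  the excluded pair acts as an edge that closes the path 1, ..., \<open>n - 2\<close>, while
  \<open>n - 1\<close> and \<open>n\<close> are free. With both present, 2 and \<open>n - 3\<close>
  drop out and \<open>n - 1\<close>, \<open>n\<close> exclude each other, so a further split at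
  \<open>n\<close> leaves two paths.\<close>

lemma splits_last_cut_complex:
  assumes n: "4 \<le> n" and d: "d \<le> (n + 2) div 3 + 1"
  shows "splits {1..n} d (cut_complex n (n - 3))"
proof -
  let ?D = "cut_complex n (n - 3)" and ?U = "{1, n - 2}"
  have ends: "hd [1..<n - 1] = 1" "last [1..<n - 1] = n - 2" using n by auto
  have "{S \<in> ?D. \<not> ?U \<subseteq> S} = cycle_complex {n - 1, n} [1..<n - 1]"
  proof (rule Set.set_eqI)
    fix S
    have sub: "S \<subseteq> {n - 1, n} \<union> set [1..<n - 1] \<longleftrightarrow> S \<subseteq> {1..n}" using n by (auto simp: subset_iff)
    have "(\<forall>i. 1 \<le> i \<and> Suc i < n - 1 \<longrightarrow> \<not> (i \<in> S \<and> Suc i \<in> S))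
        \<longleftrightarrow> (\<forall>i. 1 \<le> i \<and> i \<le> n - 3 \<longrightarrow> \<not> (i \<in> S \<and> Suc i \<in> S))"
    proof -
      have "Suc i < n - 1 \<longleftrightarrow> i \<le> n - 3" for i using n by arith
      then show ?thesis by simp
    qed
    then show "S \<in> {S \<in> ?D. \<not> ?U \<subseteq> S} \<longleftrightarrow> S \<in> cycle_complex {n - 1, n} [1..<n - 1]"
      unfolding cycle_complex_def path_complex_def mem_Collect_eq ends independent_along_upt
        mem_last_cut_complex[OF n] sub by blast
  qed
  moreover have "splits {1..n} d (cycle_complex {n - 1, n} [1..<n - 1])"
  proof (rule splits_cycle_complex)
    have "card {n - 1, n} = 2" using n by simp
    then show "d \<le> card {n - 1, n} + (length [1..<n - 1] + 1) div 3" using d n by simp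
  qed (use n in auto)
  moreover have "splits {1..n} d {S. S \<union> ?U \<in> ?D}"
  \<comment> \<open>For \<open>n = 4\<close> the vertices 1 and \<open>n - 2\<close> span an edge
    that is already cut, so no face contains both.\<close>
  proof (cases "n = 4")
    case True
    have "S \<union> ?U \<notin> ?D" for S
    proof
      assume "S \<union> ?U \<in> ?D"
      then have "\<forall>i. 1 \<le> i \<and> i \<le> n - 3 \<longrightarrow> \<not> (i \<in> S \<union> ?U \<and> Suc i \<in> S \<union> ?U)"
        unfolding mem_last_cut_complex[OF n] by blast
      from spec[OF this, of 1] show False using True by simp
    qed
    then have "{S. S \<union> ?U \<in> ?D} = {}" by blast
    then show ?thesis using splits_void[of "{1..n}" d] by simp
  next
    case False
    let ?K = "{S. S \<union> ?U \<in> ?D}" and ?vs = "[3..<n - 3]"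
    have K: "S \<union> ?U \<in> ?D \<longleftrightarrow> S \<subseteq> {1..n} \<and> 2 \<notin> S \<and> n - 3 \<notin> S \<and> \<not> {n - 1, n} \<subseteq> S \<and>
        (\<forall>i. 3 \<le> i \<and> Suc i < n - 3 \<longrightarrow> \<not> (i \<in> S \<and> Suc i \<in> S))" for S
    proof
      assume "S \<union> ?U \<in> ?D"
      then have "S \<union> ?U \<subseteq> {1..n}" and cut: "\<And>i. 1 \<le> i \<Longrightarrow> i \<le> n - 3 \<Longrightarrow> \<not> (i \<in> S \<union> ?U \<and> Suc i \<in> S \<union> ?U)"
        and last: "\<not> {1, n - 2, n - 1, n} \<subseteq> S \<union> ?U"
        unfolding mem_last_cut_complex[OF n] by blast+
      moreover have "2 \<notin> S" using cut[of 1] n by (simp add: numeral_2_eq_2)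
      moreover have "Suc (n - 3) = n - 2" using n by simp
      then have "n - 3 \<notin> S" using cut[of "n - 3"] n by simp
      moreover have "\<not> (i \<in> S \<and> Suc i \<in> S)" if "3 \<le> i" "Suc i < n - 3" for i
        using cut[of i] that by auto
      ultimately show "S \<subseteq> {1..n} \<and> 2 \<notin> S \<and> n - 3 \<notin> S \<and> \<not> {n - 1, n} \<subseteq> S \<and>
        (\<forall>i. 3 \<le> i \<and> Suc i < n - 3 \<longrightarrow> \<not> (i \<in> S \<and> Suc i \<in> S))" by blast
    next
      assume *: "S \<subseteq> {1..n} \<and> 2 \<notin> S \<and> n - 3 \<notin> S \<and> \<not> {n - 1, n} \<subseteq> S \<and>
        (\<forall>i. 3 \<le> i \<and> Suc i < n - 3 \<longrightarrow> \<not> (i \<in> S \<and> Suc i \<in> S))"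
      have "\<not> (i \<in> S \<union> ?U \<and> Suc i \<in> S \<union> ?U)" if i: "1 \<le> i" "i \<le> n - 3" for i
      proof
        assume mem: "i \<in> S \<union> ?U \<and> Suc i \<in> S \<union> ?U"
        consider "i = 1" | "i = 2" | "3 \<le> i" "Suc i < n - 3" | "3 \<le> i" "Suc i = n - 3" | "i = n - 3" using i by linarith
        then show False
        proof cases
          case 1
          then show ?thesis using mem * n False by (auto simp: numeral_2_eq_2)
        next
          case 2
          then show ?thesis using mem * n False by auto
        next
          case 3
          then show ?thesis using mem * n by auto
        next
          case 4
          then show ?thesis using mem * n by auto
        next
          case 5
          then show ?thesis using mem * n False by auto
        qed
      qed
      moreover have "\<not> {1, n - 2, n - 1, n} \<subseteq> S \<union> ?U"
      proof
        assume "{1, n - 2, n - 1, n} \<subseteq> S \<union> ?U"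
        then have "{n - 1, n} \<subseteq> S" using n by auto
        with * show False by blast
      qed
      moreover have "S \<union> ?U \<subseteq> {1..n}" using * n by auto
      ultimately show "S \<union> ?U \<in> ?D" unfolding mem_last_cut_complex[OF n] by blast
    qed
    \<comment> \<open>Of the vertices \<open>n - 1\<close> and \<open>n\<close>, \<open>m\<close> is
      the one that becomes free and \<open>m'\<close> the one that is removed.\<close>
    have path: "S \<in> path_complex {1, n - 2, m} ?vs \<longleftrightarrow> S \<subseteq> {1..n} - {2, n - 3, m'} \<and>
        (\<forall>i. 3 \<le> i \<and> Suc i < n - 3 \<longrightarrow> \<not> (i \<in> S \<and> Suc i \<in> S))"
      if m: "(m = n \<and> m' = n - 1) \<or> (m = n - 1 \<and> m' = n)" for S m m'
    proof -
      have "{1, n - 2, m} \<union> set ?vs = {1..n} - {2, n - 3, m'}"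
      proof (rule Set.set_eqI)
        show "x \<in> {1, n - 2, m} \<union> set ?vs \<longleftrightarrow> x \<in> {1..n} - {2, n - 3, m'}" for x
          using n False m
          unfolding Un_iff insert_iff empty_iff set_upt atLeastLessThan_iff Diff_iff atLeastAtMost_iff
          by presburger
      qed
      then show ?thesis unfolding path_complex_def mem_Collect_eq independent_along_upt by simp
    qed
    have splits: "splits {1..n} d (path_complex {1, n - 2, m} ?vs)" if m: "m = n \<or> m = n - 1" for m
    proof (rule splits_path_complex)
      have "n - 2 \<noteq> 1" "m \<noteq> 1" "m \<noteq> n - 2" using n False m by arith+
      then have "card {1, n - 2, m} = 3" by simp
      \<comment> \<open>Three free vertices and a path on \<open>n - 6\<close>; for
        \<open>n = 5\<close> the truncated difference is 0 and the path is empty.\<close>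
      moreover have "(n + 2) div 3 + 1 \<le> 3 + (n - 6 + 2) div 3" using n False by arith
      ultimately show "d \<le> card {1, n - 2, m} + (length ?vs + 2) div 3" using d by simp
    qed (use n m in auto)
    have "{S. S \<union> {n} \<in> ?K} = path_complex {1, n - 2, n} ?vs"
    proof (rule Set.set_eqI)
      fix S
      have "i \<noteq> n \<and> Suc i \<noteq> n" if "Suc i < n - 3" for i using that by auto
      then have "(\<forall>i. 3 \<le> i \<and> Suc i < n - 3 \<longrightarrow> \<not> (i \<in> S \<union> {n} \<and> Suc i \<in> S \<union> {n}))
          \<longleftrightarrow> (\<forall>i. 3 \<le> i \<and> Suc i < n - 3 \<longrightarrow> \<not> (i \<in> S \<and> Suc i \<in> S))" by blast
      moreover have "S \<union> {n} \<subseteq> {1..n} \<and> 2 \<notin> S \<union> {n} \<and> n - 3 \<notin> S \<union> {n} \<and> \<not> {n - 1, n} \<subseteq> S \<union> {n}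
          \<longleftrightarrow> S \<subseteq> {1..n} - {2, n - 3, n - 1}" using n by auto
      ultimately show "S \<in> {S. S \<union> {n} \<in> ?K} \<longleftrightarrow> S \<in> path_complex {1, n - 2, n} ?vs"
        unfolding mem_Collect_eq K using path[of n "n - 1" S] by blast
    qed
    moreover have "{S \<in> ?K. \<not> {n} \<subseteq> S} = path_complex {1, n - 2, n - 1} ?vs"
    proof (rule Set.set_eqI)
      show "S \<in> {S \<in> ?K. \<not> {n} \<subseteq> S} \<longleftrightarrow> S \<in> path_complex {1, n - 2, n - 1} ?vs" for S
        unfolding mem_Collect_eq K using path[of "n - 1" n S] by blast
    qed
    ultimately have "splits {1..n} d {S. S \<union> {n} \<in> ?K}" "splits {1..n} d {S \<in> ?K. \<not> {n} \<subseteq> S}"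
      using splits by simp_all
    then show ?thesis using n by (intro splits_step[of "{n}" _ _ ?K]) simp_all
  qed
  moreover have "?U \<subseteq> {1..n}" using n by auto
  ultimately show ?thesis using splits_step[of ?U "{1..n}" d ?D] by simp
qed

lemma splits_cycle_matching_complex:
  assumes n: "4 \<le> n" and d: "d \<le> (n + 2) div 3 + 1"
  shows "splits {1..n} d (cycle_matching_complex n)"
proof -
  have "splits {1..n} d (cut_complex n j)" if "j \<le> n - 3" for j
    using that
  proof (induction rule: inc_induct)
    case base
    show ?case by (rule splits_last_cut_complex[OF n d])
  next
    case (step j)
    let ?U = "{Suc j, Suc (Suc j)}"
    \<comment> \<open>The path on \<open>n - 3\<close> vertices contributes
      \<open>(n - 3 + 2) div 3\<close>, the cycle on \<open>n - 2\<close> vertices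
      \<open>(n - 2 + 1) div 3\<close>. Both are the same number, and with two free vertices they
      leave no slack.\<close>
    have d': "d \<le> 2 + (n - 3 + 2) div 3" using d n by (auto elim: order_trans)
    have "splits {1..n} d {S. S \<union> ?U \<in> cut_complex n j}"
    proof (cases "j = 0")
      case True
      have "splits {1..n} d (cycle_complex {1, 2} [3..<Suc n])"
        using d' n by (intro splits_cycle_complex) auto
      then show ?thesis using link_cut_complex_0[OF n] True by (simp add: numeral_2_eq_2)
    next
      case False
      then have j: "1 \<le> j" "j + 4 \<le> n" using step.hyps by auto
      have "splits {1..n} d (path_complex ?U ([j + 3..<Suc n] @ [1..<j]))"
        using d' j by (intro splits_path_complex) auto
      then show ?thesis unfolding link_cut_complex[OF j] .
    qed
    moreover have "splits {1..n} d {S \<in> cut_complex n j. \<not> ?U \<subseteq> S}"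
      unfolding delete_cut_complex by (rule step.IH)
    moreover have "?U \<subseteq> {1..n}" using step.hyps by auto
    ultimately show ?case by (rule splits_step[rotated 1])
  qed
  from this[of 0] show ?thesis by (simp add: cut_complex_def)
qed


subsection \<open>The upper bound\<close>

text \<open>A smallest dominating set of the cycle: any vertex added to it creates an edge, and
  edges at different places are disjoint, which breaks up the link.\<close>

definition dominating_set :: "nat \<Rightarrow> nat set" where
  "dominating_set n = {i \<in> {1..n}. i mod 3 = 1}"

lemma card_dominating_set: "card (dominating_set n) = (n + 2) div 3"
proof -
  have "dominating_set n = (\<lambda>k. 3 * k + 1) ` {..<(n + 2) div 3}"
  proof (intro equalityI subsetI)
    fix i assume "i \<in> dominating_set n"
    then have i: "1 \<le> i" "i \<le> n" "i mod 3 = 1" by (auto simp: dominating_set_def)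
    define q where "q = i div 3"
    have q: "i = 3 * q + 1" using mult_div_mod_eq[of 3 i] i(3) by (simp add: q_def)
    moreover have "(i + 2) div 3 \<le> (n + 2) div 3" using i(2) by (intro div_le_mono) simp
    then have "q < (n + 2) div 3" by (simp add: q)
    ultimately show "i \<in> (\<lambda>k. 3 * k + 1) ` {..<(n + 2) div 3}" by blast
  next
    fix i assume "i \<in> (\<lambda>k. 3 * k + 1) ` {..<(n + 2) div 3}"
    then obtain k where k: "k < (n + 2) div 3" "i = 3 * k + 1" by auto
    then have "i \<le> n" using div_times_less_eq_dividend[of "n + 2" 3] by linarith
    with k show "i \<in> dominating_set n" by (simp add: dominating_set_def)
  qed
  then show ?thesis by (simp add: card_image inj_on_def)
qed

theorem depth_cycle_le:
  assumes n: "4 \<le> n"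
  shows "depth_quotient {1..n} (nonface_ideal {1..n} (cycle_matching_complex n) :: ((nat \<Rightarrow>\<^sub>0 nat) \<Rightarrow>\<^sub>0 'k::field) set)
    \<le> enat ((n + 2) div 3 + 1)"
proof -
  let ?F = "dominating_set n" and ?\<Delta> = "cycle_matching_complex n"
  \<comment> \<open>The vertex 2 creates the edge \<open>{1, 2}\<close>. If 3 divides
    \<open>n\<close>, then \<open>n\<close> is outside the set too and only creates
    \<open>{n, 1}\<close>, which meets \<open>{1, 2}\<close>; so it belongs to the same
    part.\<close>
  define P where "P = (if n mod 3 = 0 then {2, n} else {2})"
  \<comment> \<open>If \<open>n mod 3 = 1\<close>, the set already contains the edge
    \<open>{n, 1}\<close>, so the new edge must meet it. The vertex 3 would fail for
    \<open>n > 4\<close>, as \<open>{3, 4}\<close> is disjoint from it.\<close>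
  define b0 where "b0 = (if n mod 3 = 1 then n - 1 else 3)"
  have F: "i \<in> ?F \<longleftrightarrow> 1 \<le> i \<and> i \<le> n \<and> i mod 3 = 1" for i by (auto simp: dominating_set_def)
  have "depth_quotient {1..n} (nonface_ideal {1..n} ?\<Delta> :: ((nat \<Rightarrow>\<^sub>0 nat) \<Rightarrow>\<^sub>0 'k) set) \<le> enat (Suc (card ?F))"
  proof (rule depth_le_if_link_disconnected[of _ _ _ P 2 b0])
    show "down_closed ?\<Delta>" by (rule down_closed_matching_complex)
    show "?F \<subseteq> {1..n}" by (auto simp: dominating_set_def)
    show "P \<subseteq> {1..n} - ?F" using n by (auto simp: P_def F)
    show "2 \<in> P" by (simp add: P_def)
    show "b0 \<in> {1..n} - ?F - P"
    proof (cases "n mod 3 = 1")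
      case True
      then have "(n - 1) mod 3 = 0" by presburger
      with True n show ?thesis by (auto simp: b0_def P_def F)
    next
      case False
      have "n \<noteq> 3" using n by simp
      with False n show ?thesis by (auto simp: b0_def P_def F)
    qed
    show "insert 2 ?F \<in> ?\<Delta>"
    proof (rule cycle_matching_complexI[where x = 1])
      show "insert 2 ?F \<subseteq> {1..n}" using n by (auto simp: dominating_set_def)
      fix i assume i: "i \<in> {1..n}" "cycle_edge n i \<subseteq> insert 2 ?F"
      show "1 \<in> cycle_edge n i"
      proof (cases "i = n")
        case False
        with i(2) have "i \<in> insert 2 ?F" "Suc i \<in> insert 2 ?F" by (simp_all add: cycle_edge_def)
        then have "(i = 2 \<or> i mod 3 = 1) \<and> (Suc i = 2 \<or> Suc i mod 3 = 1)" by (auto simp: F)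
        then have "i = 1" by presburger
        then show ?thesis by (simp add: cycle_edge_def)
      qed (simp add: cycle_edge_def)
    qed
    show "insert b0 ?F \<in> ?\<Delta>"
    proof (cases "n mod 3 = 1")
      case True
      then have b0: "b0 = n - 1" "(n - 1) mod 3 = 0" unfolding b0_def by (simp, presburger)
      show ?thesis
      proof (rule cycle_matching_complexI[where x = n])
        show "insert b0 ?F \<subseteq> {1..n}" using n b0 by (auto simp: dominating_set_def)
        fix i assume i: "i \<in> {1..n}" "cycle_edge n i \<subseteq> insert b0 ?F"
        show "n \<in> cycle_edge n i"
        proof (cases "i = n")
          case False
          with i(2) have "i \<in> insert b0 ?F" "Suc i \<in> insert b0 ?F" by (simp_all add: cycle_edge_def)
          then have "(i = n - 1 \<or> i mod 3 = 1) \<and> (Suc i = n - 1 \<or> Suc i mod 3 = 1)" by (auto simp: F b0(1))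
          then have "Suc i = n" using b0(2) n by presburger
          then show ?thesis by (simp add: cycle_edge_def)
        qed (simp add: cycle_edge_def)
      qed
    next
      case False
      then have b0: "b0 = 3" by (simp add: b0_def)
      show ?thesis
      proof (rule cycle_matching_complexI[where x = 3])
        show "insert b0 ?F \<subseteq> {1..n}" using n b0 by (auto simp: dominating_set_def)
        fix i assume i: "i \<in> {1..n}" "cycle_edge n i \<subseteq> insert b0 ?F"
        then have "i \<in> insert 3 ?F" by (simp add: cycle_edge_def b0)
        then have i3: "i = 3 \<or> i mod 3 = 1" by (auto simp: F)
        with False n have "i \<noteq> n" by auto
        with i(2) have "Suc i \<in> insert 3 ?F" by (simp add: cycle_edge_def b0)
        then have "Suc i = 3 \<or> Suc i mod 3 = 1" by (auto simp: F)
        with i3 have "i = 3" by presburger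
        then show "3 \<in> cycle_edge n i" by (simp add: cycle_edge_def)
      qed
    qed
    fix a b assume a: "a \<in> P" and b: "b \<in> {1..n} - ?F - P"
    \<comment> \<open>The edge joins \<open>b\<close> to its neighbour in the dominating set:
      \<open>k\<close> is the predecessor of \<open>b\<close> if \<open>b mod 3 = 2\<close>, and
      \<open>b\<close> itself if \<open>b mod 3 = 0\<close>. It avoids 1 and 2, and also
      \<open>n\<close> whenever \<open>n\<close> can belong to \<open>P\<close>.\<close>
    have "\<exists>k. 3 \<le> k \<and> k < n \<and> {k, Suc k} \<subseteq> insert b ?F \<and> (n mod 3 = 0 \<longrightarrow> Suc k \<noteq> n)"
    proof -
      have bn: "1 \<le> b" "b \<le> n" "b \<noteq> 2" "b mod 3 \<noteq> 1" "n mod 3 = 0 \<longrightarrow> b \<noteq> n"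
        using b by (auto simp: F P_def split: if_splits)
      show ?thesis
      proof (cases "b mod 3 = 2")
        case True
        define q where "q = b div 3"
        have q: "b = 3 * q + 2" using mult_div_mod_eq[of 3 b] True by (simp add: q_def)
        then have "q \<noteq> 0" using bn(3) by auto
        moreover have "(3 * q + 1) mod 3 = 1" by simp
        ultimately show ?thesis using bn(2,5) q by (intro exI[of _ "3 * q + 1"]) (auto simp: F)
      next
        case False
        have "b mod 3 < 3" by simp
        with False bn(4) have b0: "b mod 3 = 0" by linarith
        define q where "q = b div 3"
        have q: "b = 3 * q" using mult_div_mod_eq[of 3 b] b0 by (simp add: q_def)
        then have "q \<noteq> 0" using bn(1) by auto
        moreover have "b \<noteq> n" using bn(5) b0 by auto
        moreover have "Suc b mod 3 = 1" using q by simp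
        ultimately show ?thesis using bn(2) q by (intro exI[of _ b]) (auto simp: F)
      qed
    qed
    then obtain k where k: "3 \<le> k" "k < n" "{k, Suc k} \<subseteq> insert b ?F" "n mod 3 = 0 \<longrightarrow> Suc k \<noteq> n"
      by (elim exE conjE)
    have ek: "cycle_edge n k = {k, Suc k}" using k by (simp add: cycle_edge_def)
    have "1 \<in> ?F" using n by (simp add: F)
    \<comment> \<open>This is the edge at 1 created by \<open>a\<close>: \<open>{1, 2}\<close> for
      \<open>a = 2\<close> and \<open>{n, 1}\<close> for \<open>a = n\<close>.\<close>
    obtain j where j: "j \<in> {1..n}" "cycle_edge n j \<subseteq> insert a ?F" "cycle_edge n j \<inter> {k, Suc k} = {}"
    proof (cases "a = 2")
      case True
      have "cycle_edge n 1 = {1, 2}" using n by (simp add: cycle_edge_def numeral_2_eq_2)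
      with True \<open>1 \<in> ?F\<close> k n show ?thesis by (intro that[of 1]) auto
    next
      case False
      then have "a = n" "n mod 3 = 0" using a by (auto simp: P_def split: if_splits)
      moreover have "cycle_edge n n = {n, 1}" by (simp add: cycle_edge_def)
      ultimately show ?thesis using \<open>1 \<in> ?F\<close> k n by (intro that[of n]) auto
    qed
    show "insert a (insert b ?F) \<notin> ?\<Delta>"
    proof
      assume "insert a (insert b ?F) \<in> ?\<Delta>"
      from cycle_matching_complexD[OF this j(1), of k] j k show False unfolding ek by auto
    qed
  qed simp
  then show ?thesis by (simp add: card_dominating_set)
qed

theorem corollary4p11:
  fixes n :: nat
  assumes "n \<ge> 4"
  shows "depth_quotient (cycle_vertices n)
           (squarefree_square (cycle_vertices n)
              (edge_ideal (cycle_vertices n) (cycle_edges n)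
                 :: ((nat \<Rightarrow>\<^sub>0 nat) \<Rightarrow>\<^sub>0 'k::field) set))
         = enat (nat \<lceil>real n / 3\<rceil> + 1)"
proof -
  let ?V = "{1..n}" and ?\<Delta> = "cycle_matching_complex n"
  let ?N = "nonface_ideal ?V ?\<Delta> :: ((nat \<Rightarrow>\<^sub>0 nat) \<Rightarrow>\<^sub>0 'k) set"
  have V: "cycle_vertices n = ?V" by (simp add: cycle_vertices_def)
  have "squarefree_square (cycle_vertices n) (edge_ideal (cycle_vertices n) (cycle_edges n)) =
      (nonface_ideal (cycle_vertices n) ?\<Delta> :: ((nat \<Rightarrow>\<^sub>0 nat) \<Rightarrow>\<^sub>0 'k) set)"
    by (rule squarefree_square_edge_ideal) (use assms cycle_edges_wf[of n] in auto)
  moreover have "depth_quotient ?V ?N = enat ((n + 2) div 3 + 1)"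
  proof (rule antisym)
    show "depth_quotient ?V ?N \<le> enat ((n + 2) div 3 + 1)" by (rule depth_cycle_le[OF assms])
    have "{} \<in> ?\<Delta>" by (rule cycle_matching_complexI[where x = 0]) (auto simp: cycle_edge_def)
    then show "enat ((n + 2) div 3 + 1) \<le> depth_quotient ?V ?N"
      using assms by (intro depth_ge_if_splits down_closed_matching_complex splits_cycle_matching_complex) auto
  qed
  moreover have "\<lceil>real n / 3\<rceil> = int ((n + 2) div 3)"
  proof (rule ceiling_unique)
    have "3 * ((n + 2) div 3) \<le> n + 2" "n + 2 < 3 * ((n + 2) div 3) + 3" by presburger+
    then have "3 * real ((n + 2) div 3) \<le> real n + 2" "real n + 2 < 3 * real ((n + 2) div 3) + 3"
      by (simp_all flip: of_nat_less_iff of_nat_le_iff)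
    moreover have "n \<le> 3 * ((n + 2) div 3)" by presburger
    then have "real n \<le> 3 * real ((n + 2) div 3)" by (simp flip: of_nat_le_iff)
    ultimately show "real_of_int (int ((n + 2) div 3)) - 1 < real n / 3" "real n / 3 \<le> real_of_int (int ((n + 2) div 3))"
      by simp_all
  qed
  ultimately show ?thesis by (simp add: V)
qed

end
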